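(* For each $n$ consider the multinomial model described in the context with $d=d_n$, parameter space $\Theta_n$, and ground truth $\theta_n^*\in\Theta_n$, and let $\pi_{v_n},\gamma_n^*,M_{0n}^*,\delta^*_{01n},\theta^*_{\min,n}$ be the corresponding objects. If $M_{0n}^*=\mathcal O(1)$, $\delta^*_{01n}(s)=o(\sqrt n)$ for each $s\geq0$, and $$\frac{d_n^2}{n\,\theta^*_{\min,n}}=o(1),$$ then $\mathrm{TV}(\pi_{v_n},\gamma_n^* )\to0$ with probability tending to $1$ as $n\to\infty$; that is, for every $\epsilon>0$, the probability that the MLE exists uniquely and $\mathrm{TV}(\pi_{v_n},\gamma_n^* )\le\epsilon$ tends to $1$ as $n\to\infty$.
   Context: Model (for each $n$; index $n$ suppressed). $\Theta=\{\theta=(\theta_1,\dots,\theta_d)\in\mathbb R^d:\theta_j>0\ \forall j=1,\dots,d,\ \theta_1+\dots+\theta_d<1\}$; for $\theta\in\mathbb R^d$ set $\theta_0=1-\sum_{j=1}^d\theta_j$, so that for $\theta\in\Theta$, $(\theta_0,\dots,\theta_d)$ is a strictly positive probability mass function on $d+1$ states. For a ground truth $\theta^*\in\Theta$, one observes counts $N=(N_0,\dots,N_d)\sim\mathrm{Multinomial}(n,(\theta_0^*,\dots,\theta_d^* ))$; $\bar N_j=N_j/n$, and $\theta^*_{\min}=\min_{j=0,\dots,d}\theta_j^*$. Normalized negative log likelihood: $\ell(\theta)=-\sum_{j=0}^d\bar N_j\log\theta_j$, $\theta\in\Theta$, regarded as a function of the free parameters $\theta_1,\dots,\theta_d$. The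 MLE is $\hat\theta=\arg\min_{\theta\in\Theta}\ell(\theta)$ when it exists and is unique. The Fisher information matrix is $F^*=\mathrm{diag}\big((1/\theta_j^* )_{j=1}^d\big)+\frac1{\theta_0^*}\mathbf 1\mathbf 1^\top\in\mathbb R^{d\times d}$, with $\mathbf 1$ the all-ones vector. The prior is a probability density $\pi_0$ strictly positive on $\Theta$; the posterior is $\pi_v(\theta)\propto e^{-n\ell(\theta)}\pi_0(\theta)$, $\theta\in\Theta$; and $\gamma^*=\mathcal N(\hat\theta,(nF^* )^{-1})$. $|u|_{F^*}=|(F^* )^{1/2}u|$; for a gradient vector $S$, $\|S\|_{F^*}=|(F^* )^{-1/2}S|$. $\mathcal U^*(s)=\{\theta\in\mathbb R^d:|\theta-\theta^*|_{F^*}\le s\sqrt{d/n}\}$; $\delta_{01}^*(s)=\sup_{\theta\in\mathcal U^*(s)}\|\nabla\log\pi_0(\theta)\|_{F^*}$, with $\delta_{01}^*(s)=\infty$ if $\pi_0$ is not $C^1$ or not strictly positive on $\mathcal U^*(s)$; $M_0^*=d^{-1}\log\sup_{\theta\in\Theta}\pi_0(\theta)/\pi_0(\theta^* )$. $\mathrm{TV}(P,Q)=\sup_B|P(B)-Q(B)|$. *)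

theory Defs
  imports
    "HOL-Probability.Probability"
    "Jordan_Normal_Form.Gauss_Jordan_Elimination"
    "Jordan_Normal_Form.Determinant"
begin

hide_const (open) Finite_Cartesian_Product.vec Finite_Cartesian_Product.mat Determinants.det

text \<open>
  The dimension \<open>d\<close> varies with the sample size, so it cannot be a type index. A point of
  \<open>\<real>\<^sup>d\<close> is a function \<open>nat \<Rightarrow> real\<close> in \<open>extensional {1..d}\<close> (arbitrary but fixed outside
  \<open>{1..d}\<close>), with the usual product topology and Lebesgue product measure. For linear algebra
  it is converted to a vector, whose indices start at 0.
\<close>

abbreviation Rd :: "nat \<Rightarrow> (nat \<Rightarrow> real) set" where
  "Rd d \<equiv> extensional {1..d}"

definition lebesgue_Rd :: "nat \<Rightarrow> (nat \<Rightarrow> real) measure" where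
  "lebesgue_Rd d = PiM {1..d} (\<lambda>_. lborel)"

definition vec_of :: "nat \<Rightarrow> (nat \<Rightarrow> real) \<Rightarrow> real Matrix.vec" where
  "vec_of d x = Matrix.vec d (\<lambda>i. x (Suc i))"


section \<open>Matrices, norms and Gaussian measures\<close>

definition enorm :: "real Matrix.vec \<Rightarrow> real" where
  "enorm v = sqrt (scalar_prod v v)"

definition mat_inv :: "real Matrix.mat \<Rightarrow> real Matrix.mat" where
  "mat_inv A = the (mat_inverse A)"

definition psd_mat :: "nat \<Rightarrow> real Matrix.mat \<Rightarrow> bool" where
  "psd_mat d A \<longleftrightarrow> A \<in> carrier_mat d d \<and> transpose_mat A = A
     \<and> (\<forall>v\<in>carrier_vec d. 0 \<le> scalar_prod v (mult_mat_vec A v))"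

definition mat_sqrt :: "real Matrix.mat \<Rightarrow> real Matrix.mat" where
  "mat_sqrt A = (SOME R. psd_mat (dim_row A) R \<and> R * R = A)"

definition wnorm :: "real Matrix.mat \<Rightarrow> real Matrix.vec \<Rightarrow> real" where
  "wnorm F u = enorm (mult_mat_vec (mat_sqrt F) u)"

definition dual_wnorm :: "real Matrix.mat \<Rightarrow> real Matrix.vec \<Rightarrow> real" where
  "dual_wnorm F S = enorm (mult_mat_vec (mat_inv (mat_sqrt F)) S)"

definition mvn_density ::
    "nat \<Rightarrow> (nat \<Rightarrow> real) \<Rightarrow> real Matrix.mat \<Rightarrow> (nat \<Rightarrow> real) \<Rightarrow> real" where
  "mvn_density d \<mu> \<Sigma> x =
     (let u = vec_of d (\<lambda>j. x j - \<mu> j)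
      in exp (- scalar_prod u (mult_mat_vec (mat_inv \<Sigma>) u) / 2)
           / sqrt ((2 * pi) ^ d * Determinant.det \<Sigma>))"

definition mvn :: "nat \<Rightarrow> (nat \<Rightarrow> real) \<Rightarrow> real Matrix.mat \<Rightarrow> (nat \<Rightarrow> real) measure" where
  "mvn d \<mu> \<Sigma> = density (lebesgue_Rd d) (\<lambda>x. ennreal (mvn_density d \<mu> \<Sigma> x))"

text \<open>Only meant for probability measures on the same sigma-algebra.\<close>

definition TV :: "'b measure \<Rightarrow> 'b measure \<Rightarrow> real" where
  "TV P Q = (SUP B\<in>sets P. \<bar>measure P B - measure Q B\<bar>)"


section \<open>Partial derivatives\<close>

definition partial :: "nat \<Rightarrow> ((nat \<Rightarrow> real) \<Rightarrow> real) \<Rightarrow> (nat \<Rightarrow> real) \<Rightarrow> real" where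
  "partial j f x = deriv (\<lambda>t. f (x(j := t))) (x j)"

definition grad :: "nat \<Rightarrow> ((nat \<Rightarrow> real) \<Rightarrow> real) \<Rightarrow> (nat \<Rightarrow> real) \<Rightarrow> real Matrix.vec" where
  "grad d f x = vec_of d (\<lambda>j. partial j f x)"

text \<open>
  \<open>C\<^sup>1\<close> on an arbitrary subset of \<open>\<real>\<^sup>d\<close>: all partial derivatives exist and are continuous on
  an open neighbourhood of the set.
\<close>

definition C1_on :: "nat \<Rightarrow> ((nat \<Rightarrow> real) \<Rightarrow> real) \<Rightarrow> (nat \<Rightarrow> real) set \<Rightarrow> bool" where
  "C1_on d f S \<longleftrightarrow>
     (\<exists>W. openin (top_of_set (Rd d)) W \<and> S \<subseteq> W \<and>
        (\<forall>j\<in>{1..d}. (\<forall>x\<in>W. (\<lambda>t. f (x(j := t))) differentiable (at (x j)))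
           \<and> continuous_on W (partial j f)))"


section \<open>The multinomial model\<close>

definition Theta :: "nat \<Rightarrow> (nat \<Rightarrow> real) set" where
  "Theta d = {\<theta> \<in> Rd d. (\<forall>j\<in>{1..d}. 0 < \<theta> j) \<and> (\<Sum>j=1..d. \<theta> j) < 1}"

text \<open>The full vector \<open>(\<theta>\<^sub>0, \<dots>, \<theta>\<^sub>d)\<close> with \<open>\<theta>\<^sub>0 = 1 - (\<theta>\<^sub>1 + \<dots> + \<theta>\<^sub>d)\<close>.\<close>

definition cell :: "nat \<Rightarrow> (nat \<Rightarrow> real) \<Rightarrow> nat \<Rightarrow> real" where
  "cell d \<theta> j = (if j = 0 then 1 - (\<Sum>k=1..d. \<theta> k) else \<theta> j)"

definition theta_min :: "nat \<Rightarrow> (nat \<Rightarrow> real) \<Rightarrow> real" where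
  "theta_min d \<theta> = Min (cell d \<theta> ` {0..d})"

definition multinomial_counts ::
    "'a measure \<Rightarrow> ('a \<Rightarrow> nat \<Rightarrow> nat) \<Rightarrow> nat \<Rightarrow> nat \<Rightarrow> (nat \<Rightarrow> real) \<Rightarrow> bool" where
  "multinomial_counts M N n d p \<longleftrightarrow>
     (\<forall>j\<in>{0..d}. (\<lambda>\<omega>. N \<omega> j) \<in> measurable M (count_space UNIV)) \<and>
     (\<forall>k. (\<Sum>j=0..d. k j) = n \<longrightarrow>
        measure M {\<omega> \<in> space M. \<forall>j\<in>{0..d}. N \<omega> j = k j}
          = fact n / (\<Prod>j=0..d. fact (k j)) * (\<Prod>j=0..d. p j ^ k j))"

definition nll :: "nat \<Rightarrow> nat \<Rightarrow> (nat \<Rightarrow> nat) \<Rightarrow> (nat \<Rightarrow> real) \<Rightarrow> real" where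
  "nll n d N \<theta> = - (\<Sum>j=0..d. real (N j) / real n * ln (cell d \<theta> j))"

definition is_mle :: "nat \<Rightarrow> nat \<Rightarrow> (nat \<Rightarrow> nat) \<Rightarrow> (nat \<Rightarrow> real) \<Rightarrow> bool" where
  "is_mle n d N = is_arg_min (nll n d N) (\<lambda>\<theta>. \<theta> \<in> Theta d)"

definition mle :: "nat \<Rightarrow> nat \<Rightarrow> (nat \<Rightarrow> nat) \<Rightarrow> (nat \<Rightarrow> real)" where
  "mle n d N = (THE \<theta>. is_mle n d N \<theta>)"

definition fisher :: "nat \<Rightarrow> (nat \<Rightarrow> real) \<Rightarrow> real Matrix.mat" where
  "fisher d \<theta>s = mat_diag d (\<lambda>i. 1 / \<theta>s (Suc i))
     + smult_mat (1 / cell d \<theta>s 0) (Matrix.mat d d (\<lambda>_. 1))"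

text \<open>
  The prior is a Lebesgue density on \<open>\<real>\<^sup>d\<close>, strictly positive on the parameter space; it may,
  but need not, vanish outside.
\<close>

definition prior_density :: "nat \<Rightarrow> ((nat \<Rightarrow> real) \<Rightarrow> real) \<Rightarrow> bool" where
  "prior_density d \<pi>0 \<longleftrightarrow>
     \<pi>0 \<in> borel_measurable (lebesgue_Rd d) \<and> (\<forall>\<theta>\<in>Rd d. 0 \<le> \<pi>0 \<theta>) \<and>
     (\<integral>\<^sup>+ \<theta>. ennreal (\<pi>0 \<theta>) \<partial>lebesgue_Rd d) = 1 \<and> (\<forall>\<theta>\<in>Theta d. 0 < \<pi>0 \<theta>)"

definition posterior ::
    "nat \<Rightarrow> nat \<Rightarrow> ((nat \<Rightarrow> real) \<Rightarrow> real) \<Rightarrow> (nat \<Rightarrow> nat) \<Rightarrow> (nat \<Rightarrow> real) measure" where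
  "posterior n d \<pi>0 N =
     (let g = (\<lambda>\<theta>. indicator (Theta d) \<theta> * (exp (- real n * nll n d N \<theta>) * \<pi>0 \<theta>))
      in density (lebesgue_Rd d) (\<lambda>\<theta>. ennreal (g \<theta> / (\<integral>\<eta>. g \<eta> \<partial>lebesgue_Rd d))))"

definition gamma_star ::
    "nat \<Rightarrow> nat \<Rightarrow> (nat \<Rightarrow> real) \<Rightarrow> (nat \<Rightarrow> nat) \<Rightarrow> (nat \<Rightarrow> real) measure" where
  "gamma_star n d \<theta>s N = mvn d (mle n d N) (mat_inv (smult_mat (real n) (fisher d \<theta>s)))"

definition U_star :: "nat \<Rightarrow> nat \<Rightarrow> (nat \<Rightarrow> real) \<Rightarrow> real \<Rightarrow> (nat \<Rightarrow> real) set" where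
  "U_star n d \<theta>s s = {\<theta> \<in> Rd d.
     wnorm (fisher d \<theta>s) (vec_of d (\<lambda>j. \<theta> j - \<theta>s j)) \<le> s * sqrt (real d / real n)}"

definition delta01 ::
    "nat \<Rightarrow> nat \<Rightarrow> (nat \<Rightarrow> real) \<Rightarrow> ((nat \<Rightarrow> real) \<Rightarrow> real) \<Rightarrow> real \<Rightarrow> ereal" where
  "delta01 n d \<theta>s \<pi>0 s =
     (if C1_on d \<pi>0 (U_star n d \<theta>s s) \<and> (\<forall>\<theta>\<in>U_star n d \<theta>s s. 0 < \<pi>0 \<theta>)
      then (SUP \<theta>\<in>U_star n d \<theta>s s.
              ereal (dual_wnorm (fisher d \<theta>s) (grad d (\<lambda>\<theta>. ln (\<pi>0 \<theta>)) \<theta>)))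
      else \<infinity>)"

text \<open>Infinite when the prior density is unbounded on the parameter space.\<close>

definition M0 :: "nat \<Rightarrow> (nat \<Rightarrow> real) \<Rightarrow> ((nat \<Rightarrow> real) \<Rightarrow> real) \<Rightarrow> ereal" where
  "M0 d \<theta>s \<pi>0 =
     (if bdd_above (\<pi>0 ` Theta d)
      then ereal (ln ((SUP \<theta>\<in>Theta d. \<pi>0 \<theta>) / \<pi>0 \<theta>s) / real d)
      else \<infinity>)"

end

theory Submission
  imports Defs
begin

text \<open>
  On the event that the chi-square statistic \<open>\<Sum>\<^sub>j (N\<^sub>j/n - \<theta>\<^sup>*\<^sub>j)\<^sup>2 / \<theta>\<^sup>*\<^sub>j\<close>
  is at most \<open>s\<^sup>2 d/n\<close>, whose probability is at least \<open>1 - 1/s\<^sup>2\<close>, the MLE is the vector of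
  observed frequencies and everything else is deterministic. An explicit Cholesky factor of the
  inverse Fisher information turns \<open>\<gamma>\<^sup>*\<close> into the standard Gaussian and the posterior into a density
  \<open>\<rho>\<close> relative to it. On the ball of radius \<open>A \<surd>d\<close> the gradient of \<open>log \<rho>\<close> is at most
  \<open>\<surd>8 A\<^sup>2 d / \<surd>(n \<theta>\<^sub>m\<^sub>i\<^sub>n) + \<delta>\<^sub>0\<^sub>1 / \<surd>n\<close>, which tends to 0. The Gaussian Poincare
  inequality, applied to \<open>\<surd>\<rho>\<close> times a cutoff, then bounds the Hellinger distance of the two
  measures up to the posterior mass outside a smaller ball. By convexity the negative log likelihood
  grows linearly along rays, so this mass is exponentially small in \<open>d\<close>.
\<close>

section \<open>The Gaussian Poincare inequality\<close>

text \<open>The obstacle is the power of the dimension. The gradient bound on the ball is small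
  under the hypothesis, but integrating it along a radius costs a further factor of order
  \<open>sqrt d\<close>, so \<open>ln \<rho>\<close> itself need not be small there and a pointwise
  comparison of the densities would demand more. The Poincare inequality has constant 1 in every
  dimension and sees only the gradient, so nothing is lost. The cutoff is forced because the score
  of the prior is controlled only near the ground truth. The order of choices matters: the tolerated
  failure probability fixes \<open>s\<close>, the accuracy and the bound on \<open>M0\<close> fix
  \<open>R\<close>, then \<open>A\<close> is taken large, and only then does \<open>n\<close> grow;
  the hypothesis on \<open>delta01\<close> is thus used at the single radius \<open>2 * A\<close>.
  The norms in the hypotheses involve a matrix square root given by a choice operator, so its
  existence has to be proved. The Cholesky factor is used in place of the symmetric root as change
  of variables because it is triangular: Lebesgue measure is then transformed one coordinate at a
  time, and the determinant can be read off.\<close>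

abbreviation stdN :: "real measure" where
  "stdN \<equiv> density lborel (\<lambda>x. ennreal (std_normal_density x))"

lemma prob_space_stdN: "prob_space stdN"
  using prob_space_normal_density[of 1 0] by simp

lemma sets_stdN [measurable_cong, simp]: "sets stdN = sets borel"
  by simp

lemma deriv_tendsto_quotient:
  fixes f :: "real \<Rightarrow> real"
  assumes "(f has_real_derivative D) (at x)"
  shows "(\<lambda>n. (f (x + 1 / real (Suc n)) - f x) * real (Suc n)) \<longlonglongrightarrow> D"
proof -
  have "((\<lambda>h. (f (x + h) - f x) / h) \<longlongrightarrow> D) (at 0)"
    using assms by (simp add: DERIV_def)
  moreover have "filterlim (\<lambda>n. 1 / real (Suc n)) (at 0) sequentially"
    unfolding filterlim_at using LIMSEQ_Suc[OF lim_1_over_n[where 'a=real]] by simp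
  ultimately have "(\<lambda>n. (f (x + 1 / real (Suc n)) - f x) / (1 / real (Suc n))) \<longlonglongrightarrow> D"
    by (rule filterlim_compose)
  then show ?thesis by simp
qed

section \<open>The one-dimensional inequality\<close>

lemma integrable_Icc_bounded:
  fixes f :: "real \<Rightarrow> real"
  assumes f[measurable]: "f \<in> borel_measurable borel" and bd: "\<And>t. \<bar>f t\<bar> \<le> B"
  shows "integrable lborel (\<lambda>t. indicator {a..b} t *\<^sub>R f t)"
proof (rule integrableI_bounded_set_indicator[where B=B])
  show "emeasure lborel {a..b} < \<infinity>" by (simp add: emeasure_lborel_Icc_eq)
  show "AE x in lborel. x \<in> {a..b} \<longrightarrow> norm (f x) \<le> B" using bd by simp
qed auto

text \<open>Cauchy-Schwarz on an interval, applied to the increment as the integral of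
  \<open>f'\<close>. The extended nonnegative form is the one that can be inserted into Tonelli's
  theorem.\<close>

lemma increment_sq_le_integral_deriv_sq:
  fixes f f' :: "real \<Rightarrow> real"
  assumes der: "\<And>t. (f has_real_derivative f' t) (at t)"
    and bd: "\<And>t. \<bar>f' t\<bar> \<le> B" and ab: "a \<le> b"
    and f'[measurable]: "f' \<in> borel_measurable borel"
  shows "ennreal ((f b - f a)\<^sup>2) \<le> ennreal (b - a) * (\<integral>\<^sup>+ t. ennreal ((f' t)\<^sup>2) * indicator {a..b} t \<partial>lborel)"
proof -
  have i1: "integrable lborel (\<lambda>t. indicator {a..b} t *\<^sub>R f' t)"
    by (rule integrable_Icc_bounded[OF f' bd])
  have bd2: "(f' t)\<^sup>2 \<le> B\<^sup>2" for t
    using power_mono[OF bd[of t], of 2] by simp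
  have i2: "integrable lborel (\<lambda>t. indicator {a..b} t *\<^sub>R (f' t)\<^sup>2)"
    by (rule integrable_Icc_bounded[where B="B\<^sup>2"]) (measurable, use bd2 in simp)
  have i0: "integrable lborel (\<lambda>t. indicator {a..b} t *\<^sub>R (1::real))"
    by (rule integrable_Icc_bounded[where B=1]) auto
  \<comment> \<open>The fundamental theorem yields the gauge integral of \<open>f'\<close>;
    uniqueness then identifies it with the Lebesgue integral, so \<open>f'\<close> may be
    discontinuous.\<close>
  have "(f' has_integral f b - f a) {a..b}"
    using ab der by (intro fundamental_theorem_of_calculus)
      (auto simp: has_real_derivative_iff_has_vector_derivative[symmetric] intro: has_field_derivative_at_within)
  moreover have "((\<lambda>t. indicator {a..b} t *\<^sub>R f' t) has_integral (\<integral>t. indicator {a..b} t *\<^sub>R f' t \<partial>lborel)) UNIV"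
    by (rule has_integral_integral_lborel) (rule i1)
  then have "(f' has_integral (\<integral>t. indicator {a..b} t *\<^sub>R f' t \<partial>lborel)) {a..b}"
    by (simp only: indicator_scaleR_eq_if has_integral_restrict_UNIV)
  ultimately have I1: "(\<integral>t. indicator {a..b} t *\<^sub>R f' t \<partial>lborel) = f b - f a"
    by (metis has_integral_unique)
  have I0: "(\<integral>t. indicator {a..b} t *\<^sub>R (1::real) \<partial>lborel) = b - a"
    using ab by simp
  define J where "J = (\<integral>t. indicator {a..b} t *\<^sub>R (f' t)\<^sup>2 \<partial>lborel)"
  have ineq: "(f b - f a)\<^sup>2 \<le> (b - a) * J"
  proof (cases "a = b")
    case False
    \<comment> \<open>The mean slope: the integral of the square of \<open>f' - c\<close> is
      nonnegative, and this is exactly the Cauchy-Schwarz inequality sought.\<close>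
    define c where "c = (f b - f a) / (b - a)"
    have "0 \<le> (\<integral>t. indicator {a..b} t *\<^sub>R (f' t - c)\<^sup>2 \<partial>lborel)" by simp
    also have "\<dots> = (\<integral>t. indicator {a..b} t *\<^sub>R (f' t)\<^sup>2 - (2 * c) * (indicator {a..b} t *\<^sub>R f' t)
        + c\<^sup>2 * (indicator {a..b} t *\<^sub>R 1) \<partial>lborel)"
      by (intro Bochner_Integration.integral_cong) (auto simp: power2_eq_square algebra_simps)
    also have "\<dots> = J - 2 * c * (f b - f a) + c\<^sup>2 * (b - a)"
      unfolding J_def I1[symmetric] I0[symmetric] using i0 i1 i2
      by (subst Bochner_Integration.integral_add Bochner_Integration.integral_diff; simp)+
    finally have "0 \<le> J - 2 * c * (f b - f a) + c\<^sup>2 * (b - a)" .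
    moreover have "c\<^sup>2 * (b - a) = c * (f b - f a)" "c * (f b - f a) = (f b - f a)\<^sup>2 / (b - a)"
      using False by (auto simp: c_def power2_eq_square)
    ultimately have "(f b - f a)\<^sup>2 / (b - a) \<le> J" by linarith
    then show ?thesis using False ab by (simp add: divide_le_eq mult.commute)
  qed (simp add: J_def)
  have "(\<integral>\<^sup>+ t. ennreal ((f' t)\<^sup>2) * indicator {a..b} t \<partial>lborel)
      = (\<integral>\<^sup>+ t. ennreal (indicator {a..b} t *\<^sub>R (f' t)\<^sup>2) \<partial>lborel)"
    by (intro nn_integral_cong) (auto split: split_indicator)
  also have "\<dots> = ennreal J" unfolding J_def
    by (rule nn_integral_eq_integral[OF i2]) auto
  finally show ?thesis using ineq ab
    by (simp add: J_def ennreal_mult[symmetric] ennreal_leI)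
qed

text \<open>The derivative of the standard normal density is \<open>- x\<close> times the density.
  This identity is what makes the Poincare constant exactly 1.\<close>

lemma std_normal_tail_integral:
  "(\<integral>\<^sup>+ x. ennreal (x * std_normal_density x) * indicator {t..} x \<partial>lborel) = ennreal (std_normal_density t)"
  if "0 \<le> t"
proof -
  have "(\<integral>\<^sup>+ x. ennreal (x * std_normal_density x) * indicator {t..} x \<partial>lborel)
     = ennreal (0 - (- std_normal_density t))"
  proof (rule nn_integral_FTC_atLeast)
    show "((\<lambda>x. - std_normal_density x) has_real_derivative x * std_normal_density x) (at x)" if "t \<le> x" for x
      unfolding std_normal_density_def by (auto intro!: derivative_eq_intros simp: power2_eq_square field_simps)
    have "((\<lambda>x. - (1 / sqrt (2 * pi)) * exp (- x\<^sup>2 / 2)) \<longlongrightarrow> - (1 / sqrt (2 * pi)) * 0) at_top"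
      by (intro tendsto_mult tendsto_const filterlim_compose[OF exp_at_bot] ) (real_asymp)
    then show "((\<lambda>x. - std_normal_density x) \<longlongrightarrow> 0) at_top"
      unfolding std_normal_density_def by simp
  qed (use that in auto)
  then show ?thesis by simp
qed

text \<open>The increment from 0 is bounded by \<open>\<bar>x\<bar>\<close> times the integral of
  \<open>f'\<close> squared between 0 and \<open>x\<close>. After exchanging the integrals, the
  weight at \<open>t\<close> is the Gaussian integral of \<open>\<bar>x\<bar>\<close> beyond
  \<open>t\<close>, which is the density at \<open>t\<close> itself.\<close>

lemma nn_integral_square_increment_std_normal:
  fixes f f' :: "real \<Rightarrow> real"
  assumes der: "\<And>t. (f has_real_derivative f' t) (at t)"
    and bd: "\<And>t. \<bar>f' t\<bar> \<le> B"
    and f'[measurable]: "f' \<in> borel_measurable borel"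
  shows "(\<integral>\<^sup>+ x. ennreal ((f x - f 0)\<^sup>2) \<partial>stdN) \<le> (\<integral>\<^sup>+ x. ennreal ((f' x)\<^sup>2) \<partial>stdN)"
proof -
  \<comment> \<open>\<open>S x t\<close> says that \<open>t\<close> lies between 0 and
    \<open>x\<close>, with 0 excluded. It treats both signs of \<open>x\<close> at once; the
    excluded point is a null set.\<close>
  define S where "S x t \<longleftrightarrow> 0 < t \<and> t \<le> x \<or> t < 0 \<and> x \<le> t" for x t :: real
  have [measurable]: "Measurable.pred (borel \<Otimes>\<^sub>M borel) (\<lambda>(x, t). S x t)"
    unfolding S_def by measurable
  have f[measurable]: "f \<in> borel_measurable borel"
    using der by (intro borel_measurable_continuous_onI)
      (auto intro!: continuous_at_imp_continuous_on DERIV_isCont)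
  have ae: "AE t in lborel. t \<noteq> (0::real)"
    by (rule AE_lborel_singleton)
  have pt: "ennreal ((f x - f 0)\<^sup>2) \<le> ennreal \<bar>x\<bar> * (\<integral>\<^sup>+ t. ennreal ((f' t)\<^sup>2) * indicator {t. S x t} t \<partial>lborel)" for x
  proof (cases "0 \<le> x")
    case True
    have "(\<integral>\<^sup>+ t. ennreal ((f' t)\<^sup>2) * indicator {0..x} t \<partial>lborel) = (\<integral>\<^sup>+ t. ennreal ((f' t)\<^sup>2) * indicator {t. S x t} t \<partial>lborel)"
      using ae by (intro nn_integral_cong_AE, eventually_elim) (use True in \<open>auto simp: S_def split: split_indicator\<close>)
    then show ?thesis
      using increment_sq_le_integral_deriv_sq[OF der bd True f'] True by simp
  next
    case False
    have "(\<integral>\<^sup>+ t. ennreal ((f' t)\<^sup>2) * indicator {x..0} t \<partial>lborel) = (\<integral>\<^sup>+ t. ennreal ((f' t)\<^sup>2) * indicator {t. S x t} t \<partial>lborel)"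
      using ae by (intro nn_integral_cong_AE, eventually_elim) (use False in \<open>auto simp: S_def split: split_indicator\<close>)
    moreover have "(f 0 - f x)\<^sup>2 = (f x - f 0)\<^sup>2" by (simp add: power2_commute)
    ultimately show ?thesis
      using increment_sq_le_integral_deriv_sq[OF der bd _ f', of x 0] False by simp
  qed
  have inner: "(\<integral>\<^sup>+ x. ennreal (\<bar>x\<bar> * std_normal_density x) * indicator {x. S x t} x \<partial>lborel) \<le> ennreal (std_normal_density t)" for t
  proof (cases "0 < t")
    case True
    then have "(\<integral>\<^sup>+ x. ennreal (\<bar>x\<bar> * std_normal_density x) * indicator {x. S x t} x \<partial>lborel)
       = (\<integral>\<^sup>+ x. ennreal (x * std_normal_density x) * indicator {t..} x \<partial>lborel)"
      by (intro nn_integral_cong) (auto simp: S_def split: split_indicator)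
    then show ?thesis using std_normal_tail_integral[of t] True by simp
  next
    case F: False
    show ?thesis
    proof (cases "t = 0")
      case False
      with F have t: "t < 0" by simp
      have "(\<integral>\<^sup>+ x. ennreal (\<bar>x\<bar> * std_normal_density x) * indicator {x. S x t} x \<partial>lborel)
         = ennreal \<bar>-1\<bar> * (\<integral>\<^sup>+ x. ennreal (\<bar>0 + (-1) * x\<bar> * std_normal_density (0 + (-1) * x)) * indicator {x. S x t} (0 + (-1) * x) \<partial>lborel)"
        by (intro nn_integral_real_affine) (auto simp: S_def)
      also have "\<dots> = (\<integral>\<^sup>+ x. ennreal (x * std_normal_density x) * indicator {-t..} x \<partial>lborel)"
        using t by (simp, intro nn_integral_cong) (auto simp: S_def std_normal_density_def split: split_indicator)
      also have "\<dots> = ennreal (std_normal_density (- t))"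
        using t by (intro std_normal_tail_integral) simp
      finally show ?thesis by (simp add: std_normal_density_def)
    qed (simp add: S_def)
  qed
  have "(\<integral>\<^sup>+ x. ennreal ((f x - f 0)\<^sup>2) \<partial>stdN) = (\<integral>\<^sup>+ x. ennreal (std_normal_density x) * ennreal ((f x - f 0)\<^sup>2) \<partial>lborel)"
    by (subst nn_integral_density) auto
  also have "\<dots> \<le> (\<integral>\<^sup>+ x. ennreal (std_normal_density x) * (ennreal \<bar>x\<bar> * (\<integral>\<^sup>+ t. ennreal ((f' t)\<^sup>2) * indicator {t. S x t} t \<partial>lborel)) \<partial>lborel)"
    by (intro nn_integral_mono mult_left_mono pt) simp
  also have "\<dots> = (\<integral>\<^sup>+ x. (\<integral>\<^sup>+ t. ennreal (\<bar>x\<bar> * std_normal_density x) * indicator {x. S x t} x * ennreal ((f' t)\<^sup>2) \<partial>lborel) \<partial>lborel)"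
    by (auto intro!: nn_integral_cong simp: nn_integral_cmult[symmetric] ennreal_mult mult_ac split: split_indicator)
  also have "\<dots> = (\<integral>\<^sup>+ t. (\<integral>\<^sup>+ x. ennreal (\<bar>x\<bar> * std_normal_density x) * indicator {x. S x t} x * ennreal ((f' t)\<^sup>2) \<partial>lborel) \<partial>lborel)"
    by (rule lborel_pair.Fubini'[symmetric]) (simp add: indicator_def split_beta)
  also have "\<dots> = (\<integral>\<^sup>+ t. (\<integral>\<^sup>+ x. ennreal (\<bar>x\<bar> * std_normal_density x) * indicator {x. S x t} x \<partial>lborel) * ennreal ((f' t)\<^sup>2) \<partial>lborel)"
    by (intro nn_integral_cong nn_integral_multc) measurable
  also have "\<dots> \<le> (\<integral>\<^sup>+ t. ennreal (std_normal_density t) * ennreal ((f' t)\<^sup>2) \<partial>lborel)"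
    by (intro nn_integral_mono mult_right_mono inner) simp
  also have "\<dots> = (\<integral>\<^sup>+ x. ennreal ((f' x)\<^sup>2) \<partial>stdN)"
    by (subst nn_integral_density) auto
  finally show ?thesis .
qed

text \<open>The mean is the constant with the smallest mean square deviation, so replacing
  \<open>f 0\<close> by the mean only lowers the left side of the previous estimate.\<close>

lemma poincare_std_normal:
  fixes f f' :: "real \<Rightarrow> real"
  assumes der: "\<And>t. (f has_real_derivative f' t) (at t)"
    and bf: "\<And>t. \<bar>f t\<bar> \<le> B" and bd: "\<And>t. \<bar>f' t\<bar> \<le> B"
    and f'[measurable]: "f' \<in> borel_measurable borel"
  shows "(\<integral>x. (f x)\<^sup>2 \<partial>stdN) - (\<integral>x. f x \<partial>stdN)\<^sup>2 \<le> (\<integral>x. (f' x)\<^sup>2 \<partial>stdN)"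
proof -
  interpret prob_space stdN by (rule prob_space_stdN)
  have f[measurable]: "f \<in> borel_measurable borel"
    using der by (intro borel_measurable_continuous_onI)
      (auto intro!: continuous_at_imp_continuous_on DERIV_isCont)
  have sq: "\<bar>y\<bar> \<le> B \<Longrightarrow> y\<^sup>2 \<le> B\<^sup>2" for y
    using power_mono[of "\<bar>y\<bar>" B 2] by simp
  have i1[simp]: "integrable stdN f" by (intro integrable_const_bound[of _ B]) (simp_all add: bf)
  have i2[simp]: "integrable stdN (\<lambda>x. (f x)\<^sup>2)" by (intro integrable_const_bound[of _ "B\<^sup>2"]) (simp_all add: sq[OF bf])
  have i3[simp]: "integrable stdN (\<lambda>x. (f' x)\<^sup>2)" by (intro integrable_const_bound[of _ "B\<^sup>2"]) (simp_all add: sq[OF bd])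
  have eq: "(\<integral>x. (f x - f 0)\<^sup>2 \<partial>stdN) = (\<integral>x. (f x)\<^sup>2 \<partial>stdN) - 2 * f 0 * (\<integral>x. f x \<partial>stdN) + (f 0)\<^sup>2"
  proof -
    have "(\<integral>x. (f x - f 0)\<^sup>2 \<partial>stdN) = (\<integral>x. (f x)\<^sup>2 - (2 * f 0) * f x + (f 0)\<^sup>2 \<partial>stdN)"
      by (intro Bochner_Integration.integral_cong) (auto simp: power2_eq_square algebra_simps)
    also have "\<dots> = (\<integral>x. (f x)\<^sup>2 \<partial>stdN) - 2 * f 0 * (\<integral>x. f x \<partial>stdN) + (f 0)\<^sup>2"
      using prob_space by (subst Bochner_Integration.integral_add) (auto simp del: integral_density)
    finally show ?thesis .
  qed
  have i4: "integrable stdN (\<lambda>x. (f x - f 0)\<^sup>2)"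
  proof -
    have "integrable stdN (\<lambda>x. (f x)\<^sup>2 - (2 * f 0) * f x + (f 0)\<^sup>2)" by (intro Bochner_Integration.integrable_add Bochner_Integration.integrable_diff integrable_mult_right) auto
    then show ?thesis by (rule Bochner_Integration.integrable_cong[THEN iffD1, rotated -1]) (auto simp: power2_eq_square algebra_simps)
  qed
  have "ennreal (\<integral>x. (f x - f 0)\<^sup>2 \<partial>stdN) \<le> ennreal (\<integral>x. (f' x)\<^sup>2 \<partial>stdN)"
    using nn_integral_square_increment_std_normal[OF der bd f']
    by (simp add: nn_integral_eq_integral i4 i3 del: integral_density)
  then have "(\<integral>x. (f x - f 0)\<^sup>2 \<partial>stdN) \<le> (\<integral>x. (f' x)\<^sup>2 \<partial>stdN)"
    by (subst (asm) ennreal_le_iff) auto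
  moreover have "0 \<le> ((\<integral>x. f x \<partial>stdN) - f 0)\<^sup>2" by simp
  ultimately show ?thesis unfolding eq by (simp add: power2_eq_square algebra_simps)
qed

text \<open>The Efron-Stein inequality for two factors. The gap between the two sides is the mean
  square of the interaction term \<open>F - a - b + m\<close>, where \<open>a\<close> and
  \<open>b\<close> are the conditional means and \<open>m\<close> is the mean.\<close>

lemma (in pair_prob_space) sum_conditional_variances_ge:
  fixes F :: "'a \<Rightarrow> 'b \<Rightarrow> real"
  assumes F[measurable]: "(\<lambda>(x, y). F x y) \<in> borel_measurable (M1 \<Otimes>\<^sub>M M2)"
    and bd: "\<And>x y. x \<in> space M1 \<Longrightarrow> y \<in> space M2 \<Longrightarrow> \<bar>F x y\<bar> \<le> B"
  shows "(\<integral>x. (\<integral>y. (F x y)\<^sup>2 \<partial>M2) \<partial>M1) - (\<integral>x. (\<integral>y. F x y \<partial>M2) \<partial>M1)\<^sup>2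
    \<le> (\<integral>x. (\<integral>y. (F x y)\<^sup>2 \<partial>M2) - (\<integral>y. F x y \<partial>M2)\<^sup>2 \<partial>M1)
      + (\<integral>y. (\<integral>x. (F x y)\<^sup>2 \<partial>M1) - (\<integral>x. F x y \<partial>M1)\<^sup>2 \<partial>M2)"
proof -
  define a where "a x = (\<integral>y. F x y \<partial>M2)" for x
  define b where "b y = (\<integral>x. F x y \<partial>M1)" for y
  define m where "m = (\<integral>x. a x \<partial>M1)"
  have B0: "0 \<le> B"
    using bd M1.not_empty M2.not_empty abs_ge_zero order_trans by blast
  have [measurable]: "a \<in> borel_measurable M1" "b \<in> borel_measurable M2"
    unfolding a_def b_def by measurable
  have Fint: "integrable M2 (F x)" if "x \<in> space M1" for x
    using that bd by (intro M2.integrable_const_bound[of _ B]) (auto intro!: AE_I2)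
  have Fint': "integrable M1 (\<lambda>x. F x y)" if "y \<in> space M2" for y
    using that bd by (intro M1.integrable_const_bound[of _ B]) (auto intro!: AE_I2)
  have ab: "\<bar>a x\<bar> \<le> B" if x: "x \<in> space M1" for x
  proof -
    have "\<bar>a x\<bar> \<le> (\<integral>y. \<bar>F x y\<bar> \<partial>M2)" unfolding a_def by (rule integral_abs_bound)
    also have "\<dots> \<le> B" using x bd Fint[OF x] by (intro M2.integral_le_const) (auto intro!: AE_I2)
    finally show ?thesis .
  qed
  have bb: "\<bar>b y\<bar> \<le> B" if y: "y \<in> space M2" for y
  proof -
    have "\<bar>b y\<bar> \<le> (\<integral>x. \<bar>F x y\<bar> \<partial>M1)" unfolding b_def by (rule integral_abs_bound)
    also have "\<dots> \<le> B" using y bd Fint'[OF y] by (intro M1.integral_le_const) (auto intro!: AE_I2)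
    finally show ?thesis .
  qed
  have sq: "\<bar>t\<bar> \<le> B \<Longrightarrow> t\<^sup>2 \<le> B\<^sup>2" for t :: real
    using power_mono[of "\<bar>t\<bar>" B 2] by simp
  have pr: "\<bar>s\<bar> \<le> B \<Longrightarrow> \<bar>t\<bar> \<le> B \<Longrightarrow> \<bar>s * t\<bar> \<le> B * B" for s t :: real
    using B0 by (simp add: abs_mult mult_mono)
  let ?P = "M1 \<Otimes>\<^sub>M M2"
  note sp = space_pair_measure
  have iFF: "integrable ?P (\<lambda>(x, y). (F x y)\<^sup>2)"
    by (intro integrable_const_bound[of _ "B\<^sup>2"]) (auto simp: sp intro!: AE_I2 sq bd)
  have iF: "integrable ?P (\<lambda>(x, y). F x y)"
    by (intro integrable_const_bound[of _ B]) (auto simp: sp intro!: AE_I2 bd)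
  have iFa: "integrable ?P (\<lambda>(x, y). F x y * a x)"
    by (intro integrable_const_bound[of _ "B * B"]) (auto simp: sp intro!: AE_I2 pr bd ab)
  have iFb: "integrable ?P (\<lambda>(x, y). F x y * b y)"
    by (intro integrable_const_bound[of _ "B * B"]) (auto simp: sp intro!: AE_I2 pr bd bb)
  have iab: "integrable ?P (\<lambda>(x, y). a x * b y)"
    by (intro integrable_const_bound[of _ "B * B"]) (auto simp: sp intro!: AE_I2 pr ab bb)
  have iaa: "integrable ?P (\<lambda>(x, y). (a x)\<^sup>2)"
    by (intro integrable_const_bound[of _ "B\<^sup>2"]) (auto simp: sp intro!: AE_I2 sq ab)
  have ibb: "integrable ?P (\<lambda>(x, y). (b y)\<^sup>2)"
    by (intro integrable_const_bound[of _ "B\<^sup>2"]) (auto simp: sp intro!: AE_I2 sq bb)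
  have ia: "integrable ?P (\<lambda>(x, y). a x)"
    by (intro integrable_const_bound[of _ B]) (auto simp: sp intro!: AE_I2 ab)
  have ib: "integrable ?P (\<lambda>(x, y). b y)"
    by (intro integrable_const_bound[of _ B]) (auto simp: sp intro!: AE_I2 bb)
  define A where "A = (\<integral>x. (a x)\<^sup>2 \<partial>M1)"
  define C where "C = (\<integral>y. (b y)\<^sup>2 \<partial>M2)"
  define Q where "Q = (\<integral>x. (\<integral>y. (F x y)\<^sup>2 \<partial>M2) \<partial>M1)"
  have mb: "m = (\<integral>y. b y \<partial>M2)"
    unfolding m_def a_def b_def using Fubini_integral[OF iF] by simp
  have eFF: "(\<integral>z. (case z of (x, y) \<Rightarrow> (F x y)\<^sup>2) \<partial>?P) = Q"
    unfolding Q_def using integral_fst[OF iFF] by simp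
  have Q': "Q = (\<integral>y. (\<integral>x. (F x y)\<^sup>2 \<partial>M1) \<partial>M2)"
    unfolding Q_def using Fubini_integral[OF iFF] by simp
  have eF: "(\<integral>z. (case z of (x, y) \<Rightarrow> F x y) \<partial>?P) = m"
    unfolding m_def a_def using integral_fst[OF iF] by simp
  have eFa: "(\<integral>z. (case z of (x, y) \<Rightarrow> F x y * a x) \<partial>?P) = A"
    unfolding A_def using integral_fst[OF iFa] by (simp add: a_def[symmetric] power2_eq_square)
  have eFb: "(\<integral>z. (case z of (x, y) \<Rightarrow> F x y * b y) \<partial>?P) = C"
    unfolding C_def using integral_snd[OF iFb] by (simp add: b_def[symmetric] power2_eq_square)
  have eab: "(\<integral>z. (case z of (x, y) \<Rightarrow> a x * b y) \<partial>?P) = m\<^sup>2"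
    using integral_fst[OF iab] by (simp add: mb[symmetric] m_def[symmetric] power2_eq_square)
  have eaa: "(\<integral>z. (case z of (x, y) \<Rightarrow> (a x)\<^sup>2) \<partial>?P) = A"
    unfolding A_def using integral_fst[OF iaa] by (simp add: M2.prob_space)
  have ebb: "(\<integral>z. (case z of (x, y) \<Rightarrow> (b y)\<^sup>2) \<partial>?P) = C"
    unfolding C_def using integral_snd[OF ibb] by (simp add: M1.prob_space)
  have ea: "(\<integral>z. (case z of (x, y) \<Rightarrow> a x) \<partial>?P) = m"
    unfolding m_def using integral_fst[OF ia] by (simp add: M2.prob_space)
  have eb: "(\<integral>z. (case z of (x, y) \<Rightarrow> b y) \<partial>?P) = m"
    unfolding mb using integral_snd[OF ib] by (simp add: M1.prob_space)
  note ints = iFF iF iFa iFb iab iaa ibb ia ib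
  note vals = eFF eF eFa eFb eab eaa ebb ea eb
  \<comment> \<open>The square of \<open>F - a - b + m\<close>, expanded with the mean of every
    product. \<open>F * a\<close> and \<open>F * b\<close> integrate to \<open>A\<close> and
    \<open>C\<close> because \<open>a\<close> and \<open>b\<close> are conditional means of
    \<open>F\<close>.\<close>
  have "has_bochner_integral ?P (\<lambda>z. (case z of (x, y) \<Rightarrow> (F x y)\<^sup>2) + (case z of (x, y) \<Rightarrow> (a x)\<^sup>2)
      + (case z of (x, y) \<Rightarrow> (b y)\<^sup>2) + m\<^sup>2
      - 2 * (case z of (x, y) \<Rightarrow> F x y * a x) - 2 * (case z of (x, y) \<Rightarrow> F x y * b y)
      + 2 * m * (case z of (x, y) \<Rightarrow> F x y) + 2 * (case z of (x, y) \<Rightarrow> a x * b y)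
      - 2 * m * (case z of (x, y) \<Rightarrow> a x) - 2 * m * (case z of (x, y) \<Rightarrow> b y))
      (Q + A + C + m\<^sup>2 - 2 * A - 2 * C + 2 * m * m + 2 * m\<^sup>2 - 2 * m * m - 2 * m * m)"
    using ints[THEN has_bochner_integral_integrable, unfolded vals]
      has_bochner_integral_integrable[OF integrable_const[of "m\<^sup>2"]]
    by (intro has_bochner_integral_add has_bochner_integral_diff has_bochner_integral_mult_right)
      (auto simp: prob_space)
  then have "has_bochner_integral ?P (\<lambda>z. (case z of (x, y) \<Rightarrow> (F x y - a x - b y + m)\<^sup>2)) (Q - A - C + m\<^sup>2)"
    by (rule has_bochner_integral_cong[THEN iffD1, rotated -1])
      (auto simp: power2_eq_square algebra_simps)
  then have "Q - A - C + m\<^sup>2 = (\<integral>z. (case z of (x, y) \<Rightarrow> (F x y - a x - b y + m)\<^sup>2) \<partial>?P)"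
    by (rule has_bochner_integral_integral_eq[symmetric])
  also have "0 \<le> \<dots>"
    by (rule Bochner_Integration.integral_nonneg) auto
  finally have "0 \<le> Q - A - C + m\<^sup>2" .
  moreover have "(\<integral>x. (\<integral>y. (F x y)\<^sup>2 \<partial>M2) - (a x)\<^sup>2 \<partial>M1) = Q - A"
    unfolding Q_def A_def
    by (rule Bochner_Integration.integral_diff)
      (use integrable_fst[OF iFF] in simp, intro M1.integrable_const_bound[of _ "B\<^sup>2"],
        auto intro!: AE_I2 sq ab)
  moreover have "(\<integral>y. (\<integral>x. (F x y)\<^sup>2 \<partial>M1) - (b y)\<^sup>2 \<partial>M2) = Q - C"
    unfolding Q' C_def
    by (rule Bochner_Integration.integral_diff)
      (use integrable_snd[OF iFF] in simp, intro M2.integrable_const_bound[of _ "B\<^sup>2"],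
        auto intro!: AE_I2 sq bb)
  ultimately show ?thesis
    unfolding a_def[symmetric] b_def[symmetric] m_def[symmetric] Q_def[symmetric] by simp
qed

section \<open>Tensorization to product Gaussians\<close>

abbreviation stdN_prod :: "'i set \<Rightarrow> ('i \<Rightarrow> real) measure" where
  "stdN_prod I \<equiv> PiM I (\<lambda>_. stdN)"

lemma prob_space_stdN_prod: "prob_space (stdN_prod I)"
  by (intro prob_space_PiM prob_space_stdN)

lemma space_stdN_prod [simp]: "space (stdN_prod I) = extensional I"
  by (simp add: space_PiM PiE_UNIV_domain extensional_def PiE_def)

text \<open>Only existence of the derivative is assumed, so measurability comes from its being a
  pointwise limit of difference quotients.\<close>

lemma borel_measurable_partial_derivative:
  assumes i: "i \<in> I" and fm: "f \<in> borel_measurable (stdN_prod I)"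
    and fd: "\<And>x. x \<in> extensional I \<Longrightarrow> ((\<lambda>t. f (x(i := t))) has_real_derivative f' x) (at (x i))"
  shows "f' \<in> borel_measurable (stdN_prod I)"
proof (rule borel_measurable_LIMSEQ_real)
  fix x assume "x \<in> space (stdN_prod I)"
  then show "(\<lambda>n. (f (x(i := x i + 1 / real (Suc n))) - f x) * real (Suc n)) \<longlonglongrightarrow> f' x"
    using deriv_tendsto_quotient[where f="\<lambda>t. f (x(i := t))" and x="x i" and D="f' x"] fd[of x]
    by (simp only: fun_upd_triv space_stdN_prod)
next
  fix n
  note [measurable] = fm
  have "(\<lambda>x. x(i := x i + 1 / real (Suc n))) \<in> measurable (stdN_prod I) (stdN_prod I)"
    using i by (intro measurable_fun_upd[where J=I]) (auto simp del: of_nat_Suc)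
  then show "(\<lambda>x. (f (x(i := x i + 1 / real (Suc n))) - f x) * real (Suc n)) \<in> borel_measurable (stdN_prod I)"
    by measurable
qed

text \<open>Induction on the coordinates through the Efron-Stein inequality. The constant stays 1
  regardless of the size of \<open>I\<close>, which is what permits a dimension growing with the
  sample size.\<close>

lemma poincare_stdN_prod:
  fixes f :: "('i \<Rightarrow> real) \<Rightarrow> real" and f' :: "'i \<Rightarrow> ('i \<Rightarrow> real) \<Rightarrow> real"
  assumes "finite I"
    and "f \<in> borel_measurable (stdN_prod I)"
    and "\<And>x. x \<in> extensional I \<Longrightarrow> \<bar>f x\<bar> \<le> B"
    and "\<And>i x. i \<in> I \<Longrightarrow> x \<in> extensional I \<Longrightarrow> ((\<lambda>t. f (x(i := t))) has_real_derivative f' i x) (at (x i))"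
    and "\<And>i x. i \<in> I \<Longrightarrow> x \<in> extensional I \<Longrightarrow> \<bar>f' i x\<bar> \<le> B"
  shows "(\<integral>x. (f x)\<^sup>2 \<partial>stdN_prod I) - (\<integral>x. f x \<partial>stdN_prod I)\<^sup>2 \<le> (\<Sum>i\<in>I. \<integral>x. (f' i x)\<^sup>2 \<partial>stdN_prod I)"
  using assms
proof (induction I arbitrary: f f' rule: finite_induct)
  case empty
  interpret prob_space "stdN_prod {} :: ('i \<Rightarrow> real) measure" by (rule prob_space_stdN_prod)
  have "(\<integral>x. h x \<partial>stdN_prod {}) = h (\<lambda>_. undefined)" for h :: "('i \<Rightarrow> real) \<Rightarrow> real"
  proof -
    have "(\<integral>x. h x \<partial>stdN_prod {}) = (\<integral>x. h (\<lambda>_. undefined) \<partial>(stdN_prod {} :: ('i \<Rightarrow> real) measure))"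
      by (intro Bochner_Integration.integral_cong) auto
    then show ?thesis using prob_space by simp
  qed
  then show ?case by simp
next
  case (insert i I f f')
  let ?G = "stdN_prod I :: ('i \<Rightarrow> real) measure" and ?G' = "stdN_prod (insert i I) :: ('i \<Rightarrow> real) measure"
  interpret N: prob_space stdN by (rule prob_space_stdN)
  interpret G: prob_space ?G by (rule prob_space_stdN_prod)
  interpret G': prob_space ?G' by (rule prob_space_stdN_prod)
  interpret pair_prob_space ?G stdN ..
  interpret product_sigma_finite "\<lambda>_::'i. stdN" ..
  note fm[measurable] = insert.prems(1)
  note fb = insert.prems(2) and fd = insert.prems(3) and f'b = insert.prems(4)
  define F where "F x y = f (x(i := y))" for x y
  have ext: "x(i := y) \<in> extensional (insert i I)" if "x \<in> extensional I" for x :: "'i \<Rightarrow> real" and y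
    using that by (auto simp: extensional_def)
  have Fb: "\<bar>F x y\<bar> \<le> B" if "x \<in> extensional I" for x y
    unfolding F_def by (rule fb[OF ext[OF that]])
  have upd[measurable]: "(\<lambda>(x, y). x(i := y)) \<in> measurable (?G \<Otimes>\<^sub>M stdN) ?G'"
    by (rule measurable_add_dim)
  have F_meas[measurable]: "(\<lambda>(x, y). F x y) \<in> borel_measurable (?G \<Otimes>\<^sub>M stdN)"
    using measurable_compose[OF upd fm] by (simp add: F_def split_beta')
  have f'm[measurable]: "f' j \<in> borel_measurable ?G'" if j: "j \<in> insert i I" for j
    by (rule borel_measurable_partial_derivative[OF j fm fd[OF j]])
  define F' where "F' j x y = f' j (x(i := y))" for j x y
  have F'_meas[measurable]: "(\<lambda>(x, y). F' j x y) \<in> borel_measurable (?G \<Otimes>\<^sub>M stdN)" if "j \<in> insert i I" for j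
    using measurable_compose[OF upd f'm[OF that]] by (simp add: F'_def split_beta')
  have sq: "\<bar>t\<bar> \<le> B \<Longrightarrow> t\<^sup>2 \<le> B\<^sup>2" for t :: real
    using power_mono[of "\<bar>t\<bar>" B 2] by simp
  have iF'2: "integrable (?G \<Otimes>\<^sub>M stdN) (\<lambda>(x, y). (F' j x y)\<^sup>2)" if "j \<in> insert i I" for j
    using F'_meas[OF that] f'b[OF that] ext by (intro integrable_const_bound[of _ "B\<^sup>2"]) (auto simp: F'_def space_pair_measure intro!: AE_I2 sq)
  have iF2: "integrable (?G \<Otimes>\<^sub>M stdN) (\<lambda>(x, y). (F x y)\<^sup>2)"
    using Fb by (intro integrable_const_bound[of _ "B\<^sup>2"]) (auto simp: space_pair_measure intro!: AE_I2 sq)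
  have I1: "(\<integral>x. h x \<partial>?G') = (\<integral>x. (\<integral>y. h (x(i := y)) \<partial>stdN) \<partial>?G)" if "integrable ?G' h" for h :: "('i \<Rightarrow> real) \<Rightarrow> real"
    using insert.hyps that by (intro product_integral_insert) auto
  have f2_int: "integrable ?G' (\<lambda>x. (f x)\<^sup>2)"
    using fb by (intro G'.integrable_const_bound[of _ "B\<^sup>2"]) (auto intro!: AE_I2 sq)
  have f_int: "integrable ?G' f"
    using fb by (intro G'.integrable_const_bound[of _ B]) (auto intro!: AE_I2)
  have f'2_int: "integrable ?G' (\<lambda>x. (f' j x)\<^sup>2)" if j: "j \<in> insert i I" for j
    using f'm[OF j] f'b[OF j] by (intro G'.integrable_const_bound[of _ "B\<^sup>2"]) (auto intro!: AE_I2 sq)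
  have Fx_meas: "F x \<in> borel_measurable stdN" if "x \<in> extensional I" for x
    using measurable_compose[OF measurable_Pair1'[of x ?G stdN] F_meas] that by simp
  have Fy_meas: "(\<lambda>x. F x y) \<in> borel_measurable ?G" for y
    using measurable_compose[OF measurable_Pair2'[of y stdN ?G] F_meas] by simp
  \<comment> \<open>The one-dimensional inequality bounds the variance in the new coordinate with
    the others frozen; \<open>step2\<close> is the induction hypothesis with the new coordinate
    frozen.\<close>
  have step1: "(\<integral>y. (F x y)\<^sup>2 \<partial>stdN) - (\<integral>y. F x y \<partial>stdN)\<^sup>2 \<le> (\<integral>y. (F' i x y)\<^sup>2 \<partial>stdN)" if x: "x \<in> extensional I" for x
  proof (rule poincare_std_normal[where B=B])
    show "(F x has_real_derivative F' i x t) (at t)" for t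
      using fd[OF insertI1 ext[OF x], of t] by (simp only: F_def[abs_def] F'_def fun_upd_upd fun_upd_same)
    show "F' i x \<in> borel_measurable borel"
      using measurable_compose[OF measurable_Pair1'[of x ?G stdN] F'_meas[of i]] x by simp
    show "\<bar>F' i x t\<bar> \<le> B" for t
      unfolding F'_def by (rule f'b[OF insertI1 ext[OF x]])
  qed (rule Fb[OF x])
  have step2: "(\<integral>x. (F x y)\<^sup>2 \<partial>?G) - (\<integral>x. F x y \<partial>?G)\<^sup>2 \<le> (\<Sum>j\<in>I. \<integral>x. (F' j x y)\<^sup>2 \<partial>?G)" for y
  proof (rule insert.IH)
    show "((\<lambda>t. F (x(j := t)) y) has_real_derivative F' j x y) (at (x j))" if j: "j \<in> I" and x: "x \<in> extensional I" for j x
    proof -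
      have ji: "j \<noteq> i" using j insert.hyps by auto
      have "(x(i := y))(j := t) = (x(j := t))(i := y)" for t
        using ji by (rule fun_upd_twist[OF not_sym])
      moreover have "(x(i := y)) j = x j" using ji by (rule fun_upd_other)
      ultimately show ?thesis
        using fd[OF insertI2[OF j] ext[OF x], of y] by (simp only: F_def F'_def)
    qed
    show "(\<lambda>x. F x y) \<in> borel_measurable ?G" by (rule Fy_meas)
    show "\<bar>F x y\<bar> \<le> B" if "x \<in> extensional I" for x
      using that by (rule Fb)
    show "\<bar>F' j x y\<bar> \<le> B" if "j \<in> I" "x \<in> extensional I" for j x
      unfolding F'_def by (rule f'b[OF insertI2[OF that(1)] ext[OF that(2)]])
  qed
  have iv1: "integrable ?G (\<lambda>x. (\<integral>y. (F x y)\<^sup>2 \<partial>stdN) - (\<integral>y. F x y \<partial>stdN)\<^sup>2)"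
  proof (intro Bochner_Integration.integrable_diff)
    show "integrable ?G (\<lambda>x. \<integral>y. (F x y)\<^sup>2 \<partial>stdN)" using integrable_fst[OF iF2] by simp
    have "\<bar>\<integral>y. F x y \<partial>stdN\<bar> \<le> B" if x: "x \<in> extensional I" for x
    proof -
      have "\<bar>\<integral>y. F x y \<partial>stdN\<bar> \<le> (\<integral>y. \<bar>F x y\<bar> \<partial>stdN)" by (rule integral_abs_bound)
      also have "\<dots> \<le> B"
        using Fb[OF x] Fx_meas[OF x] by (intro N.integral_le_const N.integrable_const_bound[of _ B]) (auto intro!: AE_I2)
      finally show ?thesis .
    qed
    then show "integrable ?G (\<lambda>x. (\<integral>y. F x y \<partial>stdN)\<^sup>2)"
      by (intro G.integrable_const_bound[of _ "B\<^sup>2"]) (auto intro!: AE_I2 sq)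
  qed
  have iv2: "integrable stdN (\<lambda>y. (\<integral>x. (F x y)\<^sup>2 \<partial>?G) - (\<integral>x. F x y \<partial>?G)\<^sup>2)"
  proof (intro Bochner_Integration.integrable_diff)
    show "integrable stdN (\<lambda>y. \<integral>x. (F x y)\<^sup>2 \<partial>?G)" using integrable_snd[OF iF2] by simp
    have "\<bar>\<integral>x. F x y \<partial>?G\<bar> \<le> B" for y
    proof -
      have "\<bar>\<integral>x. F x y \<partial>?G\<bar> \<le> (\<integral>x. \<bar>F x y\<bar> \<partial>?G)" by (rule integral_abs_bound)
      also have "\<dots> \<le> B"
        using Fb Fy_meas by (intro G.integral_le_const G.integrable_const_bound[of _ B]) (auto intro!: AE_I2)
      finally show ?thesis .
    qed
    then show "integrable stdN (\<lambda>y. (\<integral>x. F x y \<partial>?G)\<^sup>2)"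
      by (intro N.integrable_const_bound[of _ "B\<^sup>2"]) (auto intro!: AE_I2 sq)
  qed
  have "(\<integral>x. (f x)\<^sup>2 \<partial>?G') - (\<integral>x. f x \<partial>?G')\<^sup>2
     = (\<integral>x. (\<integral>y. (F x y)\<^sup>2 \<partial>stdN) \<partial>?G) - (\<integral>x. (\<integral>y. F x y \<partial>stdN) \<partial>?G)\<^sup>2"
    unfolding I1[OF f2_int] I1[OF f_int] F_def ..
  also have "\<dots> \<le> (\<integral>x. (\<integral>y. (F x y)\<^sup>2 \<partial>stdN) - (\<integral>y. F x y \<partial>stdN)\<^sup>2 \<partial>?G)
      + (\<integral>y. (\<integral>x. (F x y)\<^sup>2 \<partial>?G) - (\<integral>x. F x y \<partial>?G)\<^sup>2 \<partial>stdN)"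
    using Fb by (intro sum_conditional_variances_ge[where B=B] F_meas) auto
  also have "\<dots> \<le> (\<integral>x. (\<integral>y. (F' i x y)\<^sup>2 \<partial>stdN) \<partial>?G) + (\<integral>y. (\<Sum>j\<in>I. \<integral>x. (F' j x y)\<^sup>2 \<partial>?G) \<partial>stdN)"
    using integrable_fst[OF iF'2[of i]] integrable_snd[OF iF'2] iv1 iv2
    by (intro add_mono integral_mono step1 step2 Bochner_Integration.integrable_sum) auto
  also have "(\<integral>y. (\<Sum>j\<in>I. \<integral>x. (F' j x y)\<^sup>2 \<partial>?G) \<partial>stdN) = (\<Sum>j\<in>I. \<integral>y. (\<integral>x. (F' j x y)\<^sup>2 \<partial>?G) \<partial>stdN)"
    using integrable_snd[OF iF'2] by (intro Bochner_Integration.integral_sum) auto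
  also have "\<dots> = (\<Sum>j\<in>I. \<integral>x. (\<integral>y. (F' j x y)\<^sup>2 \<partial>stdN) \<partial>?G)"
    using Fubini_integral[OF iF'2] by (intro sum.cong) auto
  also have "(\<integral>x. (\<integral>y. (F' i x y)\<^sup>2 \<partial>stdN) \<partial>?G) + \<dots> = (\<Sum>j\<in>insert i I. \<integral>x. (f' j x)\<^sup>2 \<partial>?G')"
    unfolding sum.insert[OF insert.hyps] using I1[OF f'2_int] by (simp add: F'_def)
  finally show ?case .
qed

section \<open>Square roots and inverses of matrices\<close>

lemma enorm_L2_set: "enorm v = L2_set (\<lambda>i. v $ i) {0..<dim_vec v}"
  by (simp add: enorm_def L2_set_def scalar_prod_def power2_eq_square)

lemma enorm_nonneg [simp]: "0 \<le> enorm v"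
  by (simp add: enorm_L2_set)

lemma enorm_sq: "(enorm v)\<^sup>2 = scalar_prod v v"
  unfolding enorm_def by (intro real_sqrt_pow2) (simp add: scalar_prod_def sum_nonneg)

lemma enorm_triangle:
  assumes "v \<in> carrier_vec d" "w \<in> carrier_vec d"
  shows "enorm (v + w) \<le> enorm v + enorm w"
proof -
  have "enorm (v + w) = L2_set (\<lambda>i. v $ i + w $ i) {0..<d}"
    unfolding enorm_L2_set using assms by (intro L2_set_cong) auto
  also have "\<dots> \<le> L2_set (\<lambda>i. v $ i) {0..<d} + L2_set (\<lambda>i. w $ i) {0..<d}"
    by (rule L2_set_triangle_ineq)
  finally show ?thesis using assms by (simp add: enorm_L2_set)
qed

lemma enorm_smult: "enorm (c \<cdot>\<^sub>v v) = \<bar>c\<bar> * enorm v"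
proof -
  have "scalar_prod (c \<cdot>\<^sub>v v) (c \<cdot>\<^sub>v v) = c\<^sup>2 * scalar_prod v v"
    by (simp add: power2_eq_square mult.assoc)
  then show ?thesis by (simp add: enorm_def real_sqrt_mult)
qed

lemma enorm_Cauchy_Schwarz:
  assumes "v \<in> carrier_vec d" "w \<in> carrier_vec d"
  shows "\<bar>scalar_prod v w\<bar> \<le> enorm v * enorm w"
proof -
  have "\<bar>scalar_prod v w\<bar> \<le> (\<Sum>i\<in>{0..<d}. \<bar>v $ i\<bar> * \<bar>w $ i\<bar>)"
    using assms unfolding scalar_prod_def
    by (intro order_trans[OF sum_abs]) (simp add: abs_mult)
  also have "\<dots> \<le> L2_set (\<lambda>i. v $ i) {0..<d} * L2_set (\<lambda>i. w $ i) {0..<d}"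
    by (rule L2_set_mult_ineq)
  finally show ?thesis using assms by (simp add: enorm_L2_set)
qed

lemma enorm_unit_vec: "i < d \<Longrightarrow> enorm (unit_vec d i :: real Matrix.vec) = 1"
  by (simp add: enorm_def)

text \<open>Turns operator bounds on differences of iterates into convergence of each entry, so that
  limits of matrices reduce to limits of real sequences.\<close>

lemma mat_entry_le_op_bound:
  fixes A :: "real Matrix.mat"
  assumes A: "A \<in> carrier_mat d d" and ij: "i < d" "j < d"
    and bd: "\<And>v. v \<in> carrier_vec d \<Longrightarrow> enorm (A *\<^sub>v v) \<le> b * enorm v"
  shows "\<bar>A $$ (i, j)\<bar> \<le> b"
proof -
  let ?w = "A *\<^sub>v unit_vec d j"
  have "A $$ (i, j) = scalar_prod (unit_vec d i) ?w"
    using A ij by simp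
  also have "\<bar>\<dots>\<bar> \<le> enorm (unit_vec d i :: real Matrix.vec) * enorm ?w"
    using A by (intro enorm_Cauchy_Schwarz[where d=d]) auto
  also have "\<dots> \<le> 1 * (b * 1)"
    using bd[of "unit_vec d j"] ij by (simp add: enorm_unit_vec)
  finally show ?thesis by simp
qed

lemma tendsto_scalar_prod_mult_mat_vec:
  fixes X :: "nat \<Rightarrow> real Matrix.mat"
  assumes X: "\<And>k. X k \<in> carrier_mat d d" and L: "L \<in> carrier_mat d d"
    and lim: "\<And>i j. i < d \<Longrightarrow> j < d \<Longrightarrow> (\<lambda>k. X k $$ (i, j)) \<longlonglongrightarrow> L $$ (i, j)"
    and v: "v \<in> carrier_vec d" "w \<in> carrier_vec d"
  shows "(\<lambda>k. scalar_prod w (X k *\<^sub>v v)) \<longlonglongrightarrow> scalar_prod w (L *\<^sub>v v)"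
proof -
  have eq: "scalar_prod w (A *\<^sub>v v) = (\<Sum>i\<in>{0..<d}. w $ i * (\<Sum>j\<in>{0..<d}. A $$ (i, j) * v $ j))"
    if "A \<in> carrier_mat d d" for A
    using that v by (simp add: scalar_prod_def)
  show ?thesis
    unfolding eq[OF X] eq[OF L] by (intro tendsto_sum tendsto_mult tendsto_const lim) auto
qed

text \<open>With \<open>B = 1 - c F\<close> a strict contraction, the fixed point of \<open>X \<mapsto> (B + X\<^sup>2) / 2\<close>
  satisfies \<open>(1 - X)\<^sup>2 = 1 - B = c F\<close>.\<close>

context
  fixes d :: nat and B :: "real Matrix.mat" and b :: real
  assumes B: "B \<in> carrier_mat d d" and B_sym: "transpose_mat B = B"
    and b: "0 \<le> b" "b < 1"
    and B_le: "\<And>v. v \<in> carrier_vec d \<Longrightarrow> enorm (B *\<^sub>v v) \<le> b * enorm v"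
begin

primrec iter_sqrt :: "nat \<Rightarrow> real Matrix.mat" where
  "iter_sqrt 0 = 0\<^sub>m d d"
| "iter_sqrt (Suc k) = (1 / 2) \<cdot>\<^sub>m (B + iter_sqrt k * iter_sqrt k)"

lemma iter_sqrt_carrier [simp, intro]: "iter_sqrt k \<in> carrier_mat d d"
  using B by (induction k) auto

lemma iter_sqrt_dim [simp]: "dim_row (iter_sqrt k) = d" "dim_col (iter_sqrt k) = d"
  using carrier_matD[OF iter_sqrt_carrier[of k]] by auto

lemma iter_sqrt_mult_carrier [simp, intro]: "v \<in> carrier_vec d \<Longrightarrow> iter_sqrt k *\<^sub>v v \<in> carrier_vec d"
  by (rule mult_mat_vec_carrier) auto

lemma B_mult_carrier [simp, intro]: "v \<in> carrier_vec d \<Longrightarrow> B *\<^sub>v v \<in> carrier_vec d"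
  using B by (rule mult_mat_vec_carrier)

lemma iter_sqrt_sym: "transpose_mat (iter_sqrt k) = iter_sqrt k"
proof (induction k)
  case (Suc k)
  have "transpose_mat (iter_sqrt k * iter_sqrt k) = iter_sqrt k * iter_sqrt k"
    using Suc by (simp add: transpose_mult[of _ d d _ d])
  moreover have "transpose_mat (c \<cdot>\<^sub>m A) = c \<cdot>\<^sub>m transpose_mat A" for c and A :: "real Matrix.mat"
    by (intro eq_matI) auto
  moreover have "iter_sqrt k * iter_sqrt k \<in> carrier_mat d d"
    by (rule mult_carrier_mat) auto
  ultimately show ?case using B B_sym by (simp add: transpose_add[OF B])
qed simp

lemma iter_sqrt_Suc_mult_vec:
  assumes v: "v \<in> carrier_vec d"
  shows "iter_sqrt (Suc k) *\<^sub>v v = (1 / 2) \<cdot>\<^sub>v (B *\<^sub>v v + iter_sqrt k *\<^sub>v (iter_sqrt k *\<^sub>v v))"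
proof -
  have "iter_sqrt (Suc k) *\<^sub>v v = (1 / 2) \<cdot>\<^sub>v ((B + iter_sqrt k * iter_sqrt k) *\<^sub>v v)"
    using v B by (intro eq_vecI) (auto simp: scalar_prod_def sum_distrib_left mult.assoc)
  also have "(B + iter_sqrt k * iter_sqrt k) *\<^sub>v v = B *\<^sub>v v + (iter_sqrt k * iter_sqrt k) *\<^sub>v v"
    using B v by (intro add_mult_distrib_mat_vec[of _ d d]) auto
  also have "(iter_sqrt k * iter_sqrt k) *\<^sub>v v = iter_sqrt k *\<^sub>v (iter_sqrt k *\<^sub>v v)"
    using v by (intro assoc_mult_mat_vec[of _ d d _ d]) auto
  finally show ?thesis .
qed

text \<open>The ball of radius \<open>b\<close> is invariant under the iteration, because
  \<open>(b + b * b) / 2\<close> is at most \<open>b\<close> for \<open>b < 1\<close>.\<close>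

lemma iter_sqrt_le: "v \<in> carrier_vec d \<Longrightarrow> enorm (iter_sqrt k *\<^sub>v v) \<le> b * enorm v"
proof (induction k arbitrary: v)
  case 0
  then have "(0\<^sub>m d d :: real Matrix.mat) *\<^sub>v v = 0\<^sub>v d" by (intro eq_vecI) auto
  moreover have "enorm (0\<^sub>v d) = 0" by (simp add: enorm_def)
  ultimately show ?case using mult_nonneg_nonneg[OF b(1) enorm_nonneg[of v]] by simp
next
  case (Suc k)
  let ?X = "iter_sqrt k"
  have c: "?X *\<^sub>v v \<in> carrier_vec d" "?X *\<^sub>v (?X *\<^sub>v v) \<in> carrier_vec d" "B *\<^sub>v v \<in> carrier_vec d"
    using Suc.prems B by auto
  have 1: "enorm (iter_sqrt (Suc k) *\<^sub>v v) \<le> (1 / 2) * (enorm (B *\<^sub>v v) + enorm (?X *\<^sub>v (?X *\<^sub>v v)))"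
    unfolding iter_sqrt_Suc_mult_vec[OF Suc.prems] enorm_smult using enorm_triangle[OF c(3,2)] by simp
  have "enorm (?X *\<^sub>v (?X *\<^sub>v v)) \<le> b * (b * enorm v)"
    by (rule order_trans[OF Suc.IH[OF c(1)] mult_left_mono[OF Suc.IH[OF Suc.prems] b(1)]])
  also have "b * (b * enorm v) \<le> 1 * (b * enorm v)"
    using b by (intro mult_right_mono) auto
  finally have 2: "enorm (?X *\<^sub>v (?X *\<^sub>v v)) \<le> 1 * (b * enorm v)" .
  have "q \<le> 1 * r \<Longrightarrow> p \<le> r \<Longrightarrow> 1 / 2 * (p + q) \<le> r" for p q r :: real by simp
  from order_trans[OF 1 this[OF 2 B_le[OF Suc.prems]]] show ?case .
qed

text \<open>The map is a contraction with factor \<open>b\<close>. The difference of squares is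
  split as \<open>Y * Y - X * X = Y * (Y - X) + (Y - X) * X\<close>, an identity that does not
  presuppose that \<open>X\<close> and \<open>Y\<close> commute.\<close>

lemma iter_sqrt_diff_le:
  "v \<in> carrier_vec d \<Longrightarrow> enorm ((iter_sqrt (Suc k) - iter_sqrt k) *\<^sub>v v) \<le> b ^ Suc k * enorm v"
proof (induction k arbitrary: v)
  case 0
  then have "(iter_sqrt (Suc 0) - iter_sqrt 0) *\<^sub>v v = (1 / 2) \<cdot>\<^sub>v (B *\<^sub>v v)"
    using B by (intro eq_vecI) (auto simp: scalar_prod_def sum_distrib_left)
  then have "enorm ((iter_sqrt (Suc 0) - iter_sqrt 0) *\<^sub>v v) = enorm (B *\<^sub>v v) / 2"
    by (simp add: enorm_smult)
  also have "\<dots> \<le> b * enorm v"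
    using B_le[OF 0] mult_nonneg_nonneg[OF b(1) enorm_nonneg[of v]] by linarith
  finally show ?case by simp
next
  case (Suc k)
  let ?X = "iter_sqrt k" and ?Y = "iter_sqrt (Suc k)"
  note v = Suc.prems
  have YX: "?Y - ?X \<in> carrier_mat d d" by (intro minus_carrier_mat) auto
  have cY: "?Y \<in> carrier_mat d d" by (rule iter_sqrt_carrier)
  have "(iter_sqrt (Suc (Suc k)) - ?Y) *\<^sub>v v = iter_sqrt (Suc (Suc k)) *\<^sub>v v - ?Y *\<^sub>v v"
    using v by (intro minus_mult_distrib_mat_vec[of _ d d]) (auto simp del: iter_sqrt.simps)
  also have "\<dots> = (1 / 2) \<cdot>\<^sub>v (B *\<^sub>v v + ?Y *\<^sub>v (?Y *\<^sub>v v)) - (1 / 2) \<cdot>\<^sub>v (B *\<^sub>v v + ?X *\<^sub>v (?X *\<^sub>v v))"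
    by (simp only: iter_sqrt_Suc_mult_vec[OF v])
  also have "\<dots> = (1 / 2) \<cdot>\<^sub>v (?Y *\<^sub>v (?Y *\<^sub>v v) - ?X *\<^sub>v (?X *\<^sub>v v))"
    using B v cY by (intro eq_vecI) (auto simp del: iter_sqrt.simps index_mult_mat_vec simp: field_simps)
  also have "?Y *\<^sub>v (?Y *\<^sub>v v) - ?X *\<^sub>v (?X *\<^sub>v v) = ?Y *\<^sub>v ((?Y - ?X) *\<^sub>v v) + (?Y - ?X) *\<^sub>v (?X *\<^sub>v v)"
  proof -
    have "?Y *\<^sub>v ((?Y - ?X) *\<^sub>v v) = ?Y *\<^sub>v (?Y *\<^sub>v v) - ?Y *\<^sub>v (?X *\<^sub>v v)"
      using v cY by (simp del: iter_sqrt.simps add: minus_mult_distrib_mat_vec[of _ d d] mult_minus_distrib_mat_vec[of _ d d])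
    moreover have "(?Y - ?X) *\<^sub>v (?X *\<^sub>v v) = ?Y *\<^sub>v (?X *\<^sub>v v) - ?X *\<^sub>v (?X *\<^sub>v v)"
      using v cY by (simp del: iter_sqrt.simps add: minus_mult_distrib_mat_vec[of _ d d])
    ultimately show ?thesis
      using v cY by (intro eq_vecI) (auto simp del: iter_sqrt.simps index_mult_mat_vec)
  qed
  finally have eq: "(iter_sqrt (Suc (Suc k)) - ?Y) *\<^sub>v v
    = (1 / 2) \<cdot>\<^sub>v (?Y *\<^sub>v ((?Y - ?X) *\<^sub>v v) + (?Y - ?X) *\<^sub>v (?X *\<^sub>v v))" .
  have c1: "(?Y - ?X) *\<^sub>v v \<in> carrier_vec d" "?X *\<^sub>v v \<in> carrier_vec d"
    using v YX by (auto simp del: iter_sqrt.simps)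
  have c2: "?Y *\<^sub>v ((?Y - ?X) *\<^sub>v v) \<in> carrier_vec d" "(?Y - ?X) *\<^sub>v (?X *\<^sub>v v) \<in> carrier_vec d"
    using c1 YX cY by (auto simp del: iter_sqrt.simps)
  have "enorm (?Y *\<^sub>v ((?Y - ?X) *\<^sub>v v)) \<le> b * enorm ((?Y - ?X) *\<^sub>v v)"
    by (rule iter_sqrt_le[OF c1(1)])
  also have "\<dots> \<le> b * (b ^ Suc k * enorm v)"
    using Suc.IH[OF v] b by (intro mult_left_mono) auto
  finally have 1: "enorm (?Y *\<^sub>v ((?Y - ?X) *\<^sub>v v)) \<le> b ^ Suc (Suc k) * enorm v" by (simp add: mult_ac)
  have "enorm ((?Y - ?X) *\<^sub>v (?X *\<^sub>v v)) \<le> b ^ Suc k * enorm (?X *\<^sub>v v)"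
    by (rule Suc.IH[OF c1(2)])
  also have "\<dots> \<le> b ^ Suc k * (b * enorm v)"
    using iter_sqrt_le[OF v, of k] b by (intro mult_left_mono) auto
  finally have 2: "enorm ((?Y - ?X) *\<^sub>v (?X *\<^sub>v v)) \<le> b ^ Suc (Suc k) * enorm v" by (simp add: mult_ac)
  show ?case unfolding eq enorm_smult using enorm_triangle[OF c2] 1 2 by simp
qed

lemma iter_sqrt_convergent:
  assumes "i < d" "j < d"
  shows "convergent (\<lambda>k. iter_sqrt k $$ (i, j))"
proof -
  have "summable (\<lambda>k. iter_sqrt (Suc k) $$ (i, j) - iter_sqrt k $$ (i, j))"
  proof (rule summable_comparison_test'[of "\<lambda>k. b ^ Suc k" 0])
    show "summable (\<lambda>k. b ^ Suc k)"
      using b summable_geometric[of b] by (subst summable_Suc_iff) auto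
    fix k
    have YX: "iter_sqrt (Suc k) - iter_sqrt k \<in> carrier_mat d d" by (intro minus_carrier_mat) auto
    have "\<bar>(iter_sqrt (Suc k) - iter_sqrt k) $$ (i, j)\<bar> \<le> b ^ Suc k"
      by (rule mat_entry_le_op_bound[OF YX assms iter_sqrt_diff_le])
    then show "norm (iter_sqrt (Suc k) $$ (i, j) - iter_sqrt k $$ (i, j)) \<le> b ^ Suc k"
      using assms by (simp del: iter_sqrt.simps)
  qed
  then have "convergent (\<lambda>n. iter_sqrt n $$ (i, j) - iter_sqrt 0 $$ (i, j))"
    by (simp only: summable_iff_convergent sum_lessThan_telescope[where f="\<lambda>n. iter_sqrt n $$ (i, j)"])
  then show ?thesis by (simp only: convergent_diff_const_right_iff)
qed

text \<open>The root is \<open>1 - L\<close> for the limit \<open>L\<close> of the iterates. It is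
  positive semidefinite because all iterates have norm at most \<open>b < 1\<close>, so the
  quadratic form of \<open>L\<close> stays below that of the identity.\<close>

lemma ex_psd_sqrt_one_minus: "\<exists>R. psd_mat d R \<and> R * R = 1\<^sub>m d - B"
proof -
  define L where "L = Matrix.mat d d (\<lambda>(i, j). lim (\<lambda>k. iter_sqrt k $$ (i, j)))"
  have L[simp]: "L \<in> carrier_mat d d" by (simp add: L_def)
  have dL[simp]: "dim_row L = d" "dim_col L = d" using carrier_matD[OF L] by auto
  have lim: "(\<lambda>k. iter_sqrt k $$ (i, j)) \<longlonglongrightarrow> L $$ (i, j)" if "i < d" "j < d" for i j
    using iter_sqrt_convergent[OF that] that by (simp add: L_def convergent_LIMSEQ_iff)
  have L_sym: "L $$ (j, i) = L $$ (i, j)" if "i < d" "j < d" for i j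
  proof (rule LIMSEQ_unique[OF lim[OF that(2,1)]])
    have "iter_sqrt k $$ (j, i) = iter_sqrt k $$ (i, j)" for k
      using iter_sqrt_sym[of k] that index_transpose_mat(1)[of j "iter_sqrt k" i] by simp
    then show "(\<lambda>k. iter_sqrt k $$ (j, i)) \<longlonglongrightarrow> L $$ (i, j)" using lim[OF that] by simp
  qed
  have L_fix: "2 * L $$ (i, j) = B $$ (i, j) + (\<Sum>l\<in>{0..<d}. L $$ (i, l) * L $$ (l, j))"
    if ij: "i < d" "j < d" for i j
  proof -
    have "(\<lambda>k. (B $$ (i, j) + (\<Sum>l\<in>{0..<d}. iter_sqrt k $$ (i, l) * iter_sqrt k $$ (l, j))) / 2)
        \<longlonglongrightarrow> (B $$ (i, j) + (\<Sum>l\<in>{0..<d}. L $$ (i, l) * L $$ (l, j))) / 2"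
      using ij by (intro tendsto_intros lim) auto
    moreover have "(B $$ (i, j) + (\<Sum>l\<in>{0..<d}. iter_sqrt k $$ (i, l) * iter_sqrt k $$ (l, j))) / 2
        = iter_sqrt (Suc k) $$ (i, j)" for k
      using ij B by (simp add: scalar_prod_def)
    ultimately have "(\<lambda>k. iter_sqrt (Suc k) $$ (i, j)) \<longlonglongrightarrow> (B $$ (i, j) + (\<Sum>l\<in>{0..<d}. L $$ (i, l) * L $$ (l, j))) / 2"
      by simp
    with LIMSEQ_Suc[OF lim[OF ij]] show ?thesis using LIMSEQ_unique by fastforce
  qed
  define R where "R = 1\<^sub>m d - L"
  have R: "R \<in> carrier_mat d d" unfolding R_def by (rule minus_carrier_mat[OF L])
  have R_sym: "transpose_mat R = R"
    unfolding R_def by (intro eq_matI) (auto simp: L_sym)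
  have "0 \<le> scalar_prod v (R *\<^sub>v v)" if v: "v \<in> carrier_vec d" for v
  proof -
    have "scalar_prod v (iter_sqrt k *\<^sub>v v) \<le> b * scalar_prod v v" for k
    proof -
      have "scalar_prod v (iter_sqrt k *\<^sub>v v) \<le> enorm v * enorm (iter_sqrt k *\<^sub>v v)"
        using enorm_Cauchy_Schwarz[OF v, of "iter_sqrt k *\<^sub>v v"] v by auto
      also have "\<dots> \<le> enorm v * (b * enorm v)"
        by (intro mult_left_mono iter_sqrt_le v) auto
      finally show ?thesis by (simp add: enorm_sq[symmetric] power2_eq_square mult_ac)
    qed
    then have "scalar_prod v (L *\<^sub>v v) \<le> b * scalar_prod v v"
      by (intro LIMSEQ_le_const2[OF tendsto_scalar_prod_mult_mat_vec[OF iter_sqrt_carrier L lim v v]]) auto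
    also have "\<dots> \<le> 1 * scalar_prod v v"
      using b by (intro mult_right_mono) (auto simp flip: enorm_sq)
    finally show ?thesis
      using v mult_mat_vec_carrier[OF L v]
      by (simp add: R_def minus_mult_distrib_mat_vec[of _ d d] scalar_prod_minus_distrib[of _ d])
  qed
  then have "psd_mat d R" using R R_sym by (simp add: psd_mat_def)
  moreover have "R * R = 1\<^sub>m d - B"
  proof -
    have sR: "(\<Sum>l\<in>{0..<d}. R $$ (i, l) * R $$ (l, j)) = (1\<^sub>m d - B) $$ (i, j)" if ij: "i < d" "j < d" for i j
    proof -
      have "(\<Sum>l\<in>{0..<d}. R $$ (i, l) * R $$ (l, j))
        = (\<Sum>l\<in>{0..<d}. ((if i = l then 1 else 0) - L $$ (i, l)) * ((if l = j then 1 else 0) - L $$ (l, j)))"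
        using ij by (intro sum.cong) (auto simp: R_def)
      also have "\<dots> = (\<Sum>l\<in>{0..<d}. (if i = l then (if l = j then 1 else 0) else 0) - (if i = l then L $$ (l, j) else 0)
         - (if l = j then L $$ (i, l) else 0) + L $$ (i, l) * L $$ (l, j))"
        by (intro sum.cong) (auto simp: algebra_simps)
      also have "\<dots> = (if i = j then 1 else 0) - 2 * L $$ (i, j) + (\<Sum>l\<in>{0..<d}. L $$ (i, l) * L $$ (l, j))"
        using ij by (simp add: sum.distrib sum_subtractf)
      also have "\<dots> = (1\<^sub>m d - B) $$ (i, j)" using ij B L_fix[OF ij] by simp
      finally show ?thesis .
    qed
    show ?thesis using R B sR by (intro eq_matI) (auto simp: scalar_prod_def)
  qed
  ultimately show ?thesis by blast
qed

end

text \<open>Guarantees that the choice in \<open>mat_sqrt\<close> picks a genuine root. A positive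
  definite \<open>F\<close> is rescaled so that \<open>1 - c F\<close> is a strict contraction, and
  the root is scaled back by \<open>1 / sqrt c\<close>.\<close>

lemma ex_psd_sqrt:
  fixes F :: "real Matrix.mat"
  assumes F: "F \<in> carrier_mat d d" and sym: "transpose_mat F = F" and m: "0 < m"
    and pos: "\<And>v. v \<in> carrier_vec d \<Longrightarrow> m * scalar_prod v v \<le> scalar_prod v (F *\<^sub>v v)"
  shows "\<exists>R. psd_mat d R \<and> R * R = F"
proof -
  \<comment> \<open>\<open>K\<close> bounds the operator norm: the sum of the Euclidean norms of the
    rows, with \<open>m\<close> added so that \<open>K\<close> is positive and at least
    \<open>m\<close>.\<close>
  obtain K where K: "0 < K" "m \<le> K" "\<And>v. v \<in> carrier_vec d \<Longrightarrow> enorm (F *\<^sub>v v) \<le> K * enorm v"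
  proof -
    define S where "S = (\<Sum>i\<in>{0..<d}. enorm (Matrix.row F i))"
    have "enorm (F *\<^sub>v v) \<le> (S + m) * enorm v" if v: "v \<in> carrier_vec d" for v
    proof -
      have "enorm (F *\<^sub>v v) \<le> (\<Sum>i\<in>{0..<d}. \<bar>(F *\<^sub>v v) $ i\<bar>)"
        using L2_set_le_sum_abs[of "\<lambda>i. (F *\<^sub>v v) $ i" "{0..<d}"] F by (simp add: enorm_L2_set del: index_mult_mat_vec)
      also have "\<dots> \<le> (\<Sum>i\<in>{0..<d}. enorm (Matrix.row F i) * enorm v)"
        using F v by (intro sum_mono) (auto intro!: enorm_Cauchy_Schwarz[where d=d])
      also have "\<dots> \<le> (S + m) * enorm v"
        using m by (simp add: S_def sum_distrib_right[symmetric] distrib_right)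
      finally show ?thesis .
    qed
    moreover have "0 \<le> S" by (auto simp: S_def intro: sum_nonneg)
    ultimately show ?thesis using that[of "S + m"] m by simp
  qed
  \<comment> \<open>The squared norm of \<open>v - c F v\<close> is at most
    \<open>1 - 2 c m + (c K)^2\<close> times that of \<open>v\<close>. This \<open>c\<close>
    minimizes the factor, and \<open>b\<close> is the square root of the minimum.\<close>
  define c where "c = m / K\<^sup>2"
  define b where "b = sqrt (1 - (m / K)\<^sup>2)"
  have c: "0 < c" using m K by (simp add: c_def)
  have mK: "0 < m / K" "m / K \<le> 1" using m K by auto
  then have mK2: "0 < (m / K)\<^sup>2" "(m / K)\<^sup>2 \<le> 1" by (auto simp: power_le_one)
  have b: "0 \<le> b" "b < 1" using mK2 by (auto simp: b_def)
  define B where "B = 1\<^sub>m d - c \<cdot>\<^sub>m F"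
  have Bc: "B \<in> carrier_mat d d" unfolding B_def using F by (intro minus_carrier_mat) auto
  have Fij: "F $$ (j, i) = F $$ (i, j)" if "i < d" "j < d" for i j
    using sym that F index_transpose_mat(1)[of j F i] by auto
  have "transpose_mat B = B" unfolding B_def using F by (intro eq_matI) (auto simp: Fij)
  moreover have "enorm (B *\<^sub>v v) \<le> b * enorm v" if v: "v \<in> carrier_vec d" for v
  proof -
    have Fv: "F *\<^sub>v v \<in> carrier_vec d" using F v by auto
    have "(c \<cdot>\<^sub>m F) *\<^sub>v v = c \<cdot>\<^sub>v (F *\<^sub>v v)"
      using F v by (intro eq_vecI) (auto simp: scalar_prod_def sum_distrib_left mult.assoc)
    then have Bv: "B *\<^sub>v v = v - c \<cdot>\<^sub>v (F *\<^sub>v v)"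
      using F v by (simp add: B_def minus_mult_distrib_mat_vec[of _ d d])
    have "scalar_prod (F *\<^sub>v v) v = scalar_prod v (F *\<^sub>v v)"
      by (rule comm_scalar_prod[OF Fv v])
    then have "(enorm (B *\<^sub>v v))\<^sup>2 = (enorm v)\<^sup>2 - 2 * c * scalar_prod v (F *\<^sub>v v) + c\<^sup>2 * (enorm (F *\<^sub>v v))\<^sup>2"
      unfolding enorm_sq Bv using v Fv
      by (simp add: scalar_prod_minus_distrib[of _ d] minus_scalar_prod_distrib[of _ d] power2_eq_square algebra_simps)
    also have "\<dots> \<le> (enorm v)\<^sup>2 - 2 * c * (m * (enorm v)\<^sup>2) + c\<^sup>2 * (K * enorm v)\<^sup>2"
      using pos[OF v] K(3)[OF v] c by (intro add_mono diff_mono mult_left_mono power_mono) (auto simp: enorm_sq)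
    also have "\<dots> = (1 - (m / K)\<^sup>2) * (enorm v)\<^sup>2"
      using K(1) by (simp add: c_def power2_eq_square field_simps)
    also have "\<dots> = (b * enorm v)\<^sup>2"
      using mK2 by (simp add: b_def power_mult_distrib)
    finally show ?thesis by (rule power2_le_imp_le) (use b in auto)
  qed
  ultimately obtain R where R: "psd_mat d R" "R * R = 1\<^sub>m d - B"
    using ex_psd_sqrt_one_minus[OF Bc _ b] by blast
  have Rc: "R \<in> carrier_mat d d" using R by (simp add: psd_mat_def)
  define R' where "R' = (1 / sqrt c) \<cdot>\<^sub>m R"
  have "psd_mat d R'"
    unfolding psd_mat_def
  proof (intro conjI ballI)
    show "R' \<in> carrier_mat d d" using Rc by (simp add: R'_def)
    have "transpose_mat (x \<cdot>\<^sub>m R) = x \<cdot>\<^sub>m transpose_mat R" for x by (intro eq_matI) auto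
    then show "transpose_mat R' = R'" using R(1) by (simp add: R'_def psd_mat_def)
    fix v :: "real Matrix.vec" assume v: "v \<in> carrier_vec d"
    have "R' *\<^sub>v v = (1 / sqrt c) \<cdot>\<^sub>v (R *\<^sub>v v)"
      unfolding R'_def using Rc v by (intro eq_vecI) (auto simp: scalar_prod_def sum_distrib_left)
    then show "0 \<le> scalar_prod v (R' *\<^sub>v v)" using R(1) v Rc c by (simp add: psd_mat_def)
  qed
  moreover have "R' * R' = F"
  proof -
    have "R' * R' = (1 / sqrt c) \<cdot>\<^sub>m ((1 / sqrt c) \<cdot>\<^sub>m (R * R))"
      unfolding R'_def using Rc by (simp add: mult_smult_distrib[of _ d d _ d] mult_smult_assoc_mat[of _ d d _ d])
    also have "\<dots> = F"
      unfolding R(2) B_def using F c by (intro eq_matI) (auto simp: field_simps real_sqrt_mult[symmetric])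
    finally show ?thesis .
  qed
  ultimately show ?thesis by blast
qed

section \<open>The Fisher information\<close>

lemma mat_inv_det_nonzero:
  fixes A :: "real Matrix.mat"
  assumes A: "A \<in> carrier_mat d d" and det: "Determinant.det A \<noteq> 0"
  shows "A * mat_inv A = 1\<^sub>m d" "mat_inv A * A = 1\<^sub>m d" "mat_inv A \<in> carrier_mat d d"
proof -
  have "mat_inverse A \<noteq> None"
    using mat_inverse(1)[OF A, of "()"] det_non_zero_imp_unit[OF A det, of "()"] by auto
  then obtain B where "mat_inverse A = Some B" by auto
  with mat_inverse(2)[OF A this]
  show "A * mat_inv A = 1\<^sub>m d" "mat_inv A * A = 1\<^sub>m d" "mat_inv A \<in> carrier_mat d d"
    by (auto simp: mat_inv_def)
qed

lemma det_mat_inv: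
  fixes A :: "real Matrix.mat"
  assumes A: "A \<in> carrier_mat d d" and det: "Determinant.det A \<noteq> 0"
  shows "Determinant.det (mat_inv A) = 1 / Determinant.det A"
proof -
  have "Determinant.det A * Determinant.det (mat_inv A) = 1"
    using det_mult[OF A mat_inv_det_nonzero(3)[OF assms]] mat_inv_det_nonzero(1)[OF assms] by simp
  then show ?thesis using det by (simp add: field_simps)
qed

lemma mat_inv_mat_inv:
  fixes A :: "real Matrix.mat"
  assumes A: "A \<in> carrier_mat d d" and det: "Determinant.det A \<noteq> 0"
  shows "mat_inv (mat_inv A) = A"
proof -
  note B = mat_inv_det_nonzero[OF assms]
  have "Determinant.det (mat_inv A) \<noteq> 0" using det by (simp add: det_mat_inv[OF assms])
  note C = mat_inv_det_nonzero[OF B(3) this]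
  have "A = A * (mat_inv A * mat_inv (mat_inv A))" using C(1) A by simp
  also have "\<dots> = (A * mat_inv A) * mat_inv (mat_inv A)"
    by (rule assoc_mult_mat[symmetric, OF A B(3) C(3)])
  also have "\<dots> = mat_inv (mat_inv A)" using B(1) C(3) by simp
  finally show ?thesis ..
qed

lemma mat_sqrt_psd:
  fixes F :: "real Matrix.mat"
  assumes F: "F \<in> carrier_mat d d" and sym: "transpose_mat F = F" and m: "0 < m"
    and pos: "\<And>v. v \<in> carrier_vec d \<Longrightarrow> m * scalar_prod v v \<le> scalar_prod v (F *\<^sub>v v)"
  shows "psd_mat d (mat_sqrt F)" "mat_sqrt F * mat_sqrt F = F"
proof -
  have "dim_row F = d" using F by auto
  then have "\<exists>R. psd_mat (dim_row F) R \<and> R * R = F"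
    using ex_psd_sqrt[OF assms] by simp
  from someI_ex[OF this] show "psd_mat d (mat_sqrt F)" "mat_sqrt F * mat_sqrt F = F"
    using \<open>dim_row F = d\<close> by (auto simp: mat_sqrt_def)
qed

text \<open>Whichever root the choice operator returned, the norm is determined by the quadratic
  form of \<open>F\<close>.\<close>

lemma wnorm_sq:
  fixes F :: "real Matrix.mat"
  assumes R: "psd_mat d (mat_sqrt F)" "mat_sqrt F * mat_sqrt F = F" and v: "v \<in> carrier_vec d"
  shows "(wnorm F v)\<^sup>2 = scalar_prod v (F *\<^sub>v v)"
proof -
  define Q where "Q = mat_sqrt F"
  have Q: "Q \<in> carrier_mat d d" "transpose_mat Q = Q" "Q * Q = F"
    using R by (auto simp: psd_mat_def Q_def)
  have Qv: "Q *\<^sub>v v \<in> carrier_vec d" using Q v by auto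
  have "(wnorm F v)\<^sup>2 = scalar_prod (Q *\<^sub>v v) (Q *\<^sub>v v)"
    by (simp add: wnorm_def enorm_sq Q_def)
  also have "\<dots> = scalar_prod v (Q *\<^sub>v (Q *\<^sub>v v))"
    using transpose_vec_mult_scalar[OF Q(1) Qv v] by (simp only: Q(2))
  also have "Q *\<^sub>v (Q *\<^sub>v v) = F *\<^sub>v v"
    unfolding Q(3)[symmetric] by (rule assoc_mult_mat_vec[symmetric, OF Q(1) Q(1) v])
  finally show ?thesis .
qed

text \<open>Insert the symmetric root and its inverse between \<open>S\<close> and \<open>v\<close>,
  then apply Cauchy-Schwarz.\<close>

lemma scalar_prod_le_dual_wnorm:
  fixes F :: "real Matrix.mat"
  assumes F: "F \<in> carrier_mat d d" "Determinant.det F \<noteq> 0"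
    and R: "psd_mat d (mat_sqrt F)" "mat_sqrt F * mat_sqrt F = F"
    and v: "v \<in> carrier_vec d" "S \<in> carrier_vec d"
  shows "\<bar>scalar_prod S v\<bar> \<le> dual_wnorm F S * wnorm F v"
proof -
  define Q where "Q = mat_sqrt F"
  have Q: "Q \<in> carrier_mat d d" "transpose_mat Q = Q" "Q * Q = F"
    using R by (auto simp: psd_mat_def Q_def)
  have dQ: "Determinant.det Q \<noteq> 0" using F(2) det_mult[OF Q(1) Q(1)] by (auto simp: Q(3))
  note I = mat_inv_det_nonzero[OF Q(1) dQ]
  have Sv: "mat_inv Q *\<^sub>v S \<in> carrier_vec d" using I(3) v by auto
  have "scalar_prod S v = scalar_prod (Q *\<^sub>v (mat_inv Q *\<^sub>v S)) v"
    using assoc_mult_mat_vec[OF Q(1) I(3) v(2)] I(1) v by simp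
  also have "\<dots> = scalar_prod (mat_inv Q *\<^sub>v S) (Q *\<^sub>v v)"
    using transpose_vec_mult_scalar[OF Q(1) v(1) Sv] by (simp only: Q(2))
  also have "\<bar>\<dots>\<bar> \<le> enorm (mat_inv Q *\<^sub>v S) * enorm (Q *\<^sub>v v)"
    using Sv Q v by (intro enorm_Cauchy_Schwarz[where d=d]) auto
  finally show ?thesis by (simp add: dual_wnorm_def wnorm_def Q_def)
qed

section \<open>The Fisher matrix as a bilinear form and its Cholesky factorization\<close>

lemma sum_Suc_shift: "(\<Sum>i\<in>{0..<d}. f (Suc i)) = (\<Sum>j\<in>{1..d}. f j)"
  by (rule sum.reindex_bij_witness[of _ "\<lambda>j. j - 1" Suc]) auto

lemma vec_of_carrier [simp, intro]: "vec_of d u \<in> carrier_vec d"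
  by (simp add: vec_of_def)

lemma dim_vec_of [simp]: "dim_vec (vec_of d u) = d"
  by (simp add: vec_of_def)

lemma vec_of_index [simp]: "i < d \<Longrightarrow> vec_of d u $ i = u (Suc i)"
  by (simp add: vec_of_def)

lemma vec_of_surj: "v \<in> carrier_vec d \<Longrightarrow> v = vec_of d (\<lambda>j. v $ (j - 1))"
  by (intro eq_vecI) auto

lemma scalar_prod_vec_of: "scalar_prod (vec_of d u) (vec_of d v) = (\<Sum>j\<in>{1..d}. u j * v j)"
proof -
  have "scalar_prod (vec_of d u) (vec_of d v) = (\<Sum>i\<in>{0..<d}. u (Suc i) * v (Suc i))"
    by (simp add: scalar_prod_def)
  also have "\<dots> = (\<Sum>j\<in>{1..d}. u j * v j)" by (rule sum_Suc_shift)
  finally show ?thesis .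
qed

text \<open>The bilinear form of the Fisher matrix on functions over \<open>{1..d}\<close>. Working
  with it keeps vectors and their index shift out of all later estimates.\<close>

definition fisher_form :: "nat \<Rightarrow> (nat \<Rightarrow> real) \<Rightarrow> (nat \<Rightarrow> real) \<Rightarrow> (nat \<Rightarrow> real) \<Rightarrow> real" where
  "fisher_form d p u v = (\<Sum>j\<in>{1..d}. u j * v j / p j) + (\<Sum>j\<in>{1..d}. u j) * (\<Sum>j\<in>{1..d}. v j) / cell d p 0"

abbreviation fisher_sq :: "nat \<Rightarrow> (nat \<Rightarrow> real) \<Rightarrow> (nat \<Rightarrow> real) \<Rightarrow> real" where
  "fisher_sq d p u \<equiv> fisher_form d p u u"

lemma fisher_carrier [simp]: "fisher d p \<in> carrier_mat d d"
  by (simp add: fisher_def)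

lemma fisher_dim [simp]: "dim_row (fisher d p) = d" "dim_col (fisher d p) = d"
  by (simp_all add: fisher_def mat_diag_def)

lemma fisher_index: "i < d \<Longrightarrow> j < d \<Longrightarrow>
    fisher d p $$ (i, j) = (if i = j then 1 / p (Suc i) else 0) + 1 / cell d p 0"
  by (auto simp: fisher_def mat_diag_def)

lemma fisher_sym: "transpose_mat (fisher d p) = fisher d p"
  by (intro eq_matI) (auto simp: fisher_index)

lemma scalar_prod_fisher:
  "scalar_prod (vec_of d u) (fisher d p *\<^sub>v vec_of d v) = fisher_form d p u v"
proof -
  have "scalar_prod (vec_of d u) (fisher d p *\<^sub>v vec_of d v)
    = (\<Sum>i\<in>{0..<d}. u (Suc i) * (\<Sum>j\<in>{0..<d}. fisher d p $$ (i, j) * v (Suc j)))"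
    by (simp add: scalar_prod_def)
  also have "\<dots> = (\<Sum>i\<in>{0..<d}. u (Suc i) * (v (Suc i) / p (Suc i) + (\<Sum>j\<in>{0..<d}. v (Suc j)) / cell d p 0))"
  proof (intro sum.cong refl arg_cong[where f="\<lambda>z. _ * z"])
    fix i assume i: "i \<in> {0..<d}"
    have "(\<Sum>j\<in>{0..<d}. fisher d p $$ (i, j) * v (Suc j))
       = (\<Sum>j\<in>{0..<d}. (if i = j then v (Suc j) / p (Suc j) else 0) + v (Suc j) / cell d p 0)"
      using i by (intro sum.cong) (auto simp: fisher_index distrib_right)
    then show "(\<Sum>j\<in>{0..<d}. fisher d p $$ (i, j) * v (Suc j))
      = v (Suc i) / p (Suc i) + (\<Sum>j\<in>{0..<d}. v (Suc j)) / cell d p 0"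
      using i by (simp add: sum.distrib sum_divide_distrib)
  qed
  also have "\<dots> = (\<Sum>i\<in>{0..<d}. u (Suc i) * v (Suc i) / p (Suc i))
      + (\<Sum>i\<in>{0..<d}. u (Suc i)) * (\<Sum>j\<in>{0..<d}. v (Suc j)) / cell d p 0"
    unfolding distrib_left sum.distrib by (simp add: sum_distrib_right[symmetric] sum_divide_distrib[symmetric])
  also have "\<dots> = fisher_form d p u v"
    unfolding fisher_form_def sum_Suc_shift[of u] sum_Suc_shift[of v] sum_Suc_shift[of "\<lambda>j. u j * v j / p j"] ..
  finally show ?thesis .
qed

text \<open>The mass left after the cells \<open>1..k\<close>, as in stick breaking; at
  \<open>k = d\<close> it is the probability of cell 0.\<close>

definition tail_mass :: "(nat \<Rightarrow> real) \<Rightarrow> nat \<Rightarrow> real" where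
  "tail_mass p k = 1 - (\<Sum>j\<in>{1..k}. p j)"

text \<open>The square root of the \<open>k\<close>-th pivot of \<open>diag p - p p^T\<close>:
  eliminating the earlier coordinates leaves
  \<open>p k - (p k)^2 / tail_mass p (k - 1)\<close>.\<close>

definition chol_diag :: "(nat \<Rightarrow> real) \<Rightarrow> nat \<Rightarrow> real" where
  "chol_diag p k = sqrt (p k * tail_mass p k / tail_mass p (k - 1))"

text \<open>The Cholesky factor of \<open>diag p - p p\<^sup>T\<close>, the inverse of the Fisher information, in closed form.\<close>

definition chol_map :: "(nat \<Rightarrow> real) \<Rightarrow> (nat \<Rightarrow> real) \<Rightarrow> nat \<Rightarrow> real" where
  "chol_map p x k = chol_diag p k * x k - p k * (\<Sum>i\<in>{1..<k}. chol_diag p i / tail_mass p i * x i)"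

lemma tail_mass_0 [simp]: "tail_mass p 0 = 1"
  by (simp add: tail_mass_def)

lemma tail_mass_Suc: "tail_mass p (Suc k) = tail_mass p k - p (Suc k)"
  by (simp add: tail_mass_def)

lemma cell_0_eq_tail_mass: "cell d p 0 = tail_mass p d"
  by (simp add: cell_def tail_mass_def)

lemma cell_pos:
  assumes p: "p \<in> Theta d" and j: "j \<le> d"
  shows "0 < cell d p j"
  using p j by (cases "j = 0") (auto simp: Theta_def cell_def)

lemma sum_cell: "(\<Sum>j\<in>{0..d}. cell d p j) = 1"
proof -
  have "(\<Sum>j\<in>{0..d}. cell d p j) = cell d p 0 + (\<Sum>j\<in>{1..d}. cell d p j)"
    by (simp add: sum.atLeast_Suc_atMost)
  also have "(\<Sum>j\<in>{1..d}. cell d p j) = (\<Sum>j\<in>{1..d}. p j)"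
    by (intro sum.cong) (auto simp: cell_def)
  finally show ?thesis by (simp add: cell_def)
qed

lemma tail_mass_pos:
  assumes p: "p \<in> Theta d" and k: "k \<le> d"
  shows "0 < tail_mass p k"
proof -
  have "(\<Sum>j\<in>{1..k}. p j) \<le> (\<Sum>j\<in>{1..d}. p j)"
    using p k by (intro sum_mono2) (auto simp: Theta_def intro: less_imp_le)
  then show ?thesis using p by (simp add: tail_mass_def Theta_def)
qed

lemma chol_diag_pos:
  assumes p: "p \<in> Theta d" and k: "k \<in> {1..d}"
  shows "0 < chol_diag p k"
  using p k tail_mass_pos[OF p, of k] tail_mass_pos[OF p, of "k - 1"]
  by (auto simp: chol_diag_def Theta_def)

lemma chol_diag_sq:
  assumes p: "p \<in> Theta d" and k: "k \<in> {1..d}"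
  shows "(chol_diag p k)\<^sup>2 = p k * tail_mass p k / tail_mass p (k - 1)"
  using p k tail_mass_pos[OF p, of k] tail_mass_pos[OF p, of "k - 1"]
  unfolding chol_diag_def by (intro real_sqrt_pow2) (auto simp: Theta_def less_imp_le)

text \<open>The rank one part of the Fisher form depends only on the total of the coordinates; these
  partial sums collapse because each step subtracts \<open>p k\<close> times the previous weighted
  sum while the tail mass drops by \<open>p k\<close>.\<close>

lemma sum_chol_map:
  assumes p: "p \<in> Theta d" and k: "k \<le> d"
  shows "(\<Sum>j\<in>{1..k}. chol_map p x j) = tail_mass p k * (\<Sum>i\<in>{1..k}. chol_diag p i / tail_mass p i * x i)"
  using k
proof (induction k)
  case (Suc k)
  define W where "W = (\<Sum>i\<in>{1..k}. chol_diag p i / tail_mass p i * x i)"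
  have t: "0 < tail_mass p (Suc k)" using tail_mass_pos[OF p Suc.prems] .
  have "(\<Sum>j\<in>{1..Suc k}. chol_map p x j) = tail_mass p k * W + (chol_diag p (Suc k) * x (Suc k) - p (Suc k) * W)"
    using Suc by (simp add: W_def chol_map_def[of p x "Suc k"] atLeastLessThanSuc_atLeastAtMost)
  also have "\<dots> = tail_mass p (Suc k) * W + chol_diag p (Suc k) * x (Suc k)"
    by (simp add: tail_mass_Suc algebra_simps)
  also have "\<dots> = tail_mass p (Suc k) * (W + chol_diag p (Suc k) / tail_mass p (Suc k) * x (Suc k))"
    using t by (simp add: distrib_left)
  finally show ?case by (simp add: W_def)
qed simp

lemma fisher_form_chol_map:
  assumes p: "p \<in> Theta d"
  shows "fisher_form d p (chol_map p x) (chol_map p y) = (\<Sum>i\<in>{1..d}. x i * y i)"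
proof -
  \<comment> \<open>The claim is generalized to the first \<open>k\<close> coordinates, with
    \<open>tail_mass p k\<close> in the role of cell 0. In the induction step the cross terms
    cancel, and \<open>a * a * (1 / q + 1 / t) = 1\<close> leaves exactly the new product of
    coordinates.\<close>
  have "(\<Sum>j\<in>{1..k}. chol_map p x j * chol_map p y j / p j)
      + (\<Sum>j\<in>{1..k}. chol_map p x j) * (\<Sum>j\<in>{1..k}. chol_map p y j) / tail_mass p k = (\<Sum>i\<in>{1..k}. x i * y i)"
    if "k \<le> d" for k
    using that
  proof (induction k)
    case (Suc k)
    define W where "W = (\<Sum>i\<in>{1..k}. chol_diag p i / tail_mass p i * x i)"
    define V where "V = (\<Sum>i\<in>{1..k}. chol_diag p i / tail_mass p i * y i)"
    define a where "a = chol_diag p (Suc k)"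
    define t where "t = tail_mass p (Suc k)"
    define q where "q = p (Suc k)"
    have t: "0 < t" using tail_mass_pos[OF p Suc.prems] by (simp add: t_def)
    have q: "0 < q" using p Suc.prems by (auto simp: q_def Theta_def)
    have tk: "tail_mass p k = t + q" by (simp add: t_def q_def tail_mass_Suc)
    have a2: "a * a = q * t / (t + q)"
      using chol_diag_sq[OF p, of "Suc k"] Suc.prems by (simp add: a_def q_def t_def tk[unfolded t_def q_def] power2_eq_square)
    have Sx: "(\<Sum>j\<in>{1..k}. chol_map p x j) = (t + q) * W" "(\<Sum>j\<in>{1..k}. chol_map p y j) = (t + q) * V"
      using sum_chol_map[OF p, of k] Suc.prems by (simp_all add: W_def V_def tk)
    have Tx: "chol_map p x (Suc k) = a * x (Suc k) - q * W" "chol_map p y (Suc k) = a * y (Suc k) - q * V"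
      by (simp_all add: chol_map_def a_def q_def W_def V_def atLeastLessThanSuc_atLeastAtMost)
    have IH: "(\<Sum>j\<in>{1..k}. chol_map p x j * chol_map p y j / p j) = (\<Sum>i\<in>{1..k}. x i * y i) - (t + q) * W * V"
    proof -
      have tq: "t + q \<noteq> 0" using t q by simp
      have "((t + q) * W) * ((t + q) * V) / (t + q) = (t + q) * W * V" using tq by (simp add: field_simps)
      then show ?thesis using Suc.IH Suc.prems unfolding Sx tk by linarith
    qed
    have "(a * x (Suc k) - q * W) * (a * y (Suc k) - q * V) / q
        + (t * W + a * x (Suc k)) * (t * V + a * y (Suc k)) / t - (t + q) * W * V = (a * a) * (1 / q + 1 / t) * (x (Suc k) * y (Suc k))"
      using t q by (simp add: field_simps)
    also have "(a * a) * (1 / q + 1 / t) = 1"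
    proof -
      have "1 / q + 1 / t = (t + q) / (q * t)" "t + q \<noteq> 0" using t q by (simp_all add: field_simps)
      then show ?thesis unfolding a2 using t q by simp
    qed
    finally have eq: "(a * x (Suc k) - q * W) * (a * y (Suc k) - q * V) / q
        + (t * W + a * x (Suc k)) * (t * V + a * y (Suc k)) / t - (t + q) * W * V = x (Suc k) * y (Suc k)"
      by simp
    have S: "(\<Sum>j\<in>{1..Suc k}. chol_map p x j) = t * W + a * x (Suc k)"
      "(\<Sum>j\<in>{1..Suc k}. chol_map p y j) = t * V + a * y (Suc k)"
      using Sx Tx by (simp_all add: algebra_simps)
    have P: "(\<Sum>j\<in>{1..Suc k}. chol_map p x j * chol_map p y j / p j)
        = (\<Sum>i\<in>{1..k}. x i * y i) - (t + q) * W * V + (a * x (Suc k) - q * W) * (a * y (Suc k) - q * V) / q"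
      using IH by (simp add: Tx q_def[symmetric])
    have Z: "(\<Sum>i\<in>{1..Suc k}. x i * y i) = (\<Sum>i\<in>{1..k}. x i * y i) + x (Suc k) * y (Suc k)" by simp
    show ?case unfolding S P Z t_def[symmetric] using eq by linarith
  qed simp
  from this[of d] show ?thesis by (simp add: fisher_form_def cell_0_eq_tail_mass)
qed

text \<open>The preceding identity says that the transpose of \<open>T\<close> times the Fisher
  matrix times \<open>T\<close> is the identity for the lower triangular matrix \<open>T\<close> of
  \<open>chol_map\<close>, and the determinant of \<open>T\<close> is the product of its
  diagonal.\<close>

lemma det_fisher:
  assumes p: "p \<in> Theta d"
  shows "Determinant.det (fisher d p) = 1 / (\<Prod>k\<in>{1..d}. chol_diag p k)\<^sup>2"
proof -
  define T where "T = Matrix.mat d d (\<lambda>(i, j). if j = i then chol_diag p (Suc i)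
      else if j < i then - p (Suc i) * (chol_diag p (Suc j) / tail_mass p (Suc j)) else 0)"
  define e where "e j = (\<lambda>i. if i = Suc j then 1 else 0 :: real)" for j :: nat
  have T: "T \<in> carrier_mat d d" by (simp add: T_def)
  have colT: "Matrix.col T j = vec_of d (chol_map p (e j))" if j: "j < d" for j
  proof (intro eq_vecI)
    fix i assume "i < dim_vec (vec_of d (chol_map p (e j)))"
    then have i: "i < d" by simp
    have "(\<Sum>k\<in>{1..<Suc i}. chol_diag p k / tail_mass p k * e j k)
        = (\<Sum>k\<in>{1..<Suc i}. if k = Suc j then chol_diag p k / tail_mass p k else 0)"
      by (intro sum.cong) (auto simp: e_def)
    also have "\<dots> = (if j < i then chol_diag p (Suc j) / tail_mass p (Suc j) else 0)"
      by (subst sum.delta) auto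
    finally show "Matrix.col T j $ i = vec_of d (chol_map p (e j)) $ i"
      using i j by (auto simp: T_def chol_map_def e_def)
  qed (use T in simp)
  have "transpose_mat T * (fisher d p * T) = 1\<^sub>m d"
  proof (intro eq_matI)
    fix i j assume "i < dim_row (1\<^sub>m d :: real Matrix.mat)" "j < dim_col (1\<^sub>m d :: real Matrix.mat)"
    then have ij: "i < d" "j < d" by auto
    have "(transpose_mat T * (fisher d p * T)) $$ (i, j) = scalar_prod (Matrix.col T i) (fisher d p *\<^sub>v Matrix.col T j)"
      using ij T col_mult2[OF fisher_carrier T ij(2)] by simp
    also have "\<dots> = (\<Sum>k\<in>{1..d}. e i k * e j k)"
      unfolding colT[OF ij(1)] colT[OF ij(2)] scalar_prod_fisher by (rule fisher_form_chol_map[OF p])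
    also have "\<dots> = (\<Sum>k\<in>{1..d}. if k = Suc i then (if i = j then 1 else 0) else 0)"
      by (intro sum.cong) (auto simp: e_def)
    also have "\<dots> = (1\<^sub>m d :: real Matrix.mat) $$ (i, j)"
      using ij by (subst sum.delta) auto
    finally show "(transpose_mat T * (fisher d p * T)) $$ (i, j) = (1\<^sub>m d :: real Matrix.mat) $$ (i, j)" .
  qed (use T in auto)
  then have "Determinant.det T * (Determinant.det (fisher d p) * Determinant.det T) = 1"
    using T by (metis det_mult det_one det_transpose fisher_carrier mult_carrier_mat transpose_carrier_mat)
  moreover have "Determinant.det T = (\<Prod>k\<in>{1..d}. chol_diag p k)"
  proof -
    have "Determinant.det T = prod_list (diag_mat T)"
      by (rule det_lower_triangular[OF _ T]) (auto simp: T_def)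
    also have "\<dots> = (\<Prod>i\<in>{0..<d}. chol_diag p (Suc i))"
      using T by (simp add: diag_mat_def prod.list_conv_set_nth) (auto intro!: prod.cong simp: T_def)
    also have "\<dots> = (\<Prod>k\<in>{1..d}. chol_diag p k)"
      by (rule prod.reindex_bij_witness[of _ "\<lambda>j. j - 1" Suc]) auto
    finally show ?thesis .
  qed
  moreover have "(\<Prod>k\<in>{1..d}. chol_diag p k) \<noteq> 0"
    using chol_diag_pos[OF p] by (simp add: less_imp_neq[symmetric] del: atLeastAtMost_iff)
  ultimately show ?thesis by (simp add: field_simps power2_eq_square)
qed

lemma prod_chol_diag_pos: "p \<in> Theta d \<Longrightarrow> 0 < (\<Prod>k\<in>{1..d}. chol_diag p k)"
  by (intro prod_pos ballI chol_diag_pos)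

lemma det_fisher_nonzero: "p \<in> Theta d \<Longrightarrow> Determinant.det (fisher d p) \<noteq> 0"
  using prod_chol_diag_pos[of p d] det_fisher[of p d]
  by (metis divide_eq_0_iff less_irrefl power_not_zero zero_neq_one)

lemma sum_sq_le_fisher_sq:
  assumes p: "p \<in> Theta d"
  shows "(\<Sum>j\<in>{1..d}. (u j)\<^sup>2 / p j) \<le> fisher_sq d p u"
  using cell_pos[OF p, of 0] by (simp add: fisher_form_def power2_eq_square)

lemma Theta_le_1:
  assumes p: "p \<in> Theta d" and j: "j \<in> {1..d}"
  shows "p j \<le> 1"
proof -
  have "p j \<le> (\<Sum>k\<in>{1..d}. p k)"
    using p j by (intro member_le_sum) (auto simp: Theta_def intro: less_imp_le)
  then show ?thesis using p by (simp add: Theta_def)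
qed

text \<open>Every \<open>p j\<close> is at most 1, so the Fisher matrix dominates the identity; this
  supplies the lower bound \<open>m = 1\<close> for the existence of the root.\<close>

lemma fisher_sqrt:
  assumes p: "p \<in> Theta d"
  shows "psd_mat d (mat_sqrt (fisher d p))" "mat_sqrt (fisher d p) * mat_sqrt (fisher d p) = fisher d p"
proof -
  have pos: "1 * scalar_prod v v \<le> scalar_prod v (fisher d p *\<^sub>v v)" if v: "v \<in> carrier_vec d" for v
  proof -
    define u where "u = (\<lambda>j. v $ (j - 1))"
    have v: "v = vec_of d u" unfolding u_def by (rule vec_of_surj[OF v])
    have "(\<Sum>j\<in>{1..d}. (u j)\<^sup>2) \<le> (\<Sum>j\<in>{1..d}. (u j)\<^sup>2 / p j)"
    proof (intro sum_mono)
      fix j assume j: "j \<in> {1..d}"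
      have "0 < p j" using p j by (auto simp: Theta_def)
      moreover have "(u j)\<^sup>2 * p j \<le> (u j)\<^sup>2"
        using Theta_le_1[OF p j] by (simp add: mult_left_le)
      ultimately show "(u j)\<^sup>2 \<le> (u j)\<^sup>2 / p j" by (simp add: le_divide_eq)
    qed
    also have "\<dots> \<le> fisher_sq d p u" by (rule sum_sq_le_fisher_sq[OF p])
    finally show ?thesis by (simp add: v scalar_prod_fisher scalar_prod_vec_of power2_eq_square)
  qed
  show "psd_mat d (mat_sqrt (fisher d p))"
    by (rule mat_sqrt_psd(1)[OF fisher_carrier fisher_sym, of 1]) (simp, rule pos)
  show "mat_sqrt (fisher d p) * mat_sqrt (fisher d p) = fisher d p"
    by (rule mat_sqrt_psd(2)[OF fisher_carrier fisher_sym, of 1]) (simp, rule pos)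
qed

lemma wnorm_fisher:
  assumes p: "p \<in> Theta d"
  shows "wnorm (fisher d p) (vec_of d u) = sqrt (fisher_sq d p u)"
  using wnorm_sq[OF fisher_sqrt[OF p] vec_of_carrier, of u] enorm_nonneg
  by (metis real_sqrt_unique scalar_prod_fisher wnorm_def)

lemma sum_le_dual_wnorm_fisher:
  assumes p: "p \<in> Theta d"
  shows "\<bar>\<Sum>j\<in>{1..d}. S j * v j\<bar> \<le> dual_wnorm (fisher d p) (vec_of d S) * sqrt (fisher_sq d p v)"
  using scalar_prod_le_dual_wnorm[OF fisher_carrier det_fisher_nonzero[OF p] fisher_sqrt[OF p] vec_of_carrier vec_of_carrier, of S v]
  by (simp add: scalar_prod_vec_of wnorm_fisher[OF p])

text \<open>Adding a coordinate 0 that compensates the others turns the rank one term into the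
  summand of cell 0. The form becomes the chi-square form, symmetric in all \<open>d + 1\<close>
  cells.\<close>

lemma fisher_form_eq_cells:
  assumes "u 0 = - (\<Sum>j\<in>{1..d}. u j)" "v 0 = - (\<Sum>j\<in>{1..d}. v j)"
  shows "fisher_form d p u v = (\<Sum>j\<in>{0..d}. u j * v j / cell d p j)"
proof -
  have "(\<Sum>j\<in>{0..d}. u j * v j / cell d p j) = u 0 * v 0 / cell d p 0 + (\<Sum>j\<in>{1..d}. u j * v j / cell d p j)"
    by (simp add: sum.atLeast_Suc_atMost)
  also have "(\<Sum>j\<in>{1..d}. u j * v j / cell d p j) = (\<Sum>j\<in>{1..d}. u j * v j / p j)"
    by (intro sum.cong) (auto simp: cell_def)
  finally show ?thesis using assms by (simp add: fisher_form_def)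
qed

section \<open>Standardizing coordinates\<close>

text \<open>Induction that peels off the last coordinate. By Tonelli the shift
  \<open>g (Suc d)\<close> is constant in the inner integral, so each coordinate undergoes an affine
  substitution in one variable.\<close>

lemma nn_integral_triangular:
  fixes a :: "nat \<Rightarrow> real" and g :: "nat \<Rightarrow> (nat \<Rightarrow> real) \<Rightarrow> real"
  assumes a: "\<And>k. k \<in> {1..d} \<Longrightarrow> 0 < a k"
    and g: "\<And>k. k \<in> {1..d} \<Longrightarrow> g k \<in> borel_measurable (lebesgue_Rd d)"
    and dep: "\<And>k x y. k \<in> {1..d} \<Longrightarrow> (\<And>j. j \<in> {1..<k} \<Longrightarrow> x j = y j) \<Longrightarrow> g k x = g k y"
    and h: "h \<in> borel_measurable (lebesgue_Rd d)"
  shows "(\<integral>\<^sup>+ u. h u \<partial>lebesgue_Rd d)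
     = ennreal (\<Prod>k\<in>{1..d}. a k) * (\<integral>\<^sup>+ x. h (\<lambda>k\<in>{1..d}. a k * x k + g k x) \<partial>lebesgue_Rd d)"
  using assms
proof (induction d arbitrary: h)
  case 0
  show ?case by (simp add: lebesgue_Rd_def PiM_empty nn_integral_count_space_finite)
next
  case (Suc d)
  interpret product_sigma_finite "\<lambda>_::nat. lborel :: real measure" ..
  let ?P = "\<lambda>d. PiM {1..d} (\<lambda>_::nat. lborel :: real measure)"
  have ins: "{1..Suc d} = insert (Suc d) {1..d}" by auto
  note [measurable] = Suc.prems(4)[unfolded lebesgue_Rd_def]
  \<comment> \<open>The coordinate \<open>Suc d\<close> does not influence \<open>g k\<close>, so
    fixing it to 0 transfers measurability from dimension \<open>Suc d\<close> to
    \<open>d\<close>.\<close>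
  have g_meas: "g k \<in> borel_measurable (?P d)" if k: "k \<in> {1..d}" for k
  proof -
    have "(\<lambda>x. g k (x(Suc d := 0))) \<in> borel_measurable (?P d)"
      using Suc.prems(2)[of k] k unfolding lebesgue_Rd_def ins by (intro measurable_compose[OF _ Suc.prems(2)[unfolded lebesgue_Rd_def ins]] measurable_fun_upd) auto
    then show ?thesis
      by (rule measurable_cong[THEN iffD1, rotated]) (use k in \<open>auto intro!: Suc.prems(3)\<close>)
  qed
  have gS_meas[measurable]: "g (Suc d) \<in> borel_measurable (?P d)"
  proof -
    have "(\<lambda>x. g (Suc d) (x(Suc d := 0))) \<in> borel_measurable (?P d)"
      by (intro measurable_compose[OF _ Suc.prems(2)[unfolded lebesgue_Rd_def ins]] measurable_fun_upd) auto
    then show ?thesis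
      by (rule measurable_cong[THEN iffD1, rotated]) (auto intro!: Suc.prems(3))
  qed
  define T where "T = (\<lambda>x. \<lambda>k\<in>{1..d}. a k * x k + g k x)"
  define T' where "T' = (\<lambda>x. \<lambda>k\<in>{1..Suc d}. a k * x k + g k x)"
  define H where "H v = (\<integral>\<^sup>+ y. h (v(Suc d := y)) \<partial>lborel)" for v
  have upd[measurable]: "(\<lambda>(x, y). x(Suc d := y)) \<in> measurable (?P d \<Otimes>\<^sub>M lborel) (?P (Suc d))"
    unfolding ins by (rule measurable_add_dim)
  have H_meas: "H \<in> borel_measurable (?P d)"
    unfolding H_def by measurable
  have T'_meas: "T' \<in> measurable (?P (Suc d)) (?P (Suc d))"
    unfolding T'_def
  proof (intro measurable_restrict)
    fix k assume k: "k \<in> {1..Suc d}"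
    have [measurable]: "g k \<in> borel_measurable (?P (Suc d))"
      using Suc.prems(2)[OF k] by (simp add: lebesgue_Rd_def)
    have [measurable]: "(\<lambda>x. x k) \<in> borel_measurable (?P (Suc d))"
      using measurable_component_singleton[OF k, of "\<lambda>_. lborel :: real measure"] by simp
    show "(\<lambda>x. a k * x k + g k x) \<in> measurable (?P (Suc d)) lborel"
      unfolding measurable_lborel2 by measurable
  qed
  have T': "T' (x(Suc d := y)) = (T x)(Suc d := g (Suc d) x + a (Suc d) * y)" if "x \<in> space (?P d)" for x y
  proof
    fix k
    have "k \<in> {1..d} \<Longrightarrow> g k (x(Suc d := y)) = g k x" by (intro Suc.prems(3)) auto
    moreover have "g (Suc d) (x(Suc d := y)) = g (Suc d) x" by (intro Suc.prems(3)) auto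
    ultimately show "T' (x(Suc d := y)) k = ((T x)(Suc d := g (Suc d) x + a (Suc d) * y)) k"
      by (auto simp: T_def T'_def)
  qed
  have hT': "(\<lambda>(x, y). h (T' (x(Suc d := y)))) \<in> borel_measurable (?P d \<Otimes>\<^sub>M lborel)"
    using measurable_compose[OF upd measurable_compose[OF T'_meas Suc.prems(4)[unfolded lebesgue_Rd_def]]]
    by (simp add: split_beta')
  have ap: "0 < a (Suc d)" using Suc.prems(1)[of "Suc d"] by simp
  have "(\<integral>\<^sup>+ u. h u \<partial>?P (Suc d)) = (\<integral>\<^sup>+ v. H v \<partial>?P d)"
    unfolding ins H_def
    by (rule product_nn_integral_insert) (simp, simp, rule Suc.prems(4)[unfolded lebesgue_Rd_def ins])
  also have "\<dots> = ennreal (\<Prod>k\<in>{1..d}. a k) * (\<integral>\<^sup>+ x. H (T x) \<partial>?P d)"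
    unfolding T_def lebesgue_Rd_def[symmetric]
  proof (rule Suc.IH)
    show "0 < a k" if "k \<in> {1..d}" for k
      using that by (intro Suc.prems(1)) auto
    show "g k \<in> borel_measurable (lebesgue_Rd d)" if "k \<in> {1..d}" for k
      unfolding lebesgue_Rd_def using that by (rule g_meas)
    show "g k x = g k y" if "k \<in> {1..d}" "\<And>j. j \<in> {1..<k} \<Longrightarrow> x j = y j" for k x y
      by (rule Suc.prems(3)) (use that in auto)
    show "H \<in> borel_measurable (lebesgue_Rd d)"
      unfolding lebesgue_Rd_def by (rule H_meas)
  qed
  also have "(\<integral>\<^sup>+ x. H (T x) \<partial>?P d) = (\<integral>\<^sup>+ x. ennreal (a (Suc d)) * (\<integral>\<^sup>+ y. h (T' (x(Suc d := y))) \<partial>lborel) \<partial>?P d)"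
  proof (intro nn_integral_cong)
    fix x assume x: "x \<in> space (?P d)"
    have Tx: "T x \<in> space (?P d)" by (auto simp: T_def space_PiM)
    have "(\<lambda>y. (T x)(Suc d := y)) \<in> measurable lborel (?P (Suc d))"
      using measurable_compose[OF measurable_Pair1'[OF Tx] upd] by (simp only: split_conv)
    from measurable_compose[OF this Suc.prems(4)[unfolded lebesgue_Rd_def]]
    have [measurable]: "(\<lambda>y. h ((T x)(Suc d := y))) \<in> borel_measurable borel"
      unfolding measurable_cong_sets[OF sets_lborel refl] .
    have "H (T x) = ennreal \<bar>a (Suc d)\<bar> * (\<integral>\<^sup>+ y. h ((T x)(Suc d := g (Suc d) x + a (Suc d) * y)) \<partial>lborel)"
      unfolding H_def using ap by (intro nn_integral_real_affine) auto
    then show "H (T x) = ennreal (a (Suc d)) * (\<integral>\<^sup>+ y. h (T' (x(Suc d := y))) \<partial>lborel)"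
      using ap by (simp add: T'[OF x])
  qed
  also have "\<dots> = ennreal (a (Suc d)) * (\<integral>\<^sup>+ x. (\<integral>\<^sup>+ y. h (T' (x(Suc d := y))) \<partial>lborel) \<partial>?P d)"
    by (rule nn_integral_cmult) (rule lborel.borel_measurable_nn_integral[OF hT'])
  also have "(\<integral>\<^sup>+ x. (\<integral>\<^sup>+ y. h (T' (x(Suc d := y))) \<partial>lborel) \<partial>?P d) = (\<integral>\<^sup>+ x. h (T' x) \<partial>?P (Suc d))"
    unfolding ins
    by (rule product_nn_integral_insert[symmetric])
      (simp, simp, rule measurable_compose[OF T'_meas Suc.prems(4)[unfolded lebesgue_Rd_def], unfolded ins])
  finally have eq: "(\<integral>\<^sup>+ u. h u \<partial>?P (Suc d)) = ennreal (\<Prod>k\<in>{1..d}. a k) *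
      (ennreal (a (Suc d)) * (\<integral>\<^sup>+ x. h (T' x) \<partial>?P (Suc d)))" .
  have "0 \<le> (\<Prod>k\<in>{1..d}. a k)"
    by (intro prod_nonneg ballI less_imp_le Suc.prems(1)) auto
  moreover have "(\<Prod>k\<in>{1..Suc d}. a k) = (\<Prod>k\<in>{1..d}. a k) * a (Suc d)" by simp
  ultimately have "ennreal (\<Prod>k\<in>{1..Suc d}. a k) = ennreal (\<Prod>k\<in>{1..d}. a k) * ennreal (a (Suc d))"
    using ap by (simp only: ennreal_mult less_imp_le)
  then show ?case
    unfolding lebesgue_Rd_def eq by (simp only: mult.assoc T'_def)
qed

lemma nn_integral_stdN_prod:
  assumes "finite I" and "h \<in> borel_measurable (PiM I (\<lambda>_. lborel))"
  shows "(\<integral>\<^sup>+ x. h x \<partial>stdN_prod I)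
     = (\<integral>\<^sup>+ x. ennreal (\<Prod>i\<in>I. std_normal_density (x i)) * h x \<partial>PiM I (\<lambda>_. lborel))"
  using assms
proof (induction I arbitrary: h rule: finite_induct)
  case empty
  show ?case by (simp add: PiM_empty nn_integral_count_space_finite)
next
  case (insert i I)
  interpret L: product_sigma_finite "\<lambda>_. lborel :: real measure" ..
  interpret N: prob_space stdN by (rule prob_space_stdN)
  interpret N: product_sigma_finite "\<lambda>_. stdN" ..
  have sets_eq: "sets (stdN_prod J) = sets (PiM J (\<lambda>_. lborel :: real measure))" for J :: "'a set"
    by (intro sets_PiM_cong) auto
  have h: "h \<in> borel_measurable (stdN_prod (insert i I))"
    using insert.prems measurable_cong_sets[OF sets_eq refl] by blast
  note [measurable] = insert.prems
  have upd[measurable]: "(\<lambda>(x, y). x(i := y)) \<in> measurable (PiM I (\<lambda>_. lborel) \<Otimes>\<^sub>M lborel) (PiM (insert i I) (\<lambda>_. lborel :: real measure))"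
    by (rule measurable_add_dim)
  have hu[measurable]: "(\<lambda>(x, y). h (x(i := y))) \<in> borel_measurable (PiM I (\<lambda>_. lborel) \<Otimes>\<^sub>M lborel)"
    using measurable_compose[OF upd insert.prems] by (simp add: split_beta')
  have inner: "(\<integral>\<^sup>+ y. h (x(i := y)) \<partial>stdN) = (\<integral>\<^sup>+ y. ennreal (std_normal_density y) * h (x(i := y)) \<partial>lborel)"
    if x: "x \<in> space (PiM I (\<lambda>_. lborel))" for x
    using measurable_compose[OF measurable_Pair1'[OF x] hu] by (subst nn_integral_density) auto
  have pr: "(\<Prod>j\<in>insert i I. std_normal_density ((x(i := y)) j))
      = std_normal_density y * (\<Prod>j\<in>I. std_normal_density (x j))" for x y
    using insert.hyps by (subst prod.insert) (auto intro!: arg_cong2[where f="(*)"] prod.cong)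
  have prn: "0 \<le> (\<Prod>j\<in>I. std_normal_density (x j))" for x by (intro prod_nonneg) auto
  have "(\<integral>\<^sup>+ x. h x \<partial>stdN_prod (insert i I)) = (\<integral>\<^sup>+ x. (\<integral>\<^sup>+ y. h (x(i := y)) \<partial>stdN) \<partial>stdN_prod I)"
    by (rule N.product_nn_integral_insert[OF insert.hyps h])
  also have "\<dots> = (\<integral>\<^sup>+ x. (\<integral>\<^sup>+ y. ennreal (std_normal_density y) * h (x(i := y)) \<partial>lborel) \<partial>stdN_prod I)"
    by (intro nn_integral_cong inner) (auto simp: space_PiM PiE_def extensional_def)
  also have "\<dots> = (\<integral>\<^sup>+ x. ennreal (\<Prod>j\<in>I. std_normal_density (x j)) *
       (\<integral>\<^sup>+ y. ennreal (std_normal_density y) * h (x(i := y)) \<partial>lborel) \<partial>PiM I (\<lambda>_. lborel))"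
    by (rule insert.IH) measurable
  also have "\<dots> = (\<integral>\<^sup>+ x. (\<integral>\<^sup>+ y. ennreal (\<Prod>j\<in>insert i I. std_normal_density ((x(i := y)) j)) * h (x(i := y)) \<partial>lborel) \<partial>PiM I (\<lambda>_. lborel))"
  proof (intro nn_integral_cong)
    fix x :: "'a \<Rightarrow> real" assume x: "x \<in> space (PiM I (\<lambda>_. lborel))"
    have [measurable]: "(\<lambda>y. h (x(i := y))) \<in> borel_measurable borel"
      using measurable_compose[OF measurable_Pair1'[OF x] hu] by simp
    show "ennreal (\<Prod>j\<in>I. std_normal_density (x j)) * (\<integral>\<^sup>+ y. ennreal (std_normal_density y) * h (x(i := y)) \<partial>lborel)
      = (\<integral>\<^sup>+ y. ennreal (\<Prod>j\<in>insert i I. std_normal_density ((x(i := y)) j)) * h (x(i := y)) \<partial>lborel)"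
      unfolding pr ennreal_mult[OF normal_density_nonneg prn]
      by (subst nn_integral_cmult[symmetric]) (auto simp: mult_ac)
  qed
  also have "\<dots> = (\<integral>\<^sup>+ x. ennreal (\<Prod>j\<in>insert i I. std_normal_density (x j)) * h x \<partial>PiM (insert i I) (\<lambda>_. lborel))"
    using insert.hyps by (intro L.product_nn_integral_insert[symmetric]) auto
  finally show ?case .
qed

text \<open>Pushes the standard Gaussian forward to the normal law with mean \<open>\<mu>\<close>
  and covariance the inverse of \<open>n\<close> times the Fisher matrix, as
  \<open>nn_integral_mvn\<close> confirms.\<close>

definition std_map :: "nat \<Rightarrow> (nat \<Rightarrow> real) \<Rightarrow> nat \<Rightarrow> (nat \<Rightarrow> real) \<Rightarrow> (nat \<Rightarrow> real) \<Rightarrow> nat \<Rightarrow> real" where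
  "std_map d p n \<mu> x = (\<lambda>k\<in>{1..d}. \<mu> k + chol_map p x k / sqrt (real n))"

text \<open>The normalizer of that normal law: \<open>(2 pi)^(d/2)\<close> times the Jacobian of
  \<open>std_map\<close>.\<close>

definition gauss_const :: "nat \<Rightarrow> (nat \<Rightarrow> real) \<Rightarrow> nat \<Rightarrow> real" where
  "gauss_const d p n = sqrt (2 * pi) ^ d * (\<Prod>k\<in>{1..d}. chol_diag p k / sqrt (real n))"

lemma std_map_measurable: "std_map d p n \<mu> \<in> measurable (lebesgue_Rd d) (lebesgue_Rd d)"
  unfolding std_map_def chol_map_def lebesgue_Rd_def
  by (intro measurable_restrict) measurable

lemma sets_stdN_prod_eq: "sets (stdN_prod {1..d}) = sets (lebesgue_Rd d)"
  unfolding lebesgue_Rd_def by (intro sets_PiM_cong) auto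

lemma space_lebesgue_Rd [simp]: "space (lebesgue_Rd d) = Rd d"
  by (simp add: lebesgue_Rd_def space_PiM PiE_def)

lemma std_map_Rd [simp]: "std_map d p n \<mu> x \<in> Rd d"
  by (simp add: std_map_def)

lemma prod_std_normal_density:
  "(\<Prod>i\<in>I. std_normal_density (x i)) = exp (- (\<Sum>i\<in>I. (x i)\<^sup>2) / 2) / sqrt (2 * pi) ^ card I" if "finite I"
proof -
  have "(\<Prod>i\<in>I. std_normal_density (x i)) = (\<Prod>i\<in>I. exp (- (x i)\<^sup>2 / 2)) * (\<Prod>i\<in>I. 1 / sqrt (2 * pi))"
    unfolding prod.distrib[symmetric] std_normal_density_def by (simp add: mult.commute)
  also have "(\<Prod>i\<in>I. exp (- (x i)\<^sup>2 / 2)) = exp (\<Sum>i\<in>I. - (x i)\<^sup>2 / 2)"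
    using that by (simp add: exp_sum)
  also have "(\<Sum>i\<in>I. - (x i)\<^sup>2 / 2) = - (\<Sum>i\<in>I. (x i)\<^sup>2) / 2"
    by (simp add: sum_divide_distrib[symmetric] sum_negf)
  finally show ?thesis by (simp add: power_one_over)
qed

text \<open>Lebesgue measure expressed against the standard Gaussian: the weight is the Jacobian
  divided by the Gaussian density. Posterior and normal law are both given by Lebesgue densities, so
  this one substitution serves both.\<close>

lemma nn_integral_lebesgue_Rd_std:
  assumes p: "p \<in> Theta d" and n: "0 < n" and h[measurable]: "h \<in> borel_measurable (lebesgue_Rd d)"
  shows "(\<integral>\<^sup>+ u. h u \<partial>lebesgue_Rd d)
     = (\<integral>\<^sup>+ x. ennreal (gauss_const d p n * exp ((\<Sum>i\<in>{1..d}. (x i)\<^sup>2) / 2)) * h (std_map d p n \<mu> x) \<partial>stdN_prod {1..d})"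
proof -
  define a where "a k = chol_diag p k / sqrt (real n)" for k
  define g where "g k x = \<mu> k - p k * (\<Sum>i\<in>{1..<k}. chol_diag p i / tail_mass p i * x i) / sqrt (real n)" for k and x :: "nat \<Rightarrow> real"
  have a: "0 < a k" if "k \<in> {1..d}" for k
    using chol_diag_pos[OF p that] n by (simp add: a_def)
  have eqT: "(\<lambda>k\<in>{1..d}. a k * x k + g k x) = std_map d p n \<mu> x" for x
    unfolding std_map_def by (intro restrict_ext) (simp add: a_def g_def chol_map_def diff_divide_distrib)
  have T[measurable]: "std_map d p n \<mu> \<in> measurable (lebesgue_Rd d) (lebesgue_Rd d)"
    by (rule std_map_measurable)
  have x_i[measurable]: "(\<lambda>x. x i) \<in> borel_measurable (lebesgue_Rd d)" if "i \<in> {1..d}" for i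
    using that unfolding lebesgue_Rd_def by measurable
  have "(\<integral>\<^sup>+ u. h u \<partial>lebesgue_Rd d) = ennreal (\<Prod>k\<in>{1..d}. a k) * (\<integral>\<^sup>+ x. h (\<lambda>k\<in>{1..d}. a k * x k + g k x) \<partial>lebesgue_Rd d)"
  proof (rule nn_integral_triangular)
    show "g k \<in> borel_measurable (lebesgue_Rd d)" if "k \<in> {1..d}" for k
      unfolding g_def using that by (intro borel_measurable_diff borel_measurable_divide borel_measurable_times borel_measurable_sum x_i) auto
    show "g k x = g k y" if "k \<in> {1..d}" "\<And>j. j \<in> {1..<k} \<Longrightarrow> x j = y j" for k x y
      using that(2) by (simp add: g_def)
  qed (use a in auto)
  also have "\<dots> = (\<integral>\<^sup>+ x. ennreal (\<Prod>k\<in>{1..d}. a k) * h (std_map d p n \<mu> x) \<partial>lebesgue_Rd d)"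
    unfolding eqT by (intro nn_integral_cmult[symmetric]) measurable
  also have "\<dots> = (\<integral>\<^sup>+ x. ennreal (\<Prod>i\<in>{1..d}. std_normal_density (x i)) *
      (ennreal (gauss_const d p n * exp ((\<Sum>i\<in>{1..d}. (x i)\<^sup>2) / 2)) * h (std_map d p n \<mu> x)) \<partial>lebesgue_Rd d)"
  proof (intro nn_integral_cong)
    fix x :: "nat \<Rightarrow> real"
    have "(\<Prod>k\<in>{1..d}. a k) = (\<Prod>i\<in>{1..d}. std_normal_density (x i)) * (gauss_const d p n * exp ((\<Sum>i\<in>{1..d}. (x i)\<^sup>2) / 2))"
      by (simp add: prod_std_normal_density gauss_const_def a_def exp_minus field_simps)
    moreover have "0 \<le> gauss_const d p n"
      unfolding gauss_const_def a_def[symmetric] using a by (intro mult_nonneg_nonneg prod_nonneg) (auto intro: less_imp_le)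
    moreover have "0 \<le> (\<Prod>i\<in>{1..d}. std_normal_density (x i))" by (intro prod_nonneg) auto
    ultimately show "ennreal (\<Prod>k\<in>{1..d}. a k) * h (std_map d p n \<mu> x) = ennreal (\<Prod>i\<in>{1..d}. std_normal_density (x i)) *
      (ennreal (gauss_const d p n * exp ((\<Sum>i\<in>{1..d}. (x i)\<^sup>2) / 2)) * h (std_map d p n \<mu> x))"
      by (simp add: ennreal_mult mult.assoc[symmetric] del: prod_constant)
  qed
  also have "\<dots> = (\<integral>\<^sup>+ x. ennreal (gauss_const d p n * exp ((\<Sum>i\<in>{1..d}. (x i)\<^sup>2) / 2)) * h (std_map d p n \<mu> x) \<partial>stdN_prod {1..d})"
  proof -
    have "(\<lambda>x. ennreal (gauss_const d p n * exp ((\<Sum>i\<in>{1..d}. (x i)\<^sup>2) / 2)) * h (std_map d p n \<mu> x))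
        \<in> borel_measurable (lebesgue_Rd d)"
      by (intro borel_measurable_times_ennreal measurable_compose[OF T h] measurable_compose[OF _ measurable_ennreal]
          borel_measurable_times borel_measurable_const measurable_compose[OF _ borel_measurable_exp] borel_measurable_divide
          borel_measurable_sum borel_measurable_power x_i)
    from nn_integral_stdN_prod[OF _ this[unfolded lebesgue_Rd_def]] show ?thesis
      unfolding lebesgue_Rd_def by simp
  qed
  finally show ?thesis .
qed

lemma gauss_const_pos: "p \<in> Theta d \<Longrightarrow> 0 < n \<Longrightarrow> 0 < gauss_const d p n"
  unfolding gauss_const_def by (intro mult_pos_pos prod_pos) (auto intro!: divide_pos_pos chol_diag_pos)

lemma mvn_density_std_map:
  assumes p: "p \<in> Theta d" and n: "0 < n"
  shows "mvn_density d \<mu> (mat_inv (smult_mat (real n) (fisher d p))) (std_map d p n \<mu> x)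
    = 1 / (gauss_const d p n * exp ((\<Sum>i\<in>{1..d}. (x i)\<^sup>2) / 2))"
proof -
  let ?F = "smult_mat (real n) (fisher d p)"
  let ?c = "\<Prod>k\<in>{1..d}. chol_diag p k"
  have c: "0 < ?c" by (rule prod_chol_diag_pos[OF p])
  have F: "?F \<in> carrier_mat d d" by simp
  have detF: "Determinant.det ?F = real n ^ d / ?c\<^sup>2" by (simp add: det_fisher[OF p])
  have "0 < real n ^ d / ?c\<^sup>2" using n c by (intro divide_pos_pos zero_less_power) auto
  then have det0: "Determinant.det ?F \<noteq> 0" unfolding detF by (rule less_imp_neq[symmetric])
  define u where "u = vec_of d (\<lambda>j. std_map d p n \<mu> x j - \<mu> j)"
  have u: "u = vec_of d (\<lambda>j. chol_map p x j / sqrt (real n))"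
    unfolding u_def by (intro eq_vecI) (auto simp: std_map_def)
  have "scalar_prod u (?F *\<^sub>v u) = real n * scalar_prod u (fisher d p *\<^sub>v u)"
  proof -
    have "?F *\<^sub>v u = real n \<cdot>\<^sub>v (fisher d p *\<^sub>v u)"
      unfolding u by (intro eq_vecI) (auto simp: scalar_prod_def sum_distrib_left mult.assoc)
    then show ?thesis by (simp add: u)
  qed
  also have "scalar_prod u (fisher d p *\<^sub>v u) = fisher_sq d p (chol_map p x) / real n"
  proof -
    have "fisher_sq d p (\<lambda>j. chol_map p x j / sqrt (real n)) = fisher_sq d p (chol_map p x) / real n"
      using n by (simp add: fisher_form_def sum_divide_distrib[symmetric] add_divide_distrib) (simp add: sum_divide_distrib field_simps)
    then show ?thesis unfolding u scalar_prod_fisher .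
  qed
  also have "real n * (fisher_sq d p (chol_map p x) / real n) = (\<Sum>i\<in>{1..d}. (x i)\<^sup>2)"
    using n fisher_form_chol_map[OF p, of x x] by (simp add: power2_eq_square)
  finally have q: "scalar_prod u (?F *\<^sub>v u) = (\<Sum>i\<in>{1..d}. (x i)\<^sup>2)" .
  have "sqrt ((2 * pi) ^ d * Determinant.det (mat_inv ?F)) = gauss_const d p n"
  proof (rule real_sqrt_unique)
    have sp: "(sqrt r ^ d)\<^sup>2 = r ^ d" if "0 \<le> r" for r :: real
    proof -
      have "(sqrt r ^ d)\<^sup>2 = ((sqrt r)\<^sup>2) ^ d" by (simp only: power_mult[symmetric] mult.commute)
      then show ?thesis using that by simp
    qed
    have "gauss_const d p n = sqrt (2 * pi) ^ d * (?c / sqrt (real n) ^ d)"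
      unfolding gauss_const_def prod_dividef by simp
    then have "(gauss_const d p n)\<^sup>2 = (sqrt (2 * pi) ^ d)\<^sup>2 * (?c\<^sup>2 / (sqrt (real n) ^ d)\<^sup>2)"
      by (simp only: power_mult_distrib power_divide)
    also have "\<dots> = (2 * pi) ^ d * (?c\<^sup>2 / real n ^ d)"
      by (subst (1 2) sp) simp_all
    finally have "(gauss_const d p n)\<^sup>2 = (2 * pi) ^ d * (?c\<^sup>2 / real n ^ d)" .
    then show "(gauss_const d p n)\<^sup>2 = (2 * pi) ^ d * Determinant.det (mat_inv ?F)"
      unfolding det_mat_inv[OF F det0] detF by simp
  qed (use gauss_const_pos[OF p n] in simp)
  then show ?thesis
    unfolding mvn_density_def Let_def u_def[symmetric] mat_inv_mat_inv[OF F det0] q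
    by (simp add: exp_minus field_simps)
qed

lemma nn_integral_mvn:
  assumes p: "p \<in> Theta d" and n: "0 < n" and h[measurable]: "h \<in> borel_measurable (lebesgue_Rd d)"
  shows "(\<integral>\<^sup>+ u. h u \<partial>mvn d \<mu> (mat_inv (smult_mat (real n) (fisher d p))))
     = (\<integral>\<^sup>+ x. h (std_map d p n \<mu> x) \<partial>stdN_prod {1..d})"
proof -
  let ?S = "mat_inv (smult_mat (real n) (fisher d p))"
  have x_i[measurable]: "(\<lambda>x. x i) \<in> borel_measurable (lebesgue_Rd d)" if "i \<in> {1..d}" for i
    using that unfolding lebesgue_Rd_def by measurable
  have "(\<lambda>x. exp (- (\<Sum>i\<in>{0..<d}. (x (Suc i) - \<mu> (Suc i)) * (\<Sum>j\<in>{0..<d}. Matrix.row (mat_inv ?S) i $ j * (x (Suc j) - \<mu> (Suc j)))) / 2)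
      / sqrt ((2 * pi) ^ d * Determinant.det ?S)) \<in> borel_measurable (lebesgue_Rd d)"
    by (intro borel_measurable_divide measurable_compose[OF _ borel_measurable_exp] borel_measurable_uminus borel_measurable_sum
        borel_measurable_times borel_measurable_diff borel_measurable_const x_i) auto
  moreover have "mat_inv ?S \<in> carrier_mat d d"
  proof -
    have "Determinant.det (smult_mat (real n) (fisher d p)) \<noteq> 0"
      using det_fisher_nonzero[OF p] n by simp
    then have "mat_inv ?S = smult_mat (real n) (fisher d p)" by (intro mat_inv_mat_inv[of _ d]) auto
    then show ?thesis by simp
  qed
  then have "mvn_density d \<mu> ?S x = exp (- (\<Sum>i\<in>{0..<d}. (x (Suc i) - \<mu> (Suc i)) * (\<Sum>j\<in>{0..<d}. Matrix.row (mat_inv ?S) i $ j * (x (Suc j) - \<mu> (Suc j)))) / 2)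
      / sqrt ((2 * pi) ^ d * Determinant.det ?S)" for x
    unfolding mvn_density_def Let_def by (simp add: scalar_prod_def)
  ultimately have dens[measurable]: "mvn_density d \<mu> ?S \<in> borel_measurable (lebesgue_Rd d)"
    by presburger
  have "(\<integral>\<^sup>+ u. h u \<partial>mvn d \<mu> ?S) = (\<integral>\<^sup>+ u. ennreal (mvn_density d \<mu> ?S u) * h u \<partial>lebesgue_Rd d)"
    unfolding mvn_def by (rule nn_integral_density) measurable
  also have "\<dots> = (\<integral>\<^sup>+ x. ennreal (gauss_const d p n * exp ((\<Sum>i\<in>{1..d}. (x i)\<^sup>2) / 2)) *
      (ennreal (mvn_density d \<mu> ?S (std_map d p n \<mu> x)) * h (std_map d p n \<mu> x)) \<partial>stdN_prod {1..d})"
    by (rule nn_integral_lebesgue_Rd_std[OF p n]) measurable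
  also have "\<dots> = (\<integral>\<^sup>+ x. h (std_map d p n \<mu> x) \<partial>stdN_prod {1..d})"
    using gauss_const_pos[OF p n]
    by (intro nn_integral_cong) (simp add: mvn_density_std_map[OF p n] mult.assoc[symmetric] ennreal_mult[symmetric])
  finally show ?thesis .
qed

section \<open>Derivatives along lines\<close>

lemma MVT_closed_segment:
  fixes f f' :: "real \<Rightarrow> real"
  assumes der: "\<And>s. s \<in> closed_segment a b \<Longrightarrow> (f has_real_derivative f' s) (at s)"
  shows "\<exists>s\<in>closed_segment a b. f b - f a = (b - a) * f' s"
proof (cases a b rule: linorder_cases)
  case less
  then obtain z where "a < z" "z < b" "f b - f a = (b - a) * f' z"
    using MVT2[of a b f f'] der by (auto simp: closed_segment_eq_real_ivl)
  then show ?thesis by (auto simp: closed_segment_eq_real_ivl)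
next
  case greater
  then obtain z where "b < z" "z < a" "f a - f b = (a - b) * f' z"
    using MVT2[of b a f f'] der by (auto simp: closed_segment_eq_real_ivl)
  then show ?thesis by (auto simp: closed_segment_eq_real_ivl algebra_simps intro!: bexI[of _ z])
qed auto

text \<open>The ambient topology is that of functions on all of \<open>nat\<close>. Points of
  \<open>Rd d\<close> agree outside \<open>{1..d}\<close>, so closeness in these finitely many
  coordinates suffices.\<close>

lemma openin_Rd_box:
  assumes U: "openin (top_of_set (Rd d)) U" and x: "x \<in> U"
  shows "\<exists>r>0. \<forall>y\<in>Rd d. (\<forall>j\<in>{1..d}. \<bar>y j - x j\<bar> < r) \<longrightarrow> y \<in> U"
proof -
  obtain T where T: "open T" "U = Rd d \<inter> T" using U by (auto simp: openin_open)
  obtain X where X: "x \<in> Pi\<^sub>E UNIV X" "\<And>i. open (X i)" "Pi\<^sub>E UNIV X \<subseteq> T"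
    using product_topology_open_contains_basis[of "\<lambda>_. euclidean" UNIV T x] T x by (auto simp: open_fun_def)
  have "\<forall>j. \<exists>r>0. \<forall>t. \<bar>t - x j\<bar> < r \<longrightarrow> t \<in> X j"
  proof
    fix j
    have "x j \<in> X j" using X(1) by auto
    with X(2)[of j] show "\<exists>r>0. \<forall>t. \<bar>t - x j\<bar> < r \<longrightarrow> t \<in> X j"
      by (auto simp: open_dist dist_real_def)
  qed
  then obtain r where r: "\<And>j. 0 < r j" "\<And>j t. \<bar>t - x j\<bar> < r j \<Longrightarrow> t \<in> X j" by metis
  define s where "s = Min (insert 1 (r ` {1..d}))"
  have s: "0 < s" using r(1) by (auto simp: s_def)
  have sr: "s \<le> r j" if "j \<in> {1..d}" for j
    unfolding s_def using that by (intro Min_le) auto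
  show ?thesis
  proof (intro exI[of _ s] conjI ballI impI)
    fix y assume y: "y \<in> Rd d" "\<forall>j\<in>{1..d}. \<bar>y j - x j\<bar> < s"
    have "y j \<in> X j" for j
    proof (cases "j \<in> {1..d}")
      case True
      then have "\<bar>y j - x j\<bar> < r j" using y(2) sr[OF True] by force
      then show ?thesis by (rule r(2))
    next
      case False
      have "x \<in> Rd d" using x T by auto
      then have "y j = x j" using extensional_arb[OF y(1) False] extensional_arb[OF _ False, of x] by simp
      then show ?thesis using X(1) by auto
    qed
    then show "y \<in> U" using X(3) T(2) y(1) by auto
  qed (rule s)
qed

definition line :: "nat \<Rightarrow> (nat \<Rightarrow> real) \<Rightarrow> (nat \<Rightarrow> real) \<Rightarrow> real \<Rightarrow> nat \<Rightarrow> real" where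
  "line d x v t = (\<lambda>k\<in>{1..d}. x k + t * v k)"

lemma line_Rd [simp]: "line d x v t \<in> Rd d"
  by (simp add: line_def)

lemma line_0: "x \<in> Rd d \<Longrightarrow> line d x v 0 = x"
  by (auto simp: line_def extensional_def restrict_def)

lemma line_add: "line d x v (s + t) = line d (line d x v s) v t"
  by (auto simp: line_def algebra_simps restrict_def)

text \<open>Continuous partial derivatives give directional derivatives: the increment telescopes
  over the coordinates, the mean value theorem turns each term into a partial derivative at a nearby
  point, and continuity gives the limit.\<close>

lemma has_derivative_line_at_0:
  assumes W: "openin (top_of_set (Rd d)) W" and x: "x \<in> W"
    and diff: "\<And>j y. j \<in> {1..d} \<Longrightarrow> y \<in> W \<Longrightarrow> (\<lambda>t. f (y(j := t))) differentiable (at (y j))"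
    and cont: "\<And>j. j \<in> {1..d} \<Longrightarrow> continuous_on W (partial j f)"
  shows "((\<lambda>t. f (line d x v t)) has_real_derivative (\<Sum>j\<in>{1..d}. v j * partial j f x)) (at 0)"
proof -
  have xR: "x \<in> Rd d" using W x by (auto simp: openin_open)
  \<comment> \<open>The point after only the first \<open>k\<close> coordinates have been moved; it
    interpolates from \<open>x\<close> at \<open>k = 0\<close> to the line at
    \<open>k = d\<close>.\<close>
  define P where "P k t = (\<lambda>j\<in>{1..d}. if j \<le> k then x j + t * v j else x j)" for k t
  have P0: "P 0 t = x" for t using xR by (auto simp: P_def extensional_def restrict_def)
  have Pd: "P d t = line d x v t" for t by (auto simp: P_def line_def restrict_def)
  have part: "((\<lambda>h. (f (P k h) - f (P (k - 1) h)) / h) \<longlongrightarrow> v k * partial k f x) (at 0)"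
    if k: "k \<in> {1..d}" for k
  proof (rule LIM_I)
    fix e :: real assume e: "0 < e"
    \<comment> \<open>The summand 1 avoids a division by zero when the direction has no component
      along \<open>k\<close>.\<close>
    define e' where "e' = e / (\<bar>v k\<bar> + 1)"
    have e': "0 < e'" using e by (simp add: e'_def add_nonneg_pos)
    let ?U = "{y \<in> W. partial k f y \<in> {partial k f x - e' <..< partial k f x + e'}}"
    have "openin (top_of_set W) (W \<inter> partial k f -` {partial k f x - e' <..< partial k f x + e'})"
      by (rule continuous_openin_preimage_gen[OF cont[OF k]]) simp
    also have "W \<inter> partial k f -` {partial k f x - e' <..< partial k f x + e'} = ?U" by auto
    finally have "openin (top_of_set (Rd d)) ?U"
      using W openin_trans by blast
    from openin_Rd_box[OF this, of x] obtain r where r: "0 < r" "\<And>y. y \<in> Rd d \<Longrightarrow> (\<And>j. j \<in> {1..d} \<Longrightarrow> \<bar>y j - x j\<bar> < r) \<Longrightarrow> y \<in> ?U"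
      using x e' by auto
    define V where "V = (\<Sum>j\<in>{1..d}. \<bar>v j\<bar>) + 1"
    have V: "0 < V" "\<And>j. j \<in> {1..d} \<Longrightarrow> \<bar>v j\<bar> \<le> V"
    proof -
      show "0 < V" by (simp add: V_def add_nonneg_pos sum_nonneg)
      show "\<bar>v j\<bar> \<le> V" if "j \<in> {1..d}" for j
        using member_le_sum[of j "{1..d}" "\<lambda>j. \<bar>v j\<bar>"] that by (simp add: V_def)
    qed
    show "\<exists>s>0. \<forall>h. h \<noteq> 0 \<and> norm (h - 0) < s \<longrightarrow>
        norm ((f (P k h) - f (P (k - 1) h)) / h - v k * partial k f x) < e"
    proof (intro exI[of _ "r / V"] conjI allI impI)
      show "0 < r / V" using r V by simp
      fix h :: real assume h: "h \<noteq> 0 \<and> norm (h - 0) < r / V"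
      have hv: "\<bar>h * v j\<bar> < r" if "j \<in> {1..d}" for j
      proof -
        have "\<bar>h * v j\<bar> \<le> \<bar>h\<bar> * V" unfolding abs_mult using V(2)[OF that] by (intro mult_left_mono) auto
        also have "\<dots> < r" using h V(1) by (simp add: pos_less_divide_eq)
        finally show ?thesis .
      qed
      \<comment> \<open>Coordinate \<open>k\<close> runs through \<open>s\<close> while the earlier
        ones are already moved and the later ones are not, so this path joins
        \<open>P (k - 1) h\<close> to \<open>P k h\<close>.\<close>
      define Q where "Q s = (P (k - 1) h)(k := s)" for s
      have Qk: "Q (x k) = P (k - 1) h" "Q (x k + h * v k) = P k h"
        using k by (auto simp: Q_def P_def fun_eq_iff)
      have QU: "Q s \<in> ?U" if s: "s \<in> closed_segment (x k) (x k + h * v k)" for s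
      proof (rule r(2))
        show "Q s \<in> Rd d" using k by (auto simp: Q_def P_def extensional_def restrict_def)
        fix j assume j: "j \<in> {1..d}"
        have sk: "\<bar>s - x k\<bar> \<le> \<bar>h * v k\<bar>" using s by (auto simp: closed_segment_eq_real_ivl split: if_splits)
        show "\<bar>Q s j - x j\<bar> < r"
        proof (cases "j = k")
          case True
          then show ?thesis using sk hv[OF k] by (simp add: Q_def)
        next
          case False
          then have "Q s j - x j = (if j \<le> k - 1 then h * v j else 0)"
            using j by (simp add: Q_def P_def)
          then show ?thesis using hv[OF j] r(1) by simp
        qed
      qed
      have der: "((\<lambda>t. f (Q t)) has_real_derivative partial k f (Q s)) (at s)"
        if s: "s \<in> closed_segment (x k) (x k + h * v k)" for s
      proof -
        have "(\<lambda>t. f ((Q s)(k := t))) differentiable (at (Q s k))"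
          using QU[OF s] by (intro diff k) auto
        moreover have "(Q s)(k := t) = Q t" "Q s k = s" for t by (simp_all add: Q_def)
        ultimately have "(\<lambda>t. f (Q t)) differentiable (at s)" by simp
        then have "((\<lambda>t. f (Q t)) has_real_derivative deriv (\<lambda>t. f (Q t)) s) (at s)"
          by (simp add: DERIV_deriv_iff_real_differentiable)
        moreover have "partial k f (Q s) = deriv (\<lambda>t. f (Q t)) s"
          unfolding partial_def using \<open>\<And>t. (Q s)(k := t) = Q t\<close> \<open>Q s k = s\<close> by simp
        ultimately show ?thesis by simp
      qed
      obtain s where s: "s \<in> closed_segment (x k) (x k + h * v k)"
        "f (Q (x k + h * v k)) - f (Q (x k)) = (x k + h * v k - x k) * partial k f (Q s)"
        using MVT_closed_segment[of "x k" "x k + h * v k" "\<lambda>t. f (Q t)" "\<lambda>s. partial k f (Q s)"] der by blast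
      have "(f (P k h) - f (P (k - 1) h)) / h = v k * partial k f (Q s)"
        using s(2) h by (simp add: Qk)
      then have "norm ((f (P k h) - f (P (k - 1) h)) / h - v k * partial k f x) = \<bar>v k\<bar> * \<bar>partial k f (Q s) - partial k f x\<bar>"
        by (simp add: right_diff_distrib[symmetric] abs_mult)
      also have "\<dots> \<le> \<bar>v k\<bar> * e'"
        using QU[OF s(1)] by (intro mult_left_mono) auto
      also have "\<dots> < (\<bar>v k\<bar> + 1) * e'" using e' by simp
      also have "\<dots> = e" by (simp add: e'_def)
      finally show "norm ((f (P k h) - f (P (k - 1) h)) / h - v k * partial k f x) < e" .
    qed
  qed
  have tele: "(f (line d x v h) - f x) / h = (\<Sum>k\<in>{1..d}. (f (P k h) - f (P (k - 1) h)) / h)" for h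
  proof -
    have "(\<Sum>k\<in>{1..m}. f (P k h) - f (P (k - 1) h)) = f (P m h) - f (P 0 h)" for m
      by (induction m) auto
    then show ?thesis by (simp add: sum_divide_distrib[symmetric] P0 Pd)
  qed
  have "((\<lambda>h. (f (line d x v h) - f x) / h) \<longlongrightarrow> (\<Sum>j\<in>{1..d}. v j * partial j f x)) (at 0)"
    unfolding tele by (intro tendsto_sum part) auto
  then show ?thesis
    by (simp add: DERIV_def line_0[OF xR])
qed

lemma has_derivative_line:
  assumes W: "openin (top_of_set (Rd d)) W" and x: "line d x v t \<in> W"
    and diff: "\<And>j y. j \<in> {1..d} \<Longrightarrow> y \<in> W \<Longrightarrow> (\<lambda>t. f (y(j := t))) differentiable (at (y j))"
    and cont: "\<And>j. j \<in> {1..d} \<Longrightarrow> continuous_on W (partial j f)"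
  shows "((\<lambda>t. f (line d x v t)) has_real_derivative (\<Sum>j\<in>{1..d}. v j * partial j f (line d x v t))) (at t)"
proof -
  have "((\<lambda>s. f (line d (line d x v t) v s)) has_real_derivative (\<Sum>j\<in>{1..d}. v j * partial j f (line d x v t))) (at 0)"
    by (rule has_derivative_line_at_0[OF W x diff cont])
  moreover have "line d x v (s + t) = line d (line d x v t) v s" for s
    by (subst add.commute) (rule line_add)
  ultimately show ?thesis
    using DERIV_shift[of "\<lambda>t. f (line d x v t)" _ 0 t] by simp
qed

text \<open>Written as \<open>f\<close> times a logarithmic derivative because
  \<open>delta01\<close> bounds the gradient of \<open>ln \<pi>0\<close>, whereas
  \<open>C1_on\<close> speaks of \<open>\<pi>0\<close> itself.\<close>

lemma has_derivative_line_pos: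
  assumes C1: "C1_on d f S" and x: "line d x v t \<in> S" and pos: "0 < f (line d x v t)"
  shows "((\<lambda>t. f (line d x v t)) has_real_derivative
    f (line d x v t) * (\<Sum>j\<in>{1..d}. partial j (\<lambda>y. ln (f y)) (line d x v t) * v j)) (at t)"
proof -
  obtain W where W: "openin (top_of_set (Rd d)) W" "S \<subseteq> W"
    "\<And>j y. j \<in> {1..d} \<Longrightarrow> y \<in> W \<Longrightarrow> (\<lambda>t. f (y(j := t))) differentiable (at (y j))"
    "\<And>j. j \<in> {1..d} \<Longrightarrow> continuous_on W (partial j f)"
    using C1 unfolding C1_on_def by blast
  let ?y = "line d x v t"
  have yW: "?y \<in> W" using x W(2) by auto
  have ln: "partial j (\<lambda>y. ln (f y)) ?y = partial j f ?y / f ?y" if j: "j \<in> {1..d}" for j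
  proof -
    have "((\<lambda>t. f (?y(j := t))) has_real_derivative partial j f ?y) (at (?y j))"
      using W(3)[OF j yW] unfolding partial_def by (simp add: DERIV_deriv_iff_real_differentiable)
    from DERIV_ln_divide[THEN DERIV_chain2, OF _ this] pos
    have "((\<lambda>t. ln (f (?y(j := t)))) has_real_derivative 1 / f ?y * partial j f ?y) (at (?y j))" by simp
    then show ?thesis unfolding partial_def[of j "\<lambda>y. ln (f y)"] by (simp add: DERIV_imp_deriv)
  qed
  have "(\<Sum>j\<in>{1..d}. v j * partial j f ?y) = f ?y * (\<Sum>j\<in>{1..d}. partial j (\<lambda>y. ln (f y)) ?y * v j)"
    unfolding sum_distrib_left using pos by (intro sum.cong) (auto simp: ln)
  then show ?thesis using has_derivative_line[OF W(1) yW W(3,4)] by simp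
qed

section \<open>The multinomial distribution\<close>

text \<open>Count vectors are taken in \<open>extensional A\<close>, which makes the set finite and
  lets every outcome appear exactly once.\<close>

definition compositions :: "'i set \<Rightarrow> nat \<Rightarrow> ('i \<Rightarrow> nat) set" where
  "compositions A n = {k \<in> extensional A. sum k A = n}"

definition multinomial_pmf :: "'i set \<Rightarrow> nat \<Rightarrow> ('i \<Rightarrow> real) \<Rightarrow> ('i \<Rightarrow> nat) \<Rightarrow> real" where
  "multinomial_pmf A n p k = fact n / (\<Prod>j\<in>A. fact (k j)) * (\<Prod>j\<in>A. p j ^ k j)"

lemma finite_compositions:
  assumes "finite A"
  shows "finite (compositions A n)"
proof (rule finite_subset)
  show "compositions A n \<subseteq> Pi\<^sub>E A (\<lambda>_. {0..n})"
  proof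
    fix k assume k: "k \<in> compositions A n"
    have "k j \<le> n" if "j \<in> A" for j
      using k member_le_sum[of j A k] that assms by (auto simp: compositions_def)
    then show "k \<in> Pi\<^sub>E A (\<lambda>_. {0..n})" using k by (auto simp: compositions_def PiE_def)
  qed
qed (use assms in \<open>simp add: finite_PiE\<close>)

lemma sum_compositions_insert:
  fixes F :: "('i \<Rightarrow> nat) \<Rightarrow> real"
  assumes A: "finite A" "i \<notin> A"
  shows "(\<Sum>k\<in>compositions (insert i A) n. F k) = (\<Sum>m\<le>n. \<Sum>k\<in>compositions A (n - m). F (k(i := m)))"
proof -
  have sum_upd: "sum (k(i := m)) A = sum k A" for k and m :: nat
    using A by (intro sum.cong) auto
  have "(\<Sum>m\<le>n. \<Sum>k\<in>compositions A (n - m). F (k(i := m)))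
      = (\<Sum>(m, k)\<in>(SIGMA m:{..n}. compositions A (n - m)). F (k(i := m)))"
    using finite_compositions[OF A(1)] by (subst sum.Sigma) auto
  also have "\<dots> = (\<Sum>k\<in>compositions (insert i A) n. F k)"
  proof (rule sum.reindex_bij_witness[where j="\<lambda>(m, k). k(i := m)" and i="\<lambda>k. (k i, restrict k A)"])
    fix a assume "a \<in> (SIGMA m:{..n}. compositions A (n - m))"
    then obtain m k where a: "a = (m, k)" "m \<le> n" "k \<in> extensional A" "sum k A = n - m"
      by (auto simp: compositions_def)
    have "restrict (k(i := m)) A = k"
      using a(3) A(2) by (auto simp: fun_eq_iff restrict_def extensional_def)
    then show "(\<lambda>k. (k i, restrict k A)) (case a of (m, k) \<Rightarrow> k(i := m)) = a" using a by simp
    have "k(i := m) \<in> extensional (insert i A)" using a(3) by (auto simp: extensional_def)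
    then show "(case a of (m, k) \<Rightarrow> k(i := m)) \<in> compositions (insert i A) n"
      using a A sum_upd[of k m] by (simp add: compositions_def)
  next
    fix k assume k: "k \<in> compositions (insert i A) n"
    then have "k i + sum k A = n" using A by (simp add: compositions_def)
    then show "(k i, restrict k A) \<in> (SIGMA m:{..n}. compositions A (n - m))"
      by (auto simp: compositions_def)
    have "(restrict k A)(i := k i) = k"
      using k by (auto simp: compositions_def fun_eq_iff restrict_def extensional_def)
    then show "(case (k i, restrict k A) of (m, k) \<Rightarrow> k(i := m)) = k" by simp
  qed auto
  finally show ?thesis ..
qed

lemma multinomial_pmf_insert:
  assumes A: "finite A" "i \<notin> A" and m: "m \<le> n"
  shows "multinomial_pmf (insert i A) n p (k(i := m))
     = real (n choose m) * p i ^ m * multinomial_pmf A (n - m) p k"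
proof -
  have "(\<Prod>j\<in>A. fact ((k(i := m)) j)) = (\<Prod>j\<in>A. fact (k j) :: real)"
    "(\<Prod>j\<in>A. p j ^ (k(i := m)) j) = (\<Prod>j\<in>A. p j ^ k j)"
    using A by (auto intro!: prod.cong)
  then show ?thesis
    using A m by (simp add: multinomial_pmf_def binomial_fact)
qed

lemma multinomial_theorem:
  assumes "finite A"
  shows "(\<Sum>k\<in>compositions A n. multinomial_pmf A n p k) = (\<Sum>j\<in>A. p j) ^ n"
  using assms
proof (induction A arbitrary: n rule: finite_induct)
  case empty
  have "compositions {} n = (if n = 0 then {\<lambda>_. undefined} else ({} :: ('a \<Rightarrow> nat) set))"
    by (auto simp: compositions_def)
  then show ?case by (simp add: multinomial_pmf_def power_0_left)
next
  case (insert i A)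
  have "(\<Sum>k\<in>compositions (insert i A) n. multinomial_pmf (insert i A) n p k)
      = (\<Sum>m\<le>n. real (n choose m) * p i ^ m * (\<Sum>j\<in>A. p j) ^ (n - m))"
    unfolding sum_compositions_insert[OF insert.hyps]
    by (intro sum.cong refl) (simp add: multinomial_pmf_insert[OF insert.hyps] sum_distrib_left[symmetric] insert.IH)
  also have "\<dots> = (p i + (\<Sum>j\<in>A. p j)) ^ n" by (simp add: binomial_ring)
  finally show ?case using insert.hyps by simp
qed

text \<open>All other cells are summed out by the multinomial theorem. The binomial weights that
  remain are written as Bernstein polynomials, whose moment identities can then be quoted.\<close>

lemma multinomial_marginal:
  assumes A: "finite A" "i \<in> A" and p: "(\<Sum>j\<in>A. p j) = 1"
  shows "(\<Sum>k\<in>compositions A n. multinomial_pmf A n p k * g (k i)) = (\<Sum>m\<le>n. Bernstein n m (p i) * g m)"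
proof -
  define C where "C = A - {i}"
  have C: "finite C" "i \<notin> C" "A = insert i C" using A by (auto simp: C_def)
  have pC: "(\<Sum>j\<in>C. p j) = 1 - p i" using p C by simp
  show ?thesis
    unfolding C(3) sum_compositions_insert[OF C(1,2)]
  proof (intro sum.cong refl)
    fix m assume "m \<in> {..n}"
    then have m: "m \<le> n" by simp
    have "(\<Sum>k\<in>compositions C (n - m). multinomial_pmf (insert i C) n p (k(i := m)) * g ((k(i := m)) i))
        = real (n choose m) * p i ^ m * g m * (\<Sum>k\<in>compositions C (n - m). multinomial_pmf C (n - m) p k)"
      unfolding sum_distrib_left multinomial_pmf_insert[OF C(1,2) m] by (intro sum.cong) auto
    also have "\<dots> = Bernstein n m (p i) * g m"
      by (simp add: multinomial_theorem[OF C(1)] pC Bernstein_def)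
    finally show "(\<Sum>k\<in>compositions C (n - m). multinomial_pmf (insert i C) n p (k(i := m)) * g ((k(i := m)) i))
        = Bernstein n m (p i) * g m" .
  qed
qed

lemma multinomial_variance:
  assumes A: "finite A" "i \<in> A" and p: "(\<Sum>j\<in>A. p j) = 1" and n: "0 < n"
  shows "(\<Sum>k\<in>compositions A n. multinomial_pmf A n p k * (real (k i) / real n - p i)\<^sup>2) = p i * (1 - p i) / real n"
proof -
  define q where "q = p i"
  have "(\<Sum>k\<in>compositions A n. multinomial_pmf A n p k * (real (k i) / real n - p i)\<^sup>2)
      = (\<Sum>m\<le>n. Bernstein n m q * (real m / real n - q)\<^sup>2)"
    unfolding q_def by (rule multinomial_marginal[OF A p])
  \<comment> \<open>The square of \<open>m\<close> is split into \<open>m * (m - 1)\<close> plus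
    \<open>m\<close> to match the two Bernstein moment identities.\<close>
  also have "\<dots> = (\<Sum>m\<le>n. (1 / (real n)\<^sup>2) * (real m * (real m - 1) * Bernstein n m q)
      + (1 / (real n)\<^sup>2 - 2 * q / real n) * (real m * Bernstein n m q) + q\<^sup>2 * Bernstein n m q)"
    using n by (intro sum.cong) (auto simp: power2_eq_square field_simps)
  also have "\<dots> = (1 / (real n)\<^sup>2) * (real n * (real n - 1) * q\<^sup>2) + (1 / (real n)\<^sup>2 - 2 * q / real n) * (real n * q) + q\<^sup>2"
    unfolding sum.distrib sum_distrib_left[symmetric] by (simp add: sum_kk_Bernstein sum_k_Bernstein)
  also have "\<dots> = q * (1 - q) / real n"
    using n by (simp add: power2_eq_square field_simps)
  finally show ?thesis by (simp add: q_def)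
qed

text \<open>The weight \<open>1 / p j\<close> cancels the factor \<open>p j\<close> of the variance,
  and the remaining \<open>1 - p j\<close> sum to the number of cells minus one. Small cells
  therefore do no harm at this point.\<close>

lemma multinomial_chi_square:
  assumes A: "finite A" and p: "(\<Sum>j\<in>A. p j) = 1" and pos: "\<And>j. j \<in> A \<Longrightarrow> 0 < p j" and n: "0 < n"
  shows "(\<Sum>k\<in>compositions A n. multinomial_pmf A n p k * (\<Sum>j\<in>A. (real (k j) / real n - p j)\<^sup>2 / p j)) = (real (card A) - 1) / real n"
proof -
  have "(\<Sum>k\<in>compositions A n. multinomial_pmf A n p k * (\<Sum>j\<in>A. (real (k j) / real n - p j)\<^sup>2 / p j))
      = (\<Sum>k\<in>compositions A n. \<Sum>j\<in>A. multinomial_pmf A n p k * (real (k j) / real n - p j)\<^sup>2 / p j)"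
    by (simp add: sum_distrib_left)
  also have "\<dots> = (\<Sum>j\<in>A. \<Sum>k\<in>compositions A n. multinomial_pmf A n p k * (real (k j) / real n - p j)\<^sup>2 / p j)"
    by (rule sum.swap)
  also have "\<dots> = (\<Sum>j\<in>A. (1 - p j) / real n)"
  proof (intro sum.cong refl)
    fix j assume j: "j \<in> A"
    show "(\<Sum>k\<in>compositions A n. multinomial_pmf A n p k * (real (k j) / real n - p j)\<^sup>2 / p j) = (1 - p j) / real n"
      unfolding sum_divide_distrib[symmetric] multinomial_variance[OF A j p n] using pos[OF j] by simp
  qed
  also have "\<dots> = (real (card A) - 1) / real n"
    using p by (simp add: sum_divide_distrib[symmetric] sum_subtractf)
  finally show ?thesis .
qed

lemma multinomial_pmf_nonneg: "(\<And>j. j \<in> A \<Longrightarrow> 0 \<le> p j) \<Longrightarrow> 0 \<le> multinomial_pmf A n p k"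
  unfolding multinomial_pmf_def by (intro mult_nonneg_nonneg divide_nonneg_nonneg prod_nonneg) auto

text \<open>Markov's inequality as a finite sum: on the excluded count vectors the chi-square
  statistic divided by \<open>c\<close> is at least 1.\<close>

lemma multinomial_chi_square_tail:
  assumes A: "finite A" and p: "(\<Sum>j\<in>A. p j) = 1" and pos: "\<And>j. j \<in> A \<Longrightarrow> 0 < p j" and n: "0 < n" and c: "0 < c"
  shows "1 - (real (card A) - 1) / (real n * c)
    \<le> (\<Sum>k\<in>{k \<in> compositions A n. (\<Sum>j\<in>A. (real (k j) / real n - p j)\<^sup>2 / p j) \<le> c}. multinomial_pmf A n p k)"
proof -
  define X where "X k = (\<Sum>j\<in>A. (real (k j) / real n - p j)\<^sup>2 / p j)" for k
  have M: "0 \<le> multinomial_pmf A n p k" for k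
    using pos by (intro multinomial_pmf_nonneg less_imp_le)
  have X: "0 \<le> X k" for k
    unfolding X_def using pos by (intro sum_nonneg divide_nonneg_nonneg) (auto intro: less_imp_le)
  let ?K = "compositions A n"
  note fin = finite_compositions[OF A, of n]
  have "(\<Sum>k\<in>?K. multinomial_pmf A n p k) - (\<Sum>k\<in>{k \<in> ?K. X k \<le> c}. multinomial_pmf A n p k)
      = (\<Sum>k\<in>?K - {k \<in> ?K. X k \<le> c}. multinomial_pmf A n p k)"
    by (rule sum_diff[symmetric]) (use fin in auto)
  also have "\<dots> \<le> (\<Sum>k\<in>?K - {k \<in> ?K. X k \<le> c}. multinomial_pmf A n p k * X k / c)"
  proof (intro sum_mono)
    fix k assume "k \<in> ?K - {k \<in> ?K. X k \<le> c}"
    then have "1 \<le> X k / c" using c by auto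
    then show "multinomial_pmf A n p k \<le> multinomial_pmf A n p k * X k / c"
      using mult_left_mono[OF _ M, of 1 "X k / c" k] by simp
  qed
  also have "\<dots> \<le> (\<Sum>k\<in>?K. multinomial_pmf A n p k * X k / c)"
    using fin c by (intro sum_mono2) (auto intro!: divide_nonneg_pos mult_nonneg_nonneg M X)
  also have "\<dots> = (\<Sum>k\<in>?K. multinomial_pmf A n p k * X k) / c"
    by (rule sum_divide_distrib[symmetric])
  also have "(\<Sum>k\<in>?K. multinomial_pmf A n p k * X k) = (real (card A) - 1) / real n"
    unfolding X_def by (rule multinomial_chi_square[OF A p pos n])
  finally show ?thesis
    unfolding X_def[symmetric] using multinomial_theorem[OF A, of n p] p by simp
qed

section \<open>Densities close to the Gaussian\<close>

text \<open>Squaring removes the kink of \<open>max 0 y\<close>. The cutoff below is such a square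
  because the Poincare inequality requires derivatives everywhere.\<close>

lemma DERIV_max_0_sq: "((\<lambda>y. (max 0 y)\<^sup>2) has_real_derivative 2 * max 0 y) (at (y::real))"
proof (cases y "0::real" rule: linorder_cases)
  case less
  have "((\<lambda>y. 0) has_real_derivative 2 * max 0 y) (at y)" using less by simp
  then show ?thesis
    by (rule has_field_derivative_transform_within_open[of _ _ _ "{..<0}"]) (use less in auto)
next
  case greater
  have "((\<lambda>y. y\<^sup>2) has_real_derivative 2 * max 0 y) (at y)"
    using greater by (auto intro!: derivative_eq_intros)
  then show ?thesis
    by (rule has_field_derivative_transform_within_open[of _ _ _ "{0<..}"]) (use greater in auto)
next
  case equal
  have "((\<lambda>h. (max 0 h)\<^sup>2 / h) \<longlongrightarrow> 0) (at (0::real))"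
  proof (rule Lim_null_comparison)
    show "\<forall>\<^sub>F h in at 0. norm ((max 0 h)\<^sup>2 / h) \<le> \<bar>h\<bar>"
      by (auto simp: max_def power2_eq_square intro!: eventuallyI)
    show "((\<lambda>h. \<bar>h\<bar>) \<longlongrightarrow> 0) (at (0::real))" by (rule tendsto_rabs_zero) simp
  qed
  then show ?thesis using equal by (simp add: DERIV_def)
qed

lemma sum_sq_fun_upd:
  fixes x :: "'i \<Rightarrow> real"
  assumes "finite I" "i \<in> I"
  shows "(\<Sum>j\<in>I. ((x(i := t)) j)\<^sup>2) = (\<Sum>j\<in>I. (x j)\<^sup>2) - (x i)\<^sup>2 + t\<^sup>2"
proof -
  have "(\<Sum>j\<in>I - {i}. ((x(i := t)) j)\<^sup>2) = (\<Sum>j\<in>I - {i}. (x j)\<^sup>2)" by (intro sum.cong) auto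
  then show ?thesis using assms by (simp add: sum.remove[of I i])
qed

text \<open>A density \<open>\<rho>\<close> relative to the standard Gaussian is close to \<open>1\<close> in \<open>L\<^sup>1\<close> if its logarithmic
  gradient is small on a large ball and it has little mass outside a smaller ball: apply the
  Poincare inequality to a cutoff of \<open>sqrt \<rho>\<close>, and conclude with the Hellinger affinity.\<close>

lemma stdN_prod_density_near_1:
  fixes \<rho> :: "('i \<Rightarrow> real) \<Rightarrow> real" and I :: "'i set"
  defines "sq \<equiv> \<lambda>x :: 'i \<Rightarrow> real. \<Sum>i\<in>I. (x i)\<^sup>2"
  assumes I: "finite I" and dI: "d = real (card I)" "1 \<le> d"
    and \<rho>m: "\<rho> \<in> borel_measurable (stdN_prod I)"
    and \<rho>0: "\<And>x. x \<in> extensional I \<Longrightarrow> 0 \<le> \<rho> x"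
    and \<rho>1: "(\<integral>\<^sup>+ x. ennreal (\<rho> x) \<partial>stdN_prod I) = 1"
    and A: "0 < A" and R: "0 \<le> R" "R \<le> A" and L: "0 \<le> L" and \<tau>: "0 \<le> \<tau>"
    and pos: "\<And>x. x \<in> extensional I \<Longrightarrow> sq x \<le> A\<^sup>2 * d \<Longrightarrow> 0 < \<rho> x"
    and bd: "\<And>x. x \<in> extensional I \<Longrightarrow> sq x \<le> A\<^sup>2 * d \<Longrightarrow> \<rho> x \<le> b"
    and der: "\<And>i x. i \<in> I \<Longrightarrow> x \<in> extensional I \<Longrightarrow> sq x \<le> A\<^sup>2 * d \<Longrightarrow>
        ((\<lambda>t. \<rho> (x(i := t))) has_real_derivative \<rho> x * D i x) (at (x i))"
    and grad: "\<And>x. x \<in> extensional I \<Longrightarrow> sq x \<le> A\<^sup>2 * d \<Longrightarrow> (\<Sum>i\<in>I. (D i x)\<^sup>2) \<le> L\<^sup>2"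
    and tail: "(\<integral>\<^sup>+ x. ennreal (\<rho> x) * indicator {x. R\<^sup>2 * d < sq x} x \<partial>stdN_prod I) \<le> ennreal \<tau>"
    and e: "0 < e" and small: "4 * R\<^sup>2 / A\<^sup>2 + \<tau> + 32 / A\<^sup>2 + L\<^sup>2 / 2 \<le> e\<^sup>2 / 8"
  shows "(\<integral>x. \<bar>\<rho> x - 1\<bar> \<partial>stdN_prod I) \<le> e"
proof -
  let ?G = "stdN_prod I"
  interpret prob_space ?G by (rule prob_space_stdN_prod)
  note [measurable] = \<rho>m
  have xm[measurable]: "(\<lambda>x. x i) \<in> borel_measurable ?G" if "i \<in> I" for i
    using measurable_component_singleton[OF that, of "\<lambda>_. stdN"] by simp
  have sqm[measurable]: "sq \<in> borel_measurable ?G"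
    unfolding sq_def by (intro borel_measurable_sum borel_measurable_power xm)
  define K where "K = A\<^sup>2 * d"
  have K: "0 < K" "A\<^sup>2 \<le> K" using A dI(2) by (auto simp: K_def)
  have sq0: "0 \<le> sq x" for x by (simp add: sq_def sum_nonneg)
  define m where "m x = max 0 (1 - sq x / K)" for x
  define cut where "cut x = (m x)\<^sup>2" for x
  have m01: "0 \<le> m x" "m x \<le> 1" for x using sq0[of x] K by (auto simp: m_def)
  have cut01: "0 \<le> cut x" "cut x \<le> 1" for x using m01[of x] by (auto simp: cut_def power_le_one)
  have mm[measurable]: "m \<in> borel_measurable ?G" unfolding m_def by measurable
  have cutm[measurable]: "cut \<in> borel_measurable ?G" unfolding cut_def by measurable
  define f where "f x = cut x * sqrt (\<rho> x)" for x
  have fm[measurable]: "f \<in> borel_measurable ?G" unfolding f_def by measurable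
  define cut' where "cut' i x = 2 * m x * (- 2 * x i / K)" for i and x :: "'i \<Rightarrow> real"
  define f' where "f' i x = (if sq x \<le> K then sqrt (\<rho> x) * (cut' i x + cut x * D i x / 2) else 0)" for i x
  have out: "f x = 0" if "K < sq x" for x
    using that K by (simp add: f_def cut_def m_def)
  have f0: "0 \<le> f x" if "x \<in> extensional I" for x
    using \<rho>0[OF that] cut01[of x] by (simp add: f_def)
  have fle: "f x \<le> sqrt (\<rho> x)" if "x \<in> extensional I" for x
    using \<rho>0[OF that] cut01[of x] by (simp add: f_def mult_left_le_one_le)
  have cutder: "((\<lambda>t. cut (x(i := t))) has_real_derivative cut' i x) (at (x i))" if i: "i \<in> I" for i x
  proof -
    have *: "sq (x(i := t)) = sq x - (x i)\<^sup>2 + t\<^sup>2" for t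
      unfolding sq_def by (rule sum_sq_fun_upd[OF I i])
    have "((\<lambda>t. 1 - (sq x - (x i)\<^sup>2 + t\<^sup>2) / K) has_real_derivative - 2 * x i / K) (at (x i))"
      using K by (auto intro!: derivative_eq_intros)
    from DERIV_chain2[OF DERIV_max_0_sq this]
    show ?thesis unfolding cut_def m_def * cut'_def by simp
  qed
  have fder: "((\<lambda>t. f (x(i := t))) has_real_derivative f' i x) (at (x i))"
    if i: "i \<in> I" and x: "x \<in> extensional I" for i x
  proof (cases "sq x \<le> K")
    case True
    then have s: "sq x \<le> A\<^sup>2 * d" by (simp add: K_def)
    have p: "0 < \<rho> (x(i := x i))" using pos[OF x s] by simp
    from DERIV_chain2[OF DERIV_real_sqrt[OF p] der[OF i x s]]
    have "((\<lambda>t. sqrt (\<rho> (x(i := t)))) has_real_derivative inverse (sqrt (\<rho> x)) / 2 * (\<rho> x * D i x)) (at (x i))"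
      by simp
    from DERIV_mult[OF cutder[OF i, of x] this]
    have "((\<lambda>t. f (x(i := t))) has_real_derivative cut' i x * sqrt (\<rho> x) + inverse (sqrt (\<rho> x)) / 2 * (\<rho> x * D i x) * cut x) (at (x i))"
      unfolding f_def by simp
    moreover have "cut' i x * sqrt (\<rho> x) + inverse (sqrt (\<rho> x)) / 2 * (\<rho> x * D i x) * cut x = f' i x"
    proof -
      have "inverse (sqrt (\<rho> x)) * \<rho> x = sqrt (\<rho> x)"
        using p by (simp add: field_simps)
      then have "inverse (sqrt (\<rho> x)) / 2 * (\<rho> x * D i x) * cut x = sqrt (\<rho> x) * (cut x * D i x / 2)"
        by (metis (no_types, opaque_lifting) mult.assoc mult.commute times_divide_eq_left times_divide_eq_right)
      then show ?thesis using True by (simp add: f'_def algebra_simps)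
    qed
    ultimately show ?thesis by simp
  next
    case False
    have *: "sq (x(i := t)) = sq x - (x i)\<^sup>2 + t\<^sup>2" for t
      unfolding sq_def by (rule sum_sq_fun_upd[OF I i])
    have op: "open {t. K < sq x - (x i)\<^sup>2 + t\<^sup>2}"
      by (intro open_Collect_less continuous_intros)
    have "((\<lambda>t. 0) has_real_derivative f' i x) (at (x i))" using False by (simp add: f'_def)
    then show ?thesis
    proof (rule has_field_derivative_transform_within_open[OF _ op])
      show "x i \<in> {t. K < sq x - (x i)\<^sup>2 + t\<^sup>2}" using False by simp
      show "0 = f (x(i := t))" if "t \<in> {t. K < sq x - (x i)\<^sup>2 + t\<^sup>2}" for t
        using that by (intro out[symmetric]) (simp add: *)
    qed
  qed
  \<comment> \<open>A common bound on \<open>f\<close> and its partial derivatives, as the Poincare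
    inequality requires. Its size, which involves \<open>b\<close>, does not reach the
    conclusion.\<close>
  define B where "B = sqrt \<bar>b\<bar> * (1 + 4 * sqrt K / K + L / 2)"
  have Bp: "sqrt \<bar>b\<bar> \<le> B" "sqrt \<bar>b\<bar> * (4 * sqrt K / K + L / 2) \<le> B"
  proof -
    have nn: "0 \<le> 4 * sqrt K / K + L / 2" using K L by simp
    then have "sqrt \<bar>b\<bar> * 1 \<le> sqrt \<bar>b\<bar> * (1 + 4 * sqrt K / K + L / 2)"
      by (intro mult_left_mono) auto
    then show "sqrt \<bar>b\<bar> \<le> B" by (simp add: B_def)
    show "sqrt \<bar>b\<bar> * (4 * sqrt K / K + L / 2) \<le> B"
      unfolding B_def by (intro mult_left_mono) auto
  qed
  have sqrtb: "sqrt (\<rho> x) \<le> sqrt \<bar>b\<bar>" if "x \<in> extensional I" "sq x \<le> K" for x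
    using bd[OF that(1)] that(2) by (simp add: K_def)
  have fB: "\<bar>f x\<bar> \<le> B" if x: "x \<in> extensional I" for x
  proof (cases "sq x \<le> K")
    case True
    then show ?thesis using f0[OF x] order_trans[OF order_trans[OF fle[OF x] sqrtb[OF x True]] Bp(1)] by simp
  next
    case False
    then show ?thesis using out[of x] Bp(1) order_trans[OF real_sqrt_ge_zero[of "\<bar>b\<bar>"] Bp(1)] by simp
  qed
  have xi: "(x i)\<^sup>2 \<le> sq x" if "i \<in> I" for i and x :: "'i \<Rightarrow> real"
    unfolding sq_def using I that member_le_sum[of i I "\<lambda>i. (x i)\<^sup>2"] by simp
  have f'B: "\<bar>f' i x\<bar> \<le> B" if i: "i \<in> I" and x: "x \<in> extensional I" for i x
  proof (cases "sq x \<le> K")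
    case True
    then have s: "sq x \<le> A\<^sup>2 * d" by (simp add: K_def)
    have "(D i x)\<^sup>2 \<le> (\<Sum>i\<in>I. (D i x)\<^sup>2)"
      using I i member_le_sum[of i I "\<lambda>i. (D i x)\<^sup>2"] by simp
    also have "\<dots> \<le> L\<^sup>2" by (rule grad[OF x s])
    finally have "\<bar>D i x\<bar> \<le> L" using L by (simp add: abs_le_square_iff[symmetric])
    moreover have "\<bar>x i\<bar> \<le> sqrt K"
      using xi[OF i, of x] True by (intro real_le_rsqrt) simp
    then have "\<bar>cut' i x\<bar> \<le> 4 * sqrt K / K"
    proof -
      have "\<bar>cut' i x\<bar> = m x * (4 * \<bar>x i\<bar> / K)"
        using K m01(1)[of x] by (simp add: cut'_def abs_mult)
      also have "\<dots> \<le> 1 * (4 * sqrt K / K)"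
        using K m01[of x] \<open>\<bar>x i\<bar> \<le> sqrt K\<close> by (intro mult_mono divide_right_mono) auto
      finally show ?thesis by simp
    qed
    moreover have "\<bar>cut x * D i x\<bar> \<le> 1 * L"
      unfolding abs_mult using cut01[of x] \<open>\<bar>D i x\<bar> \<le> L\<close> by (intro mult_mono) auto
    ultimately have "\<bar>cut' i x + cut x * D i x / 2\<bar> \<le> 4 * sqrt K / K + L / 2" by linarith
    moreover have "\<bar>f' i x\<bar> = sqrt (\<rho> x) * \<bar>cut' i x + cut x * D i x / 2\<bar>"
      using True \<rho>0[OF x] by (simp add: f'_def abs_mult)
    ultimately have "\<bar>f' i x\<bar> \<le> sqrt \<bar>b\<bar> * (4 * sqrt K / K + L / 2)"
      using sqrtb[OF x True] \<rho>0[OF x] by (simp add: mult_mono)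
    then show ?thesis using Bp(2) by linarith
  next
    case False
    then show ?thesis using order_trans[OF real_sqrt_ge_zero[of "\<bar>b\<bar>"] Bp(1)] by (simp add: f'_def)
  qed
  have f'm: "f' i \<in> borel_measurable ?G" if "i \<in> I" for i
    by (rule borel_measurable_partial_derivative[OF that fm fder[OF that]])
  have sqB: "\<bar>t\<bar> \<le> B \<Longrightarrow> t\<^sup>2 \<le> B\<^sup>2" for t :: real
    using power_mono[of "\<bar>t\<bar>" B 2] by simp
  have f'i: "integrable ?G (\<lambda>x. (f' i x)\<^sup>2)" if i: "i \<in> I" for i
    using f'm[OF i] f'B[OF i] by (intro integrable_const_bound[of _ "B\<^sup>2"]) (auto intro!: AE_I2 sqB)
  have fi: "integrable ?G f"
    using fB by (intro integrable_const_bound[of _ B]) (auto intro!: AE_I2)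
  have f2i: "integrable ?G (\<lambda>x. (f x)\<^sup>2)"
    using fB by (intro integrable_const_bound[of _ "B\<^sup>2"]) (auto intro!: AE_I2 sqB)
  have \<rho>i: "has_bochner_integral ?G \<rho> 1"
    using \<rho>0 \<rho>1 by (intro has_bochner_integral_nn_integral) (auto intro!: AE_I2)
  \<comment> \<open>From \<open>(a + b)^2 \<le> 2 a^2 + 2 b^2\<close>: the squared gradient of the
    cutoff is at most \<open>16 / A^2\<close> because \<open>d \<ge> 1\<close>, and the halved
    logarithmic gradient contributes \<open>2 * L^2 / 4\<close>.\<close>
  define v where "v = 32 / A\<^sup>2 + L\<^sup>2 / 2"
  have v0: "0 \<le> v" by (simp add: v_def)
  have gradf: "(\<Sum>i\<in>I. (f' i x)\<^sup>2) \<le> v * \<rho> x" if x: "x \<in> extensional I" for x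
  proof (cases "sq x \<le> K")
    case True
    then have s: "sq x \<le> A\<^sup>2 * d" by (simp add: K_def)
    have "(f' i x)\<^sup>2 \<le> \<rho> x * (2 * (cut' i x)\<^sup>2 + (D i x)\<^sup>2 / 2)" for i
    proof -
      have "(f' i x)\<^sup>2 = \<rho> x * (cut' i x + cut x * D i x / 2)\<^sup>2"
        using True \<rho>0[OF x] by (simp add: f'_def power_mult_distrib)
      also have "(cut' i x + cut x * D i x / 2)\<^sup>2 \<le> 2 * (cut' i x)\<^sup>2 + 2 * (cut x * D i x / 2)\<^sup>2"
        using sum_squares_bound[of "cut' i x" "cut x * D i x / 2"] by (simp add: power2_sum)
      also have "2 * (cut x * D i x / 2)\<^sup>2 \<le> (D i x)\<^sup>2 / 2"
        using mult_right_mono[OF power_le_one[OF cut01, of x 2], of "(D i x)\<^sup>2"]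
        by (simp add: power_mult_distrib power_divide)
      finally show ?thesis using \<rho>0[OF x] by (simp add: mult_left_mono)
    qed
    then have "(\<Sum>i\<in>I. (f' i x)\<^sup>2) \<le> (\<Sum>i\<in>I. \<rho> x * (2 * (cut' i x)\<^sup>2 + (D i x)\<^sup>2 / 2))"
      by (rule sum_mono)
    also have "\<dots> = \<rho> x * (2 * (\<Sum>i\<in>I. (cut' i x)\<^sup>2) + (\<Sum>i\<in>I. (D i x)\<^sup>2) / 2)"
      by (simp add: sum_distrib_left sum.distrib distrib_left sum_divide_distrib mult_ac)
    also have "\<dots> \<le> \<rho> x * (2 * (16 / A\<^sup>2) + L\<^sup>2 / 2)"
    proof (intro mult_left_mono add_mono divide_right_mono grad[OF x s] \<rho>0[OF x])
      have "(\<Sum>i\<in>I. (cut' i x)\<^sup>2) = 16 * (m x)\<^sup>2 / K\<^sup>2 * sq x"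
        unfolding cut'_def sq_def by (simp add: sum_distrib_left sum_divide_distrib power_mult_distrib power_divide mult_ac)
      also have "\<dots> \<le> 16 * 1 / K\<^sup>2 * K"
        using m01[of x] K True sq0[of x] by (intro mult_mono divide_right_mono) (auto simp: power_le_one)
      also have "\<dots> = 16 / K" using K by (simp add: power2_eq_square)
      also have "\<dots> \<le> 16 / A\<^sup>2" using K A by (intro divide_left_mono) auto
      finally show "(\<Sum>i\<in>I. (cut' i x)\<^sup>2) \<le> 16 / A\<^sup>2" .
    qed auto
    finally show ?thesis by (simp add: v_def mult.commute)
  next
    case False
    then show ?thesis using \<rho>0[OF x] v0 by (simp add: f'_def)
  qed
  have "(\<integral>x. (f x)\<^sup>2 \<partial>?G) - (\<integral>x. f x \<partial>?G)\<^sup>2 \<le> (\<Sum>i\<in>I. \<integral>x. (f' i x)\<^sup>2 \<partial>?G)"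
    by (rule poincare_stdN_prod[OF I fm fB fder f'B])
  also have "\<dots> = (\<integral>x. (\<Sum>i\<in>I. (f' i x)\<^sup>2) \<partial>?G)"
    using f'i by (intro Bochner_Integration.integral_sum[symmetric])
  also have "\<dots> \<le> (\<integral>x. v * \<rho> x \<partial>?G)"
    using f'i gradf \<rho>i by (intro integral_mono Bochner_Integration.integrable_sum integrable_mult_right) (auto simp: has_bochner_integral_iff)
  also have "\<dots> = v" using \<rho>i by (simp add: has_bochner_integral_iff)
  finally have var: "(\<integral>x. (f x)\<^sup>2 \<partial>?G) - v \<le> (\<integral>x. f x \<partial>?G)\<^sup>2" by simp
  define T where "T = {x. R\<^sup>2 * d < sq x}"
  have Tm[measurable]: "Measurable.pred ?G (\<lambda>x. x \<in> T)" unfolding T_def by measurable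
  have ti: "has_bochner_integral ?G (\<lambda>x. \<rho> x * indicator T x) (enn2real (\<integral>\<^sup>+ x. ennreal (\<rho> x) * indicator T x \<partial>?G))"
  proof (rule has_bochner_integral_nn_integral)
    have "(\<integral>\<^sup>+ x. ennreal (\<rho> x) * indicator T x \<partial>?G) \<le> ennreal \<tau>" using tail by (simp add: T_def)
    then have fin: "(\<integral>\<^sup>+ x. ennreal (\<rho> x) * indicator T x \<partial>?G) < \<infinity>"
      by (rule le_less_trans) simp
    have "(\<integral>\<^sup>+ x. ennreal (\<rho> x * indicator T x) \<partial>?G) = (\<integral>\<^sup>+ x. ennreal (\<rho> x) * indicator T x \<partial>?G)"
      by (intro nn_integral_cong) (auto split: split_indicator)
    with fin show "(\<integral>\<^sup>+ x. ennreal (\<rho> x * indicator T x) \<partial>?G) = ennreal (enn2real (\<integral>\<^sup>+ x. ennreal (\<rho> x) * indicator T x \<partial>?G))"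
      by simp
  qed (use \<rho>0 in \<open>auto intro!: AE_I2\<close>)
  have tle: "enn2real (\<integral>\<^sup>+ x. ennreal (\<rho> x) * indicator T x \<partial>?G) \<le> \<tau>"
    using tail \<tau> by (intro enn2real_leI) (auto simp: T_def)
  \<comment> \<open>On the ball of radius \<open>R * sqrt d\<close> one has
    \<open>m x \<ge> 1 - R^2 / A^2\<close>, and the square of \<open>f\<close> is the fourth power
    of \<open>m\<close> times \<open>\<rho>\<close>. Bernoulli's inequality then produces the factor
    4.\<close>
  define c where "c = 4 * R\<^sup>2 / A\<^sup>2"
  have c0: "0 \<le> c" by (simp add: c_def)
  have "1 - c - \<tau> \<le> (\<integral>x. \<rho> x - c * \<rho> x - \<rho> x * indicator T x \<partial>?G)"
    using \<rho>i ti tle by (simp add: has_bochner_integral_iff)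
  also have "\<dots> \<le> (\<integral>x. (f x)\<^sup>2 \<partial>?G)"
  proof (rule integral_mono)
    show "integrable ?G (\<lambda>x. \<rho> x - c * \<rho> x - \<rho> x * indicator T x)"
      using \<rho>i ti by (simp add: has_bochner_integral_iff)
    fix x assume "x \<in> space ?G"
    then have x: "x \<in> extensional I" by simp
    show "\<rho> x - c * \<rho> x - \<rho> x * indicator T x \<le> (f x)\<^sup>2"
    proof (cases "x \<in> T")
      case True
      then have "\<rho> x - c * \<rho> x - \<rho> x * indicator T x = - (c * \<rho> x)" by simp
      also have "\<dots> \<le> 0" using mult_nonneg_nonneg[OF c0 \<rho>0[OF x]] by linarith
      also have "0 \<le> (f x)\<^sup>2" by simp
      finally show ?thesis .
    next
      case False
      then have "sq x \<le> R\<^sup>2 * d" by (simp add: T_def)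
      then have "sq x / K \<le> R\<^sup>2 * d / K" using K by (intro divide_right_mono) auto
      also have "R\<^sup>2 * d / K = R\<^sup>2 / A\<^sup>2" using dI(2) by (simp add: K_def)
      finally have mx: "1 - R\<^sup>2 / A\<^sup>2 \<le> m x" by (simp add: m_def)
      have r1: "R\<^sup>2 / A\<^sup>2 \<le> 1" using A R power_mono[of R A 2] by simp
      have "1 - c \<le> (1 - R\<^sup>2 / A\<^sup>2) ^ 4"
        using Bernoulli_inequality[of "- (R\<^sup>2 / A\<^sup>2)" 4] r1 by (simp add: c_def)
      also have "\<dots> \<le> (m x) ^ 4" using mx r1 by (intro power_mono) auto
      finally have "(1 - c) * \<rho> x \<le> (m x) ^ 4 * \<rho> x" using \<rho>0[OF x] by (rule mult_right_mono)
      also have "\<dots> = (f x)\<^sup>2"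
        using \<rho>0[OF x] by (simp add: f_def cut_def power_mult_distrib)
      finally show ?thesis using False by (simp add: algebra_simps)
    qed
  qed (rule f2i)
  finally have ef2: "1 - c - \<tau> - v \<le> (\<integral>x. f x \<partial>?G)\<^sup>2" using var by linarith
  have \<rho>sm: "integrable ?G (\<lambda>x. sqrt (\<rho> x))"
  proof (rule Bochner_Integration.integrable_bound)
    show "integrable ?G (\<lambda>x. 1 + \<rho> x)" using \<rho>i by (simp add: has_bochner_integral_iff)
    show "AE x in ?G. norm (sqrt (\<rho> x)) \<le> norm (1 + \<rho> x)"
    proof (intro AE_I2)
      fix x assume "x \<in> space ?G"
      then have r: "0 \<le> \<rho> x" using \<rho>0 by simp
      have "0 \<le> (sqrt (\<rho> x) - 1)\<^sup>2" by simp
      then show "norm (sqrt (\<rho> x)) \<le> norm (1 + \<rho> x)"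
        using r by (simp add: power2_diff)
    qed
  qed measurable
  \<comment> \<open>The Hellinger affinity with the Gaussian. It lies between the mean of
    \<open>f\<close> and 1, so the squared mean of \<open>f\<close> is at most \<open>H\<close>, and
    the bounds above give \<open>1 - H \<le> e^2 / 8\<close>.\<close>
  define H where "H = (\<integral>x. sqrt (\<rho> x) \<partial>?G)"
  have Ef0: "0 \<le> (\<integral>x. f x \<partial>?G)" using f0 by (intro Bochner_Integration.integral_nonneg) simp
  have EfH: "(\<integral>x. f x \<partial>?G) \<le> H"
    unfolding H_def using fle by (intro integral_mono fi \<rho>sm) simp
  have sqdiff: "(\<integral>x. (sqrt (\<rho> x) - 1)\<^sup>2 \<partial>?G) = 2 - 2 * H" "integrable ?G (\<lambda>x. (sqrt (\<rho> x) - 1)\<^sup>2)"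
    "(\<integral>x. (sqrt (\<rho> x) + 1)\<^sup>2 \<partial>?G) = 2 + 2 * H" "integrable ?G (\<lambda>x. (sqrt (\<rho> x) + 1)\<^sup>2)"
  proof -
    have "has_bochner_integral ?G (\<lambda>x. \<rho> x + 1 - 2 * sqrt (\<rho> x)) (1 + 1 - 2 * H)"
      using \<rho>i \<rho>sm prob_space by (intro has_bochner_integral_add has_bochner_integral_diff has_bochner_integral_mult_right) (auto simp: has_bochner_integral_iff H_def)
    then have "has_bochner_integral ?G (\<lambda>x. (sqrt (\<rho> x) - 1)\<^sup>2) (2 - 2 * H)"
      by (rule has_bochner_integral_cong[THEN iffD1, rotated -1]) (use \<rho>0 in \<open>auto simp: power2_diff\<close>)
    then show "(\<integral>x. (sqrt (\<rho> x) - 1)\<^sup>2 \<partial>?G) = 2 - 2 * H" "integrable ?G (\<lambda>x. (sqrt (\<rho> x) - 1)\<^sup>2)"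
      by (auto simp: has_bochner_integral_iff)
    have "has_bochner_integral ?G (\<lambda>x. \<rho> x + 1 + 2 * sqrt (\<rho> x)) (1 + 1 + 2 * H)"
      using \<rho>i \<rho>sm prob_space by (intro has_bochner_integral_add has_bochner_integral_mult_right) (auto simp: has_bochner_integral_iff H_def)
    then have "has_bochner_integral ?G (\<lambda>x. (sqrt (\<rho> x) + 1)\<^sup>2) (2 + 2 * H)"
      by (rule has_bochner_integral_cong[THEN iffD1, rotated -1]) (use \<rho>0 in \<open>auto simp: power2_sum\<close>)
    then show "(\<integral>x. (sqrt (\<rho> x) + 1)\<^sup>2 \<partial>?G) = 2 + 2 * H" "integrable ?G (\<lambda>x. (sqrt (\<rho> x) + 1)\<^sup>2)"
      by (auto simp: has_bochner_integral_iff)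
  qed
  have H1: "H \<le> 1"
  proof -
    have "0 \<le> (\<integral>x. (sqrt (\<rho> x) - 1)\<^sup>2 \<partial>?G)" by (rule Bochner_Integration.integral_nonneg) simp
    then show ?thesis by (simp add: sqdiff)
  qed
  have "(\<integral>x. f x \<partial>?G)\<^sup>2 \<le> 1 * H"
    unfolding power2_eq_square using Ef0 EfH H1 by (intro mult_mono) auto
  with ef2 small have Hge: "1 - H \<le> e\<^sup>2 / 8" by (simp add: c_def v_def)
  \<comment> \<open>Factor \<open>\<rho> - 1\<close> as a product of \<open>sqrt \<rho> - 1\<close>
    and \<open>sqrt \<rho> + 1\<close> and apply the weighted arithmetic-geometric mean inequality.
    The weights are balanced so that each term ends up at most \<open>e / 2\<close>.\<close>
  have "(\<integral>x. \<bar>\<rho> x - 1\<bar> \<partial>?G) \<le> (\<integral>x. (2 / e) * (sqrt (\<rho> x) - 1)\<^sup>2 + (e / 8) * (sqrt (\<rho> x) + 1)\<^sup>2 \<partial>?G)"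
  proof (rule integral_mono)
    show "integrable ?G (\<lambda>x. \<bar>\<rho> x - 1\<bar>)" using \<rho>i by (simp add: has_bochner_integral_iff)
    show "integrable ?G (\<lambda>x. (2 / e) * (sqrt (\<rho> x) - 1)\<^sup>2 + (e / 8) * (sqrt (\<rho> x) + 1)\<^sup>2)"
      using sqdiff by simp
    fix x assume "x \<in> space ?G"
    then have r: "0 \<le> \<rho> x" using \<rho>0 by simp
    define s where "s = sqrt (\<rho> x)"
    have s: "0 \<le> s" "\<rho> x = s\<^sup>2" using r by (auto simp: s_def)
    define p q where "p = \<bar>s - 1\<bar>" and "q = s + 1"
    have "\<rho> x - 1 = (s - 1) * (s + 1)" using s by (simp add: power2_eq_square algebra_simps)
    then have "\<bar>\<rho> x - 1\<bar> = p * q" using s by (simp add: abs_mult p_def q_def)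
    moreover have "p * q \<le> (2 / e) * p\<^sup>2 + (e / 8) * q\<^sup>2"
    proof -
      have "0 \<le> (4 * p - e * q)\<^sup>2" by simp
      then have "8 * e * (p * q) \<le> 16 * p\<^sup>2 + e\<^sup>2 * q\<^sup>2"
        by (simp add: power2_diff power_mult_distrib mult_ac)
      then have "8 * e * (p * q) / (8 * e) \<le> (16 * p\<^sup>2 + e\<^sup>2 * q\<^sup>2) / (8 * e)"
        using e by (intro divide_right_mono) auto
      also have "(16 * p\<^sup>2 + e\<^sup>2 * q\<^sup>2) / (8 * e) = (2 / e) * p\<^sup>2 + (e / 8) * q\<^sup>2"
        using e by (simp add: add_divide_distrib power2_eq_square)
      finally show ?thesis using e by simp
    qed
    ultimately show "\<bar>\<rho> x - 1\<bar> \<le> (2 / e) * (sqrt (\<rho> x) - 1)\<^sup>2 + (e / 8) * (sqrt (\<rho> x) + 1)\<^sup>2"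
      by (simp add: p_def q_def s_def)
  qed
  also have "\<dots> = (2 / e) * (2 - 2 * H) + (e / 8) * (2 + 2 * H)"
    using sqdiff by simp
  also have "\<dots> \<le> (2 / e) * (e\<^sup>2 / 4) + (e / 8) * 4"
    using Hge H1 e by (intro add_mono mult_left_mono) auto
  also have "\<dots> = e" using e by (simp add: power2_eq_square)
  finally show ?thesis .
qed

section \<open>Geometry of the likelihood\<close>

lemma Theta_iff_cells: "\<theta> \<in> Theta d \<longleftrightarrow> \<theta> \<in> Rd d \<and> (\<forall>j\<in>{0..d}. 0 < cell d \<theta> j)"
proof
  assume "\<theta> \<in> Theta d"
  then show "\<theta> \<in> Rd d \<and> (\<forall>j\<in>{0..d}. 0 < cell d \<theta> j)"
    using cell_pos[of \<theta> d] by (auto simp: Theta_def)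
next
  assume *: "\<theta> \<in> Rd d \<and> (\<forall>j\<in>{0..d}. 0 < cell d \<theta> j)"
  have "0 < \<theta> j" if "j \<in> {1..d}" for j
    using * that by (auto simp: cell_def dest!: bspec[of _ _ j])
  moreover have "0 < cell d \<theta> 0" using * by simp
  ultimately show "\<theta> \<in> Theta d" using * by (simp add: Theta_def cell_def)
qed

lemma theta_min_le: "j \<le> d \<Longrightarrow> theta_min d p \<le> cell d p j"
  unfolding theta_min_def by (intro Min_le) auto

lemma theta_min_pos: "p \<in> Theta d \<Longrightarrow> 0 < theta_min d p"
  unfolding theta_min_def by (subst Min_gr_iff) (auto intro: cell_pos)

text \<open>The difference of the two sides vanishes at 0, and its derivative
  \<open>t * (1 - t) / (2 * (1 + t))\<close> has the sign of \<open>t\<close> on this range.\<close>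

lemma ln_one_plus_quadratic:
  fixes t :: real
  assumes "\<bar>t\<bar> \<le> 1 / 2"
  shows "t\<^sup>2 / 4 \<le> t - ln (1 + t)"
proof -
  define f where "f t = t - ln (1 + t) - t\<^sup>2 / 4" for t :: real
  have der: "(f has_real_derivative t * (1 - t) / (2 * (1 + t))) (at t)" if "\<bar>t\<bar> \<le> 1 / 2" for t
  proof -
    have "0 < 1 + t" using that by (auto simp: abs_le_iff)
    then show ?thesis unfolding f_def
      by (auto intro!: derivative_eq_intros simp: field_simps power2_eq_square)
  qed
  have "f 0 \<le> f t"
  proof (cases "0 \<le> t")
    case True
    show ?thesis
    proof (rule DERIV_nonneg_imp_nondecreasing[OF True])
      fix x assume x: "0 \<le> x" "x \<le> t"
      then have "\<bar>x\<bar> \<le> 1 / 2" "0 \<le> x * (1 - x) / (2 * (1 + x))" using assms by auto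
      then show "\<exists>y. (f has_real_derivative y) (at x) \<and> 0 \<le> y" using der by blast
    qed
  next
    case False
    then have "t \<le> 0" by simp
    then show ?thesis
    proof (rule DERIV_nonpos_imp_nonincreasing)
      fix x assume x: "t \<le> x" "x \<le> 0"
      then have "\<bar>x\<bar> \<le> 1 / 2" using assms by auto
      moreover from this have "x * (1 - x) / (2 * (1 + x)) \<le> 0"
        using x by (intro divide_nonpos_pos mult_nonpos_nonneg) (auto simp: abs_le_iff)
      ultimately show "\<exists>y. (f has_real_derivative y) (at x) \<and> y \<le> 0" using der by blast
    qed
  qed
  then show ?thesis by (simp add: f_def)
qed

text \<open>The mean value theorem for \<open>ln \<phi>\<close>. It is applied to the prior between
  the ground truth and the MLE, and to the likelihood along rays from the MLE.\<close>

lemma pos_log_derivative_lower_bound: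
  fixes \<phi> \<psi> :: "real \<Rightarrow> real"
  assumes pos: "\<And>t. 0 \<le> t \<Longrightarrow> t \<le> 1 \<Longrightarrow> 0 < \<phi> t"
    and der: "\<And>t. 0 \<le> t \<Longrightarrow> t \<le> 1 \<Longrightarrow> (\<phi> has_real_derivative \<phi> t * \<psi> t) (at t)"
    and bd: "\<And>t. 0 \<le> t \<Longrightarrow> t \<le> 1 \<Longrightarrow> \<bar>\<psi> t\<bar> \<le> M"
  shows "\<phi> 0 * exp (- M) \<le> \<phi> 1"
proof -
  have "((\<lambda>t. ln (\<phi> t)) has_real_derivative \<psi> t) (at t)" if t: "0 \<le> t" "t \<le> 1" for t
  proof -
    have "((\<lambda>t. ln (\<phi> t)) has_real_derivative 1 / \<phi> t * (\<phi> t * \<psi> t)) (at t)"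
      by (rule DERIV_chain2[OF DERIV_ln_divide[OF pos[OF t]] der[OF t]])
    then show ?thesis using pos[OF t] by simp
  qed
  then obtain z where z: "0 < z" "z < 1" "ln (\<phi> 1) - ln (\<phi> 0) = (1 - 0) * \<psi> z"
    using MVT2[of 0 1 "\<lambda>t. ln (\<phi> t)" \<psi>] by auto
  then have "- M \<le> ln (\<phi> 1) - ln (\<phi> 0)" using bd[of z] by (auto simp: abs_le_iff)
  then have "exp (ln (\<phi> 0) + - M) \<le> exp (ln (\<phi> 1))" by simp
  then show ?thesis using pos[of 0] pos[of 1] by (simp only: exp_add) simp
qed

text \<open>The displacement of all \<open>d + 1\<close> cells caused by a displacement of the free
  parameters. Its entries sum to zero, which later annihilates the linear terms.\<close>

definition cell_dir :: "nat \<Rightarrow> (nat \<Rightarrow> real) \<Rightarrow> nat \<Rightarrow> real" where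
  "cell_dir d v j = (if j = 0 then - (\<Sum>k\<in>{1..d}. v k) else v j)"

lemma sum_cell_dir: "(\<Sum>j\<in>{0..d}. cell_dir d v j) = 0"
proof -
  have "(\<Sum>j\<in>{0..d}. cell_dir d v j) = cell_dir d v 0 + (\<Sum>j\<in>{1..d}. cell_dir d v j)"
    by (simp add: sum.atLeast_Suc_atMost)
  also have "(\<Sum>j\<in>{1..d}. cell_dir d v j) = (\<Sum>j\<in>{1..d}. v j)"
    by (intro sum.cong) (auto simp: cell_dir_def)
  finally show ?thesis by (simp add: cell_dir_def)
qed

lemma cell_line: "j \<le> d \<Longrightarrow> cell d (line d x v t) j = cell d x j + t * cell_dir d v j"
  by (auto simp: cell_def cell_dir_def line_def sum.distrib sum_distrib_left)

lemma fisher_form_cell_dir: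
  "fisher_form d p u v = (\<Sum>j\<in>{0..d}. cell_dir d u j * cell_dir d v j / cell d p j)"
proof -
  have "fisher_form d p u v = fisher_form d p (cell_dir d u) (cell_dir d v)"
    unfolding fisher_form_def by (auto simp: cell_dir_def intro!: arg_cong2[where f="(+)"] arg_cong2[where f="(/)"] arg_cong2[where f="(*)"] sum.cong)
  also have "\<dots> = (\<Sum>j\<in>{0..d}. cell_dir d u j * cell_dir d v j / cell d p j)"
    by (rule fisher_form_eq_cells) (auto simp: cell_dir_def intro!: sum.cong)
  finally show ?thesis .
qed

lemma cell_diff: "cell_dir d (\<lambda>j. x j - y j) j = cell d x j - cell d y j"
  by (auto simp: cell_dir_def cell_def sum_subtractf)

lemma chol_map_scale: "chol_map p (\<lambda>i. c * x i) k = c * chol_map p x k"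
  by (simp add: chol_map_def sum_distrib_left algebra_simps)

lemma chol_map_add: "chol_map p (\<lambda>i. x i + y i) k = chol_map p x k + chol_map p y k"
  by (simp add: chol_map_def distrib_left sum.distrib)

lemma chol_map_sum:
  "chol_map p (\<lambda>k. \<Sum>i\<in>I. z i * e i k) k = (\<Sum>i\<in>I. z i * chol_map p (e i) k)"
proof (cases "finite I")
  case True
  then show ?thesis
    by induction (auto simp: chol_map_add chol_map_scale, simp add: chol_map_def)
qed (simp add: chol_map_def)

lemma chol_map_cong: "(\<And>i. i \<in> {1..k} \<Longrightarrow> x i = y i) \<Longrightarrow> 1 \<le> k \<Longrightarrow> chol_map p x k = chol_map p y k"
  by (simp add: chol_map_def)

lemma cell_dir_scale: "cell_dir d (\<lambda>j. c * v j) j = c * cell_dir d v j"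
  by (simp add: cell_dir_def sum_distrib_left)

lemma fisher_form_scale: "fisher_form d p (\<lambda>j. a * u j) (\<lambda>j. b * v j) = a * b * fisher_form d p u v"
  unfolding fisher_form_cell_dir cell_dir_scale sum_distrib_left by (intro sum.cong) auto

definition sq_norm :: "nat \<Rightarrow> (nat \<Rightarrow> real) \<Rightarrow> real" where
  "sq_norm d x = (\<Sum>i\<in>{1..d}. (x i)\<^sup>2)"

lemma sq_norm_nonneg [simp]: "0 \<le> sq_norm d x"
  by (simp add: sq_norm_def sum_nonneg)

text \<open>The good event with the counts frozen. \<open>s\<close> measures how far the frequencies
  are from the truth, and \<open>A\<close> is the radius of the ball in standardized coordinates.
  Since 64 is the square of 8, \<open>kappa_small\<close> says that
  \<open>A * sqrt \<kappa> \<le> 1 / 8\<close>, which keeps all cells on the ball comparable to the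
  true ones.\<close>

locale multinomial_fit =
  fixes d n :: nat and p :: "nat \<Rightarrow> real" and N :: "nat \<Rightarrow> nat" and s A :: real
  assumes d1: "1 \<le> d" and n1: "1 \<le> n" and p: "p \<in> Theta d"
    and sumN: "(\<Sum>j\<in>{0..d}. N j) = n"
    and s0: "0 \<le> s" and sA: "s \<le> A" and A1: "0 < A"
    and chi_square: "(\<Sum>j\<in>{0..d}. (real (N j) / real n - cell d p j)\<^sup>2 / cell d p j) \<le> s\<^sup>2 * real d / real n"
    and kappa_small: "64 * A\<^sup>2 * ((real d)\<^sup>2 / (real n * theta_min d p)) \<le> 1"
begin

section \<open>Cells at the MLE and on the standardized ball\<close>

definition \<kappa> :: real where "\<kappa> = (real d)\<^sup>2 / (real n * theta_min d p)"
definition h :: "nat \<Rightarrow> real" where "h j = real (N j) / real n"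
definition th :: "nat \<Rightarrow> real" where "th = (\<lambda>j\<in>{1..d}. h j)"
abbreviation "q \<equiv> cell d p"

text \<open>Displacement in the original coordinates of a displacement \<open>z\<close> in the standardized ones.\<close>

definition V :: "(nat \<Rightarrow> real) \<Rightarrow> nat \<Rightarrow> real" where "V z k = chol_map p z k / sqrt (real n)"

abbreviation "u x \<equiv> cell_dir d (V x)"
abbreviation "\<Phi> \<equiv> std_map d p n th"

lemma q_pos: "j \<le> d \<Longrightarrow> 0 < q j" using cell_pos[OF p] .
lemma n_pos: "0 < n" using n1 by simp
lemma d_pos: "0 < real d" using d1 by simp
lemma kappa_nonneg: "0 \<le> \<kappa>" using theta_min_pos[OF p] by (simp add: \<kappa>_def)

lemma sum_h: "(\<Sum>j\<in>{0..d}. h j) = 1"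
  using n_pos sumN unfolding h_def sum_divide_distrib[symmetric] by (simp flip: of_nat_sum)

lemma th_Rd [simp]: "th \<in> Rd d" by (simp add: th_def)

lemma cell_th: "j \<le> d \<Longrightarrow> cell d th j = h j"
proof -
  have "(\<Sum>k\<in>{1..d}. th k) = (\<Sum>k\<in>{1..d}. h k)" by (intro sum.cong) (auto simp: th_def)
  moreover have "(\<Sum>j\<in>{0..d}. h j) = h 0 + (\<Sum>k\<in>{1..d}. h k)" by (simp add: sum.atLeast_Suc_atMost)
  ultimately show "j \<le> d \<Longrightarrow> cell d th j = h j" using sum_h by (auto simp: cell_def th_def)
qed

lemma std_map_line: "\<Phi> (line d x z t) = line d (\<Phi> x) (V z) t"
proof
  fix k
  have "chol_map p (line d x z t) k = chol_map p x k + t * chol_map p z k" if k: "k \<in> {1..d}"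
  proof -
    have "chol_map p (line d x z t) k = chol_map p (\<lambda>k. x k + t * z k) k"
      using k by (intro chol_map_cong) (auto simp: line_def)
    then show ?thesis by (simp add: chol_map_add chol_map_scale)
  qed
  then show "\<Phi> (line d x z t) k = line d (\<Phi> x) (V z) t k"
    by (auto simp: std_map_def line_def V_def add_divide_distrib)
qed

lemma std_map_eq_line: "\<Phi> x = line d th (V x) 1"
  by (auto simp: std_map_def line_def V_def)

lemma cell_std_map: "j \<le> d \<Longrightarrow> cell d (\<Phi> x) j = h j + u x j"
  by (simp add: std_map_eq_line cell_line cell_th)

lemma fisher_form_V: "fisher_form d p (V x) (V z) = (\<Sum>i\<in>{1..d}. x i * z i) / real n"
proof -
  have V: "V x = (\<lambda>k. (1 / sqrt (real n)) * chol_map p x k)" for x by (auto simp: V_def)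
  have "(1 / sqrt (real n)) * (1 / sqrt (real n)) = 1 / real n" by simp
  then show ?thesis unfolding V fisher_form_scale fisher_form_chol_map[OF p] by simp
qed

lemma sum_u_sq: "(\<Sum>j\<in>{0..d}. (u x j)\<^sup>2 / q j) = sq_norm d x / real n"
  using fisher_form_V[of x x] by (simp add: fisher_form_cell_dir power2_eq_square sq_norm_def)

text \<open>Passage from chi-square distance to relative error in each cell. A single summand gives
  \<open>(v j)^2 \<le> a^2 * (d / n) * q j\<close>; then \<open>d \<le> d^2\<close> and
  \<open>theta_min \<le> q j\<close> replace \<open>d / n\<close> by
  \<open>\<kappa> * q j\<close>.\<close>

lemma cell_deviation:
  assumes v: "(\<Sum>j\<in>{0..d}. (v j)\<^sup>2 / q j) \<le> a\<^sup>2 * real d / real n" and a: "0 \<le> a" and j: "j \<le> d"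
  shows "(v j)\<^sup>2 / q j \<le> a\<^sup>2 * real d / real n" "\<bar>v j\<bar> \<le> a * sqrt \<kappa> * q j"
proof -
  have "(v j)\<^sup>2 / q j \<le> (\<Sum>j\<in>{0..d}. (v j)\<^sup>2 / q j)"
    using j q_pos by (intro member_le_sum) (auto intro!: divide_nonneg_pos)
  also note v
  finally show 1: "(v j)\<^sup>2 / q j \<le> a\<^sup>2 * real d / real n" .
  have t: "0 < theta_min d p" "theta_min d p \<le> q j" using theta_min_pos[OF p] theta_min_le[OF j] by auto
  have dd: "real d \<le> (real d)\<^sup>2" using d1 by (simp add: power2_eq_square)
  have "(v j)\<^sup>2 = (v j)\<^sup>2 / q j * q j" using q_pos[OF j] by simp
  also have "\<dots> \<le> a\<^sup>2 * real d / real n * q j"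
    using 1 q_pos[OF j] by (intro mult_right_mono) auto
  also have "\<dots> \<le> a\<^sup>2 * (real d)\<^sup>2 / real n * q j"
    using dd q_pos[OF j] by (intro mult_right_mono divide_right_mono mult_left_mono) auto
  also have "\<dots> = a\<^sup>2 * \<kappa> * theta_min d p * q j"
    using t by (simp add: \<kappa>_def)
  also have "\<dots> \<le> a\<^sup>2 * \<kappa> * q j * q j"
    using t q_pos[OF j] kappa_nonneg by (intro mult_right_mono mult_left_mono) auto
  also have "\<dots> = (a * sqrt \<kappa> * q j)\<^sup>2"
    using kappa_nonneg by (simp add: power_mult_distrib power2_eq_square[of "q j"])
  finally show "\<bar>v j\<bar> \<le> a * sqrt \<kappa> * q j"
    using a kappa_nonneg q_pos[OF j] by (simp add: abs_le_square_iff[symmetric])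
qed

lemma A_sqrt_kappa: "a \<le> A \<Longrightarrow> a * sqrt \<kappa> \<le> 1 / 8"
proof -
  assume a: "a \<le> A"
  have "(A * sqrt \<kappa>)\<^sup>2 \<le> (1 / 8)\<^sup>2"
    using kappa_small kappa_nonneg by (simp add: power_mult_distrib \<kappa>_def[symmetric] power_divide)
  then have "A * sqrt \<kappa> \<le> 1 / 8" by (rule power2_le_imp_le) simp
  moreover have "a * sqrt \<kappa> \<le> A * sqrt \<kappa>" using a kappa_nonneg by (intro mult_right_mono) auto
  ultimately show ?thesis by simp
qed

lemma h_near:
  assumes j: "j \<le> d"
  shows "\<bar>h j - q j\<bar> \<le> q j / 8"
  using order_trans[OF cell_deviation(2)[OF chi_square s0 j] mult_right_mono[OF A_sqrt_kappa[OF sA] less_imp_le[OF q_pos[OF j]]]]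
  by (simp add: h_def)

lemma h_pos: "j \<le> d \<Longrightarrow> 0 < h j"
  using h_near[of j] q_pos[of j] unfolding abs_le_iff by linarith

lemma th_Theta: "th \<in> Theta d"
  unfolding Theta_iff_cells by (intro conjI ballI th_Rd) (simp add: cell_th h_pos)

lemma u_bound:
  assumes x: "sq_norm d x \<le> A\<^sup>2 * real d"
  shows "(\<Sum>j\<in>{0..d}. (u x j)\<^sup>2 / q j) \<le> A\<^sup>2 * real d / real n"
  unfolding sum_u_sq using x by (intro divide_right_mono) auto

lemma u_near:
  assumes x: "sq_norm d x \<le> A\<^sup>2 * real d" and j: "j \<le> d"
  shows "\<bar>u x j\<bar> \<le> q j / 8"
  using order_trans[OF cell_deviation(2)[OF u_bound[OF x] less_imp_le[OF A1] j]
      mult_right_mono[OF A_sqrt_kappa[OF order_refl] less_imp_le[OF q_pos[OF j]]]]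
  by simp

lemma cell_near:
  assumes x: "sq_norm d x \<le> A\<^sup>2 * real d" and j: "j \<le> d"
  shows "\<bar>cell d (\<Phi> x) j - q j\<bar> \<le> q j / 4" "3 / 4 * q j \<le> cell d (\<Phi> x) j" "0 < cell d (\<Phi> x) j"
  using u_near[OF x j] h_near[OF j] q_pos[OF j] unfolding cell_std_map[OF j] abs_le_iff by linarith+

lemma std_map_Theta: "sq_norm d x \<le> A\<^sup>2 * real d \<Longrightarrow> \<Phi> x \<in> Theta d"
  unfolding Theta_iff_cells by (intro conjI ballI std_map_Rd cell_near(3)) auto

section \<open>Excess negative log likelihood over the MLE\<close>

lemma nll_eq: "nll n d N \<theta> = - (\<Sum>j\<in>{0..d}. h j * ln (cell d \<theta> j))"
  by (simp add: nll_def h_def)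

text \<open>Cells and frequencies both sum to 1, so the linear terms may be added for free. Every
  summand is then nonnegative by \<open>ln x \<le> x - 1\<close>, with equality only at 1, which
  yields uniqueness of the MLE.\<close>

lemma nll_diff:
  assumes \<theta>: "\<theta> \<in> Theta d"
  shows "nll n d N \<theta> - nll n d N th
    = (\<Sum>j\<in>{0..d}. h j * (cell d \<theta> j / h j - 1 - ln (cell d \<theta> j / h j)))"
proof -
  have "(\<Sum>j\<in>{0..d}. h j * (cell d \<theta> j / h j - 1 - ln (cell d \<theta> j / h j)))
      = (\<Sum>j\<in>{0..d}. cell d \<theta> j - h j - h j * ln (cell d \<theta> j) + h j * ln (h j))"
  proof (intro sum.cong refl)
    fix j assume "j \<in> {0..d}"
    then have "0 < h j" "0 < cell d \<theta> j" using h_pos cell_pos[OF \<theta>] by auto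
    then show "h j * (cell d \<theta> j / h j - 1 - ln (cell d \<theta> j / h j)) = cell d \<theta> j - h j - h j * ln (cell d \<theta> j) + h j * ln (h j)"
      by (simp add: ln_div algebra_simps)
  qed
  also have "\<dots> = (\<Sum>j\<in>{0..d}. cell d \<theta> j) - (\<Sum>j\<in>{0..d}. h j) - (\<Sum>j\<in>{0..d}. h j * ln (cell d \<theta> j)) + (\<Sum>j\<in>{0..d}. h j * ln (h j))"
    by (simp add: sum.distrib sum_subtractf)
  also have "(\<Sum>j\<in>{0..d}. h j * ln (h j)) = (\<Sum>j\<in>{0..d}. h j * ln (cell d th j))"
    by (intro sum.cong) (auto simp: cell_th)
  finally show ?thesis by (simp add: nll_eq sum_cell sum_h)
qed

lemma mle_unique: "is_mle n d N \<theta> \<longleftrightarrow> \<theta> = th"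
proof -
  have gap: "nll n d N th < nll n d N \<theta>" if \<theta>: "\<theta> \<in> Theta d" and ne: "\<theta> \<noteq> th" for \<theta>
  proof -
    have nn: "0 \<le> h j * (cell d \<theta> j / h j - 1 - ln (cell d \<theta> j / h j))" if "j \<le> d" for j
      using h_pos[OF that] cell_pos[OF \<theta> that] ln_le_minus_one[of "cell d \<theta> j / h j"]
      by (intro mult_nonneg_nonneg) auto
    obtain j where j: "j \<in> {1..d}" "\<theta> j \<noteq> th j"
      using ne \<theta> th_Rd extensionalityI[of \<theta> "{1..d}" th] by (auto simp: Theta_def)
    then have jd: "j \<le> d" and c: "cell d \<theta> j \<noteq> h j" by (auto simp: cell_def th_def)
    then have "ln (cell d \<theta> j / h j) \<noteq> cell d \<theta> j / h j - 1"
      using ln_eq_minus_one[of "cell d \<theta> j / h j"] h_pos[OF jd] cell_pos[OF \<theta> jd] by auto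
    then have "0 < h j * (cell d \<theta> j / h j - 1 - ln (cell d \<theta> j / h j))"
      using h_pos[OF jd] cell_pos[OF \<theta> jd] ln_le_minus_one[of "cell d \<theta> j / h j"]
      by (intro mult_pos_pos) auto
    then have "0 < (\<Sum>j\<in>{0..d}. h j * (cell d \<theta> j / h j - 1 - ln (cell d \<theta> j / h j)))"
      using jd nn by (intro sum_pos2[of _ j]) auto
    then show ?thesis using nll_diff[OF \<theta>] by simp
  qed
  show ?thesis
  proof
    assume "is_mle n d N \<theta>"
    then show "\<theta> = th" using gap[of \<theta>] th_Theta by (auto simp: is_mle_def is_arg_min_def)
  next
    assume "\<theta> = th"
    then show "is_mle n d N \<theta>" using gap th_Theta by (fastforce simp: is_mle_def is_arg_min_def)
  qed
qed

lemma mle_eq: "mle n d N = th"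
  unfolding mle_def mle_unique by simp

lemma nll_local_quadratic:
  assumes x: "sq_norm d x \<le> A\<^sup>2 * real d"
  shows "sq_norm d x / 8 \<le> real n * (nll n d N (\<Phi> x) - nll n d N th)"
proof -
  have "(1 / 8) * ((u x j)\<^sup>2 / q j) \<le> h j * (cell d (\<Phi> x) j / h j - 1 - ln (cell d (\<Phi> x) j / h j))" if j: "j \<le> d" for j
  proof -
    \<comment> \<open>The relative displacement from the MLE. The quadratic bound on
      \<open>t - ln (1 + t)\<close> loses a factor 4 and \<open>h j \<le> 2 * q j\<close> another
      factor 2, hence the 1/8.\<close>
    define t where "t = u x j / h j"
    have hq: "0 < h j" "h j \<le> 2 * q j" "q j / 2 \<le> h j" using h_pos[OF j] h_near[OF j] q_pos[OF j] unfolding abs_le_iff by linarith+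
    have c: "cell d (\<Phi> x) j / h j = 1 + t" using hq by (simp add: cell_std_map[OF j] t_def field_simps)
    have "\<bar>t\<bar> \<le> 1 / 2"
      using u_near[OF x j] hq by (simp add: t_def abs_div pos_divide_le_eq)
    then have "h j * (t\<^sup>2 / 4) \<le> h j * (t - ln (1 + t))"
      using hq by (intro mult_left_mono ln_one_plus_quadratic) auto
    moreover have "h j * (t\<^sup>2 / 4) = (u x j)\<^sup>2 / (4 * h j)"
      using hq by (simp add: t_def power2_eq_square)
    moreover have "(u x j)\<^sup>2 / (8 * q j) \<le> (u x j)\<^sup>2 / (4 * h j)"
      using hq q_pos[OF j] by (intro divide_left_mono) auto
    ultimately show ?thesis by (simp add: c)
  qed
  then have "(\<Sum>j\<in>{0..d}. (1 / 8) * ((u x j)\<^sup>2 / q j)) \<le> nll n d N (\<Phi> x) - nll n d N th"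
    unfolding nll_diff[OF std_map_Theta[OF x]] by (intro sum_mono) auto
  then have "(1 / 8) * (sq_norm d x / real n) \<le> nll n d N (\<Phi> x) - nll n d N th"
    unfolding sum_distrib_left[symmetric] sum_u_sq .
  then show ?thesis using n_pos by (simp add: field_simps)
qed

text \<open>Convexity of the negative log likelihood along rays propagates the local quadratic growth
  to linear growth on the whole parameter space.\<close>

lemma nll_global_linear:
  assumes x: "R\<^sup>2 * real d < sq_norm d x" and R: "0 < R" "R \<le> A" and \<theta>: "\<Phi> x \<in> Theta d"
  shows "R * sqrt (real d) * sqrt (sq_norm d x) / 8 \<le> real n * (nll n d N (\<Phi> x) - nll n d N th)"
proof -
  define r where "r = sqrt (sq_norm d x)"
  \<comment> \<open>Chosen so that \<open>y = c * x\<close> lies on the sphere of radius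
    \<open>R * sqrt d\<close>, on the segment from the MLE to \<open>x\<close>. Dividing the
    quadratic bound at \<open>y\<close> by \<open>c\<close> gives growth proportional to the norm of
    \<open>x\<close>.\<close>
  define c where "c = R * sqrt (real d) / r"
  have R0: "0 < R * sqrt (real d)" using R d_pos by simp
  have "R * sqrt (real d) < r"
  proof -
    have "sqrt (R\<^sup>2 * real d) < r" using x by (simp add: r_def)
    then show ?thesis using R by (simp add: real_sqrt_mult)
  qed
  then have r: "0 < r" "0 < c" "c < 1" using R0 by (auto simp: c_def)
  have r2: "r\<^sup>2 = sq_norm d x" by (simp add: r_def)
  define y where "y = (\<lambda>i. c * x i)"
  have sy: "sq_norm d y = R\<^sup>2 * real d"
  proof -
    have "sq_norm d y = c\<^sup>2 * r\<^sup>2" unfolding r2 by (simp add: sq_norm_def y_def power_mult_distrib sum_distrib_left)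
    also have "\<dots> = R\<^sup>2 * real d" using r R by (simp add: c_def power_divide power_mult_distrib)
    finally show ?thesis .
  qed
  also have "R\<^sup>2 * real d \<le> A\<^sup>2 * real d" using R by (intro mult_right_mono power_mono) auto
  finally have yA: "sq_norm d y \<le> A\<^sup>2 * real d" .
  have cy: "cell d (\<Phi> y) j = (1 - c) * h j + c * cell d (\<Phi> x) j" if j: "j \<le> d" for j
  proof -
    have "V y = (\<lambda>k. c * V x k)" by (auto simp: V_def y_def chol_map_scale)
    then have "u y j = c * u x j" by (simp add: cell_dir_scale)
    then show ?thesis using j by (simp add: cell_std_map algebra_simps)
  qed
  \<comment> \<open>Concavity of the logarithm, from its tangent at the intermediate value
    \<open>m\<close>.\<close>
  have "(1 - c) * ln (h j) + c * ln (cell d (\<Phi> x) j) \<le> ln (cell d (\<Phi> y) j)" if j: "j \<le> d" for j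
  proof -
    define m where "m = cell d (\<Phi> y) j"
    have pos: "0 < h j" "0 < cell d (\<Phi> x) j" "0 < m"
      using h_pos[OF j] cell_pos[OF \<theta> j] cell_near(3)[OF yA j] by (auto simp: m_def)
    have "(1 - c) * ln (h j / m) + c * ln (cell d (\<Phi> x) j / m)
        \<le> (1 - c) * (h j / m - 1) + c * (cell d (\<Phi> x) j / m - 1)"
      using pos r by (intro add_mono mult_left_mono ln_le_minus_one) auto
    also have "\<dots> = ((1 - c) * h j + c * cell d (\<Phi> x) j) / m - 1"
      by (simp add: add_divide_distrib diff_divide_distrib algebra_simps)
    also have "\<dots> = 0" using pos by (simp add: cy[OF j, symmetric] m_def[symmetric])
    finally show ?thesis using pos by (simp add: ln_div m_def[symmetric] algebra_simps)
  qed
  then have "(\<Sum>j\<in>{0..d}. h j * ((1 - c) * ln (h j) + c * ln (cell d (\<Phi> x) j))) \<le> (\<Sum>j\<in>{0..d}. h j * ln (cell d (\<Phi> y) j))"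
    using h_pos by (intro sum_mono mult_left_mono) (auto intro: less_imp_le)
  moreover have "(\<Sum>j\<in>{0..d}. h j * ((1 - c) * ln (h j) + c * ln (cell d (\<Phi> x) j)))
      = (1 - c) * (\<Sum>j\<in>{0..d}. h j * ln (h j)) + c * (\<Sum>j\<in>{0..d}. h j * ln (cell d (\<Phi> x) j))"
    by (simp add: sum_distrib_left sum.distrib distrib_left mult_ac)
  moreover have "(\<Sum>j\<in>{0..d}. h j * ln (h j)) = (\<Sum>j\<in>{0..d}. h j * ln (cell d th j))"
    by (intro sum.cong) (auto simp: cell_th)
  ultimately have "nll n d N (\<Phi> y) \<le> (1 - c) * nll n d N th + c * nll n d N (\<Phi> x)"
    by (simp add: nll_eq algebra_simps)
  then have "nll n d N (\<Phi> y) - nll n d N th \<le> c * (nll n d N (\<Phi> x) - nll n d N th)"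
    by (simp add: algebra_simps)
  then have "real n * (nll n d N (\<Phi> y) - nll n d N th) \<le> real n * (c * (nll n d N (\<Phi> x) - nll n d N th))"
    by (intro mult_left_mono) auto
  also have "\<dots> = c * (real n * (nll n d N (\<Phi> x) - nll n d N th))" by (rule mult.left_commute)
  finally have "R\<^sup>2 * real d / 8 \<le> c * (real n * (nll n d N (\<Phi> x) - nll n d N th))"
    using nll_local_quadratic[OF yA] unfolding sy by linarith
  then have "R\<^sup>2 * real d / 8 / c \<le> real n * (nll n d N (\<Phi> x) - nll n d N th)"
    using r by (simp add: pos_divide_le_eq mult.commute)
  moreover have "R\<^sup>2 * real d / 8 / c = R * sqrt (real d) * r / 8"
  proof -
    have "R\<^sup>2 * real d = (R * sqrt (real d)) * (R * sqrt (real d))"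
      by (simp add: power2_eq_square)
    then show ?thesis using r R d_pos by (simp add: c_def)
  qed
  ultimately show ?thesis by (simp add: r_def)
qed

end

section \<open>Tails of the standard Gaussian\<close>

lemma nn_integral_exp_neg_abs: "(\<integral>\<^sup>+ t. ennreal (exp (- \<bar>t\<bar>)) \<partial>lborel) \<le> 2"
proof -
  have half: "(\<integral>\<^sup>+ t. ennreal (exp (- t)) * indicator {0..} t \<partial>lborel) = 1"
  proof -
    have "(\<integral>\<^sup>+ t. ennreal (exp (- t)) * indicator {0..} t \<partial>lborel) = ennreal (0 - (- exp (- 0)))"
    proof (rule nn_integral_FTC_atLeast)
      show "((\<lambda>t. - exp (- t)) has_real_derivative exp (- x)) (at x)" for x :: real
        by (auto intro!: derivative_eq_intros)
      show "((\<lambda>t. - exp (- t)) \<longlongrightarrow> 0) (at_top :: real filter)" by real_asymp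
    qed auto
    then show ?thesis by simp
  qed
  have half': "(\<integral>\<^sup>+ t. ennreal (exp t) * indicator {..0} t \<partial>lborel) = 1"
  proof -
    have "(\<integral>\<^sup>+ t. ennreal (exp t) * indicator {..0} t \<partial>lborel)
       = ennreal \<bar>-1\<bar> * (\<integral>\<^sup>+ t. ennreal (exp (0 + (-1) * t)) * indicator {..0} (0 + (-1) * t) \<partial>lborel)"
      by (rule nn_integral_real_affine) auto
    also have "\<dots> = (\<integral>\<^sup>+ t. ennreal (exp (- t)) * indicator {0..} t \<partial>lborel)"
      by simp (intro nn_integral_cong, auto split: split_indicator)
    finally show ?thesis using half by simp
  qed
  have "(\<integral>\<^sup>+ t. ennreal (exp (- \<bar>t\<bar>)) \<partial>lborel)
      \<le> (\<integral>\<^sup>+ t. ennreal (exp (- t)) * indicator {0..} t + ennreal (exp t) * indicator {..0} t \<partial>lborel)"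
    by (intro nn_integral_mono) (auto split: split_indicator)
  also have "\<dots> = (\<integral>\<^sup>+ t. ennreal (exp (- t)) * indicator {0..} t \<partial>lborel) + (\<integral>\<^sup>+ t. ennreal (exp t) * indicator {..0} t \<partial>lborel)"
    by (rule nn_integral_add) auto
  also have "\<dots> = 2" unfolding half half' by simp
  finally show ?thesis .
qed

text \<open>The factor \<open>exp (t^2 / 2)\<close> cancels the Gaussian density, leaving a Laplace
  integral of at most \<open>2 / sqrt (2 * pi)\<close>. A bound not exceeding 1 is essential, since
  its \<open>d\<close>-th power is taken next.\<close>

lemma nn_integral_stdN_exp_abs:
  assumes a: "1 \<le> a"
  shows "(\<integral>\<^sup>+ t. ennreal (exp (t\<^sup>2 / 2 - a * \<bar>t\<bar>)) \<partial>stdN) \<le> 1"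
proof -
  have "(\<integral>\<^sup>+ t. ennreal (exp (t\<^sup>2 / 2 - a * \<bar>t\<bar>)) \<partial>stdN)
      = (\<integral>\<^sup>+ t. ennreal (std_normal_density t) * ennreal (exp (t\<^sup>2 / 2 - a * \<bar>t\<bar>)) \<partial>lborel)"
    by (rule nn_integral_density) auto
  also have "\<dots> \<le> (\<integral>\<^sup>+ t. ennreal (1 / 2) * ennreal (exp (- \<bar>t\<bar>)) \<partial>lborel)"
  proof (intro nn_integral_mono)
    fix t :: real
    have s: "2 \<le> sqrt (2 * pi)" using pi_gt3 by (intro real_le_rsqrt) simp
    have "exp (- t\<^sup>2 / 2) * exp (t\<^sup>2 / 2 - a * \<bar>t\<bar>) = exp (- (a * \<bar>t\<bar>))"
      by (simp add: exp_add[symmetric])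
    then have "std_normal_density t * exp (t\<^sup>2 / 2 - a * \<bar>t\<bar>) = 1 / sqrt (2 * pi) * exp (- (a * \<bar>t\<bar>))"
      unfolding std_normal_density_def by (simp only: mult.assoc)
    also have "\<dots> \<le> 1 / 2 * exp (- \<bar>t\<bar>)"
    proof (intro mult_mono)
      show "1 / sqrt (2 * pi) \<le> 1 / 2" using s by (intro divide_left_mono) auto
      show "exp (- (a * \<bar>t\<bar>)) \<le> exp (- \<bar>t\<bar>)" using mult_right_mono[OF a abs_ge_zero[of t]] by simp
    qed auto
    finally show "ennreal (std_normal_density t) * ennreal (exp (t\<^sup>2 / 2 - a * \<bar>t\<bar>)) \<le> ennreal (1 / 2) * ennreal (exp (- \<bar>t\<bar>))"
      by (simp add: ennreal_mult[symmetric] ennreal_leI del: ennreal_half)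
  qed
  also have "\<dots> = ennreal (1 / 2) * (\<integral>\<^sup>+ t. ennreal (exp (- \<bar>t\<bar>)) \<partial>lborel)"
    by (rule nn_integral_cmult) simp
  also have "\<dots> \<le> ennreal (1 / 2) * ennreal 2"
    using nn_integral_exp_neg_abs by (intro mult_left_mono) auto
  also have "\<dots> = 1" by (subst ennreal_mult[symmetric]) auto
  finally show ?thesis .
qed

text \<open>The sum of absolute values is used in place of the Euclidean norm because the integrand
  then factorizes over the coordinates.\<close>

lemma nn_integral_stdN_prod_exp_abs:
  assumes I: "finite I" and a: "1 \<le> a"
  shows "(\<integral>\<^sup>+ x. ennreal (exp ((\<Sum>i\<in>I. (x i)\<^sup>2) / 2 - a * (\<Sum>i\<in>I. \<bar>x i\<bar>))) \<partial>stdN_prod I) \<le> 1"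
proof -
  interpret N: prob_space stdN by (rule prob_space_stdN)
  interpret product_sigma_finite "\<lambda>_. stdN" ..
  have "(\<integral>\<^sup>+ x. ennreal (exp ((\<Sum>i\<in>I. (x i)\<^sup>2) / 2 - a * (\<Sum>i\<in>I. \<bar>x i\<bar>))) \<partial>stdN_prod I)
      = (\<integral>\<^sup>+ x. (\<Prod>i\<in>I. ennreal (exp ((x i)\<^sup>2 / 2 - a * \<bar>x i\<bar>))) \<partial>stdN_prod I)"
  proof (intro nn_integral_cong)
    fix x :: "'a \<Rightarrow> real"
    have "(\<Sum>i\<in>I. (x i)\<^sup>2) / 2 - a * (\<Sum>i\<in>I. \<bar>x i\<bar>) = (\<Sum>i\<in>I. (x i)\<^sup>2 / 2 - a * \<bar>x i\<bar>)"
      by (simp add: sum_subtractf sum_divide_distrib sum_distrib_left)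
    then show "ennreal (exp ((\<Sum>i\<in>I. (x i)\<^sup>2) / 2 - a * (\<Sum>i\<in>I. \<bar>x i\<bar>))) = (\<Prod>i\<in>I. ennreal (exp ((x i)\<^sup>2 / 2 - a * \<bar>x i\<bar>)))"
      by (simp add: exp_sum I prod_ennreal)
  qed
  also have "\<dots> = (\<Prod>i\<in>I. \<integral>\<^sup>+ t. ennreal (exp (t\<^sup>2 / 2 - a * \<bar>t\<bar>)) \<partial>stdN)"
    using I by (intro product_nn_integral_prod) auto
  also have "\<dots> \<le> (\<Prod>i\<in>I. 1)"
    by (intro prod_mono_ennreal nn_integral_stdN_exp_abs a)
  finally show ?thesis by simp
qed

lemma nn_integral_stdN_sq: "(\<integral>\<^sup>+ t. ennreal (t\<^sup>2) \<partial>stdN) = 1"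
proof -
  have "has_bochner_integral lborel (\<lambda>x. std_normal_density x * x ^ (2 * 1)) (fact (2 * 1) / (2 ^ 1 * fact 1))"
    by (rule std_normal_moment_even)
  then have *: "has_bochner_integral lborel (\<lambda>x. std_normal_density x * x\<^sup>2) 1" by simp
  have "(\<integral>\<^sup>+ t. ennreal (t\<^sup>2) \<partial>stdN) = (\<integral>\<^sup>+ t. ennreal (std_normal_density t) * ennreal (t\<^sup>2) \<partial>lborel)"
    by (rule nn_integral_density) auto
  also have "\<dots> = (\<integral>\<^sup>+ t. ennreal (std_normal_density t * t\<^sup>2) \<partial>lborel)"
    by (simp add: ennreal_mult)
  also have "\<dots> = ennreal 1"
    using * nn_integral_eq_integral[of lborel "\<lambda>x. std_normal_density x * x\<^sup>2"]
    by (auto simp: has_bochner_integral_iff)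
  finally show ?thesis by simp
qed

lemma nn_integral_stdN_prod_component:
  assumes I: "finite I" "i \<in> I" and f: "f \<in> borel_measurable borel"
  shows "(\<integral>\<^sup>+ x. f (x i) \<partial>stdN_prod I) = (\<integral>\<^sup>+ t. f t \<partial>stdN)"
proof -
  interpret N: prob_space stdN by (rule prob_space_stdN)
  interpret product_prob_space "\<lambda>_. stdN" I ..
  have "(\<integral>\<^sup>+ t. f t \<partial>stdN) = (\<integral>\<^sup>+ t. f t \<partial>distr (stdN_prod I) stdN (\<lambda>x. x i))"
    using PiM_component[OF I(2)] by simp
  also have "\<dots> = (\<integral>\<^sup>+ x. f (x i) \<partial>stdN_prod I)"
    using I f by (intro nn_integral_distr) auto
  finally show ?thesis ..
qed

text \<open>Markov's inequality for the squared norm, whose Gaussian mean is the number of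
  coordinates.\<close>

lemma stdN_prod_ball_half:
  assumes I: "finite I" "I \<noteq> {}"
  shows "1 / 2 \<le> emeasure (stdN_prod I) {x \<in> extensional I. (\<Sum>i\<in>I. (x i)\<^sup>2) \<le> 2 * real (card I)}"
proof -
  let ?G = "stdN_prod I"
  interpret prob_space ?G by (rule prob_space_stdN_prod)
  define d where "d = real (card I)"
  have d: "0 < d" using I by (simp add: d_def card_gt_0_iff)
  have xm[measurable]: "(\<lambda>x. x i) \<in> borel_measurable ?G" if "i \<in> I" for i
    using measurable_component_singleton[OF that, of "\<lambda>_. stdN"] by simp
  have sqm[measurable]: "(\<lambda>x. \<Sum>i\<in>I. (x i)\<^sup>2) \<in> borel_measurable ?G"
    by (intro borel_measurable_sum borel_measurable_power xm)
  have "(\<integral>\<^sup>+ x. ennreal (\<Sum>i\<in>I. (x i)\<^sup>2) \<partial>?G) = (\<integral>\<^sup>+ x. (\<Sum>i\<in>I. ennreal ((x i)\<^sup>2)) \<partial>?G)"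
    by (simp add: sum_ennreal)
  also have "\<dots> = (\<Sum>i\<in>I. \<integral>\<^sup>+ x. ennreal ((x i)\<^sup>2) \<partial>?G)"
    by (intro nn_integral_sum) measurable
  also have "\<dots> = (\<Sum>i\<in>I. 1)"
  proof (intro sum.cong refl)
    fix i assume i: "i \<in> I"
    show "(\<integral>\<^sup>+ x. ennreal ((x i)\<^sup>2) \<partial>?G) = 1"
      using nn_integral_stdN_prod_component[OF I(1) i, of "\<lambda>t. ennreal (t\<^sup>2)"] nn_integral_stdN_sq by simp
  qed
  also have "\<dots> = ennreal d" by (simp add: d_def ennreal_of_nat_eq_real_of_nat)
  finally have E: "(\<integral>\<^sup>+ x. ennreal (\<Sum>i\<in>I. (x i)\<^sup>2) \<partial>?G) = ennreal d" .
  have i: "integrable ?G (\<lambda>x. \<Sum>i\<in>I. (x i)\<^sup>2)" and v: "(\<integral>x. (\<Sum>i\<in>I. (x i)\<^sup>2) \<partial>?G) = d"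
  proof -
    have "has_bochner_integral ?G (\<lambda>x. \<Sum>i\<in>I. (x i)\<^sup>2) d"
      using E d by (intro has_bochner_integral_nn_integral) (auto intro!: AE_I2 sum_nonneg)
    then show "integrable ?G (\<lambda>x. \<Sum>i\<in>I. (x i)\<^sup>2)" "(\<integral>x. (\<Sum>i\<in>I. (x i)\<^sup>2) \<partial>?G) = d"
      by (auto simp: has_bochner_integral_iff)
  qed
  have "prob {x \<in> space ?G. 2 * d \<le> (\<Sum>i\<in>I. (x i)\<^sup>2)} \<le> (\<integral>x. (\<Sum>i\<in>I. (x i)\<^sup>2) \<partial>?G) / (2 * d)"
    using d by (intro integral_Markov_inequality_measure[OF i, where A="space ?G - space ?G"]) (auto intro!: AE_I2 sum_nonneg)
  then have 1: "prob {x \<in> space ?G. 2 * d \<le> (\<Sum>i\<in>I. (x i)\<^sup>2)} \<le> 1 / 2" using d by (simp add: v)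
  have sets: "{x \<in> space ?G. (\<Sum>i\<in>I. (x i)\<^sup>2) \<le> 2 * d} \<in> sets ?G" by measurable
  have sets': "{x \<in> space ?G. 2 * d \<le> (\<Sum>i\<in>I. (x i)\<^sup>2)} \<in> sets ?G" by measurable
  have "1 - prob {x \<in> space ?G. (\<Sum>i\<in>I. (x i)\<^sup>2) \<le> 2 * d} = prob (space ?G - {x \<in> space ?G. (\<Sum>i\<in>I. (x i)\<^sup>2) \<le> 2 * d})"
    by (rule prob_compl[OF sets, symmetric])
  also have "\<dots> \<le> prob {x \<in> space ?G. 2 * d \<le> (\<Sum>i\<in>I. (x i)\<^sup>2)}"
    by (intro finite_measure_mono sets') auto
  also note 1
  finally have "1 / 2 \<le> prob {x \<in> space ?G. (\<Sum>i\<in>I. (x i)\<^sup>2) \<le> 2 * d}" by simp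
  then have "ennreal (1 / 2) \<le> emeasure ?G {x \<in> space ?G. (\<Sum>i\<in>I. (x i)\<^sup>2) \<le> 2 * d}"
    unfolding emeasure_eq_measure by (rule ennreal_leI)
  then show ?thesis by (simp add: d_def divide_ennreal_def ennreal_half)
qed

section \<open>The posterior in standardized coordinates\<close>

text \<open>Adds the prior. The radius \<open>2 * A\<close> leaves room for the distance from truth
  to MLE and the radius of the ball around the MLE. \<open>R16\<close> makes the rate
  \<open>R / 16\<close> in the tail at least 1, \<open>CR\<close> makes the tail exponent
  nonpositive, and \<open>L_small\<close> limits the loss in the normalizing constant to
  \<open>exp (- d)\<close>.\<close>

locale multinomial_posterior = multinomial_fit +
  fixes \<pi>0 :: "(nat \<Rightarrow> real) \<Rightarrow> real" and C \<eta> R :: real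
  assumes prior: "prior_density d \<pi>0"
    and C0: "0 \<le> C" and prior_bound: "\<And>\<theta>. \<theta> \<in> Theta d \<Longrightarrow> \<pi>0 \<theta> \<le> \<pi>0 p * exp (C * real d)"
    and eta0: "0 \<le> \<eta>" and delta: "delta01 n d p \<pi>0 (2 * A) \<le> ereal (\<eta> * sqrt (real n))"
    and R16: "16 \<le> R" and RA: "R \<le> A" and CR: "C + 1 \<le> R\<^sup>2 / 16"
    and L_small: "\<eta> * s + 2 * (sqrt (8 * ((real d)\<^sup>2 / (real n * theta_min d p))) * A\<^sup>2 + \<eta>) \<le> 1"
begin

definition L :: real where "L = sqrt (8 * \<kappa>) * A\<^sup>2 + \<eta>"

abbreviation "score \<equiv> \<lambda>\<theta> j. partial j (\<lambda>y. ln (\<pi>0 y)) \<theta>"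

lemma L_nonneg: "0 \<le> L"
  using kappa_nonneg eta0 by (simp add: L_def)

lemma L_small': "\<eta> * s + 2 * L \<le> 1"
  using L_small by (simp add: L_def \<kappa>_def)

text \<open>A finite \<open>delta01\<close> excludes its default value infinity, and so carries
  smoothness and positivity of the prior along with the score bound.\<close>

lemma prior_U_star:
  shows prior_C1: "C1_on d \<pi>0 (U_star n d p (2 * A))"
    and prior_pos: "\<And>\<theta>. \<theta> \<in> U_star n d p (2 * A) \<Longrightarrow> 0 < \<pi>0 \<theta>"
    and prior_score: "\<And>\<theta>. \<theta> \<in> U_star n d p (2 * A) \<Longrightarrow>
        dual_wnorm (fisher d p) (grad d (\<lambda>\<theta>. ln (\<pi>0 \<theta>)) \<theta>) \<le> \<eta> * sqrt (real n)"
proof -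
  have *: "C1_on d \<pi>0 (U_star n d p (2 * A)) \<and> (\<forall>\<theta>\<in>U_star n d p (2 * A). 0 < \<pi>0 \<theta>)"
    using delta unfolding delta01_def by (auto split: if_splits)
  then show "C1_on d \<pi>0 (U_star n d p (2 * A))" "\<And>\<theta>. \<theta> \<in> U_star n d p (2 * A) \<Longrightarrow> 0 < \<pi>0 \<theta>" by auto
  have "(SUP \<theta>\<in>U_star n d p (2 * A). ereal (dual_wnorm (fisher d p) (grad d (\<lambda>\<theta>. ln (\<pi>0 \<theta>)) \<theta>)))
      \<le> ereal (\<eta> * sqrt (real n))"
    using delta * by (simp add: delta01_def)
  then show "dual_wnorm (fisher d p) (grad d (\<lambda>\<theta>. ln (\<pi>0 \<theta>)) \<theta>) \<le> \<eta> * sqrt (real n)"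
    if "\<theta> \<in> U_star n d p (2 * A)" for \<theta>
    using that by (auto simp: SUP_le_iff)
qed

lemma score_bound:
  assumes \<theta>: "\<theta> \<in> U_star n d p (2 * A)"
  shows "\<bar>\<Sum>j\<in>{1..d}. score \<theta> j * v j\<bar> \<le> \<eta> * sqrt (real n) * sqrt (fisher_sq d p v)"
proof -
  have fs: "0 \<le> fisher_sq d p v"
    unfolding fisher_form_cell_dir using q_pos by (intro sum_nonneg divide_nonneg_pos) auto
  have "\<bar>\<Sum>j\<in>{1..d}. score \<theta> j * v j\<bar> \<le> dual_wnorm (fisher d p) (vec_of d (score \<theta>)) * sqrt (fisher_sq d p v)"
    by (rule sum_le_dual_wnorm_fisher[OF p])
  also have "vec_of d (score \<theta>) = grad d (\<lambda>\<theta>. ln (\<pi>0 \<theta>)) \<theta>" by (simp add: grad_def)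
  also have "dual_wnorm (fisher d p) (grad d (\<lambda>\<theta>. ln (\<pi>0 \<theta>)) \<theta>) * sqrt (fisher_sq d p v)
      \<le> \<eta> * sqrt (real n) * sqrt (fisher_sq d p v)"
    using fs by (intro mult_right_mono prior_score[OF \<theta>]) auto
  finally show ?thesis .
qed

lemma U_starI:
  assumes \<theta>: "\<theta> \<in> Rd d" and le: "(\<Sum>j\<in>{0..d}. (cell d \<theta> j - q j)\<^sup>2 / q j) \<le> 4 * A\<^sup>2 * real d / real n"
  shows "\<theta> \<in> U_star n d p (2 * A)"
proof -
  have "fisher_sq d p (\<lambda>j. \<theta> j - p j) = (\<Sum>j\<in>{0..d}. (cell d \<theta> j - q j)\<^sup>2 / q j)"
    unfolding fisher_form_cell_dir cell_diff by (simp add: power2_eq_square)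
  also have "\<dots> \<le> (2 * A * sqrt (real d / real n))\<^sup>2"
    using le by (simp add: power_mult_distrib)
  finally have "sqrt (fisher_sq d p (\<lambda>j. \<theta> j - p j)) \<le> 2 * A * sqrt (real d / real n)"
    using A1 by (intro real_le_lsqrt) auto
  then show ?thesis using \<theta> by (simp add: U_star_def wnorm_fisher[OF p])
qed

lemma sum_sq_add_le:
  "(\<Sum>j\<in>{0..d}. (a j + b j)\<^sup>2 / q j) \<le> 2 * (\<Sum>j\<in>{0..d}. (a j)\<^sup>2 / q j) + 2 * (\<Sum>j\<in>{0..d}. (b j)\<^sup>2 / q j)"
proof -
  have "(\<Sum>j\<in>{0..d}. (a j + b j)\<^sup>2 / q j) \<le> (\<Sum>j\<in>{0..d}. 2 * ((a j)\<^sup>2 / q j) + 2 * ((b j)\<^sup>2 / q j))"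
  proof (intro sum_mono)
    fix j assume "j \<in> {0..d}"
    then have q: "0 < q j" using q_pos by simp
    have "(a j + b j)\<^sup>2 \<le> 2 * (a j)\<^sup>2 + 2 * (b j)\<^sup>2"
      using sum_squares_bound[of "a j" "b j"] by (simp add: power2_sum)
    then have "(a j + b j)\<^sup>2 / q j \<le> (2 * (a j)\<^sup>2 + 2 * (b j)\<^sup>2) / q j" using q by (intro divide_right_mono) auto
    then show "(a j + b j)\<^sup>2 / q j \<le> 2 * ((a j)\<^sup>2 / q j) + 2 * ((b j)\<^sup>2 / q j)" by (simp add: add_divide_distrib)
  qed
  then show ?thesis by (simp add: sum.distrib sum_distrib_left)
qed

lemma h_chi: "(\<Sum>j\<in>{0..d}. (h j - q j)\<^sup>2 / q j) \<le> A\<^sup>2 * real d / real n"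
proof -
  have "s\<^sup>2 * real d / real n \<le> A\<^sup>2 * real d / real n"
    using s0 sA by (intro divide_right_mono mult_right_mono power_mono) auto
  then show ?thesis using chi_square by (simp add: h_def)
qed

text \<open>The displacements from truth to MLE and from MLE to the point each have chi-square size
  at most \<open>A^2 * d / n\<close>; adding them doubles the radius, whence
  \<open>2 * A\<close>.\<close>

lemma std_map_chi:
  assumes x: "sq_norm d x \<le> A\<^sup>2 * real d"
  shows "(\<Sum>j\<in>{0..d}. (cell d (\<Phi> x) j - q j)\<^sup>2 / q j) \<le> 4 * A\<^sup>2 * real d / real n"
proof -
  have "(\<Sum>j\<in>{0..d}. (cell d (\<Phi> x) j - q j)\<^sup>2 / q j) = (\<Sum>j\<in>{0..d}. (u x j + (h j - q j))\<^sup>2 / q j)"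
    by (intro sum.cong) (auto simp: cell_std_map algebra_simps)
  also have "\<dots> \<le> 2 * (A\<^sup>2 * real d / real n) + 2 * (A\<^sup>2 * real d / real n)"
    by (intro order_trans[OF sum_sq_add_le] add_mono mult_left_mono u_bound[OF x] h_chi) auto
  finally show ?thesis by (simp add: mult_ac)
qed

lemma std_map_U_star: "sq_norm d x \<le> A\<^sup>2 * real d \<Longrightarrow> \<Phi> x \<in> U_star n d p (2 * A)"
  by (intro U_starI std_map_chi std_map_Rd)

text \<open>The posterior density relative to the standard Gaussian, up to a constant: the factor
  \<open>exp (sq_norm d x / 2)\<close> undoes the Gaussian weight.\<close>

definition likelihood :: "(nat \<Rightarrow> real) \<Rightarrow> real" where
  "likelihood x = exp (sq_norm d x / 2) * (exp (- real n * nll n d N (\<Phi> x)) * \<pi>0 (\<Phi> x))"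

text \<open>The derivative of \<open>ln likelihood\<close> at \<open>x\<close> in direction \<open>z\<close>.\<close>

definition dlog :: "(nat \<Rightarrow> real) \<Rightarrow> (nat \<Rightarrow> real) \<Rightarrow> real" where
  "dlog x z = (\<Sum>i\<in>{1..d}. x i * z i) + real n * (\<Sum>j\<in>{0..d}. h j * u z j / cell d (\<Phi> x) j)
     + (\<Sum>j\<in>{1..d}. score (\<Phi> x) j * V z j)"

lemma likelihood_derivative:
  assumes x: "sq_norm d (line d x z t) \<le> A\<^sup>2 * real d"
  shows "((\<lambda>t. likelihood (line d x z t)) has_real_derivative
    likelihood (line d x z t) * dlog (line d x z t) z) (at t)"
proof -
  let ?y = "line d x z t"
  have c: "cell d (\<Phi> (line d x z r)) j = cell d (\<Phi> x) j + r * u z j" if "j \<le> d" for j r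
    using that by (simp add: std_map_line cell_line)
  have "((\<lambda>r. (\<Sum>i\<in>{1..d}. (x i + r * z i)\<^sup>2) / 2) has_real_derivative (\<Sum>i\<in>{1..d}. (x i + t * z i) * z i)) (at t)"
    by (auto intro!: derivative_eq_intros DERIV_sum simp: sum_divide_distrib mult_ac)
  moreover have "sq_norm d (line d x z r) = (\<Sum>i\<in>{1..d}. (x i + r * z i)\<^sup>2)" for r
    unfolding sq_norm_def by (intro sum.cong) (auto simp: line_def)
  moreover have "(\<Sum>i\<in>{1..d}. (x i + t * z i) * z i) = (\<Sum>i\<in>{1..d}. ?y i * z i)"
    by (intro sum.cong) (auto simp: line_def)
  ultimately have d1: "((\<lambda>r. sq_norm d (line d x z r) / 2) has_real_derivative (\<Sum>i\<in>{1..d}. ?y i * z i)) (at t)"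
    by simp
  have "((\<lambda>r. - (\<Sum>j\<in>{0..d}. h j * ln (cell d (\<Phi> x) j + r * u z j))) has_real_derivative
      - (\<Sum>j\<in>{0..d}. h j * (u z j / (cell d (\<Phi> x) j + t * u z j)))) (at t)"
  proof (intro DERIV_minus DERIV_sum)
    fix j assume j: "j \<in> {0..d}"
    have "0 < cell d (\<Phi> x) j + t * u z j" using cell_near(3)[OF x, of j] c[of j t] j by simp
    then show "((\<lambda>r. h j * ln (cell d (\<Phi> x) j + r * u z j)) has_real_derivative
        h j * (u z j / (cell d (\<Phi> x) j + t * u z j))) (at t)"
      by (auto intro!: derivative_eq_intros)
  qed
  moreover have "nll n d N (\<Phi> (line d x z r)) = - (\<Sum>j\<in>{0..d}. h j * ln (cell d (\<Phi> x) j + r * u z j))" for r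
    unfolding nll_eq using c by simp
  moreover have "(\<Sum>j\<in>{0..d}. h j * (u z j / (cell d (\<Phi> x) j + t * u z j))) = (\<Sum>j\<in>{0..d}. h j * u z j / cell d (\<Phi> ?y) j)"
    using c by simp
  ultimately have d2: "((\<lambda>r. nll n d N (\<Phi> (line d x z r))) has_real_derivative - (\<Sum>j\<in>{0..d}. h j * u z j / cell d (\<Phi> ?y) j)) (at t)"
    by simp
  have U: "line d (\<Phi> x) (V z) t \<in> U_star n d p (2 * A)"
    using std_map_U_star[OF x] by (simp add: std_map_line)
  from has_derivative_line_pos[OF prior_C1 U prior_pos[OF U]]
  have d3: "((\<lambda>r. \<pi>0 (\<Phi> (line d x z r))) has_real_derivative
      \<pi>0 (\<Phi> ?y) * (\<Sum>j\<in>{1..d}. score (\<Phi> ?y) j * V z j)) (at t)"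
    by (simp only: std_map_line)
  define a b e where "a = (\<Sum>i\<in>{1..d}. ?y i * z i)" and "b = (\<Sum>j\<in>{0..d}. h j * u z j / cell d (\<Phi> ?y) j)"
    and "e = (\<Sum>j\<in>{1..d}. score (\<Phi> ?y) j * V z j)"
  note d1 = d1[folded a_def] and d2 = d2[folded b_def] and d3 = d3[folded e_def]
  have "((\<lambda>r. exp (sq_norm d (line d x z r) / 2) * (exp (- real n * nll n d N (\<Phi> (line d x z r))) * \<pi>0 (\<Phi> (line d x z r))))
     has_real_derivative exp (sq_norm d ?y / 2) * (exp (- real n * nll n d N (\<Phi> ?y)) * \<pi>0 (\<Phi> ?y)) * (a + real n * b + e)) (at t)"
    by (rule derivative_eq_intros d1 d2 d3 refl)+ (simp add: algebra_simps)
  then show ?thesis by (simp add: likelihood_def dlog_def a_def b_def e_def)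
qed

text \<open>The gradient of the Gaussian weight nearly cancels that of the log likelihood. With
  \<open>x \<bullet> z\<close> written as a Fisher form and
  \<open>h j / y j = 1 - u x j / y j\<close>, the linear part disappears because \<open>u z\<close>
  sums to zero. What remains pairs \<open>u z\<close> with \<open>b\<close>, which is of second
  order in the radius of the ball.\<close>

lemma dlog_bound:
  assumes x: "sq_norm d x \<le> A\<^sup>2 * real d"
  shows "\<bar>dlog x z\<bar> \<le> L * sqrt (sq_norm d z)"
proof -
  let ?y = "cell d (\<Phi> x)"
  define b where "b j = u x j * (1 / q j - 1 / ?y j)" for j
  have y: "0 < ?y j" "?y j = h j + u x j" if "j \<le> d" for j
    using cell_near(3)[OF x that] cell_std_map[OF that] by auto
  have "(\<Sum>i\<in>{1..d}. x i * z i) = real n * fisher_form d p (V x) (V z)"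
    using n_pos by (simp add: fisher_form_V)
  also have "\<dots> = real n * (\<Sum>j\<in>{0..d}. u x j * u z j / q j)" by (simp add: fisher_form_cell_dir)
  finally have "(\<Sum>i\<in>{1..d}. x i * z i) + real n * (\<Sum>j\<in>{0..d}. h j * u z j / ?y j)
      = real n * (\<Sum>j\<in>{0..d}. u x j * u z j / q j + h j * u z j / ?y j)"
    by (simp add: sum.distrib distrib_left)
  also have "(\<Sum>j\<in>{0..d}. u x j * u z j / q j + h j * u z j / ?y j) = (\<Sum>j\<in>{0..d}. u z j * b j + u z j)"
  proof (intro sum.cong refl)
    fix j assume "j \<in> {0..d}"
    then have j: "j \<le> d" by simp
    have h: "h j = ?y j - u x j" using y(2)[OF j] by simp
    show "u x j * u z j / q j + h j * u z j / ?y j = u z j * b j + u z j"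
      unfolding h b_def using y(1)[OF j] q_pos[OF j] by (simp add: field_simps)
  qed
  also have "\<dots> = (\<Sum>j\<in>{0..d}. u z j * b j)" by (simp add: sum.distrib sum_cell_dir)
  finally have eq: "dlog x z = real n * (\<Sum>j\<in>{0..d}. u z j * b j) + (\<Sum>j\<in>{1..d}. score (\<Phi> x) j * V z j)"
    by (simp add: dlog_def)
  have t: "0 < theta_min d p" using theta_min_pos[OF p] .
  \<comment> \<open>Here \<open>1 / q - 1 / y = (y - q) / (q * y)\<close>. The chi-square bounds
    give \<open>4 * A^2 * d / n\<close> for \<open>(y - q)^2 / q\<close>,
    \<open>y \<ge> 3/4 * q\<close> gives a factor 2, and the leftover \<open>1 / q\<close> is
    bounded by \<open>1 / theta_min\<close>.\<close>
  have qb: "q j * (b j)\<^sup>2 \<le> (u x j)\<^sup>2 / q j * (8 * A\<^sup>2 * real d / (real n * theta_min d p))" if j: "j \<le> d" for j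
  proof -
    have qj: "0 < q j" "theta_min d p \<le> q j" using q_pos[OF j] theta_min_le[OF j] by auto
    have "(?y j - q j)\<^sup>2 / q j = (u x j + (h j - q j))\<^sup>2 / q j" using y(2)[OF j] by (simp add: algebra_simps)
    also have "\<dots> \<le> (2 * (u x j)\<^sup>2 + 2 * (h j - q j)\<^sup>2) / q j"
      using sum_squares_bound[of "u x j" "h j - q j"] qj by (intro divide_right_mono) (auto simp: power2_sum)
    also have "\<dots> = 2 * ((u x j)\<^sup>2 / q j) + 2 * ((h j - q j)\<^sup>2 / q j)" by (simp add: add_divide_distrib)
    also have "\<dots> \<le> 2 * (A\<^sup>2 * real d / real n) + 2 * (A\<^sup>2 * real d / real n)"
      using cell_deviation(1)[OF u_bound[OF x] less_imp_le[OF A1] j] cell_deviation(1)[OF h_chi less_imp_le[OF A1] j]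
      by (intro add_mono mult_left_mono) auto
    finally have dev: "(?y j - q j)\<^sup>2 / q j \<le> 4 * A\<^sup>2 * real d / real n" by (simp add: mult_ac)
    have y2: "(q j)\<^sup>2 \<le> 2 * (?y j)\<^sup>2"
    proof -
      have "(3 / 4 * q j)\<^sup>2 \<le> (?y j)\<^sup>2" using cell_near(2)[OF x j] qj by (intro power_mono) auto
      then have "9 / 16 * (q j)\<^sup>2 \<le> (?y j)\<^sup>2" by (simp add: power2_eq_square)
      moreover have "0 \<le> (q j)\<^sup>2" by simp
      ultimately show ?thesis by linarith
    qed
    have "b j = u x j * (?y j - q j) / (q j * ?y j)" using qj y(1)[OF j] by (simp add: b_def field_simps)
    then have eqb: "q j * (b j)\<^sup>2 = (u x j)\<^sup>2 / q j * ((?y j - q j)\<^sup>2 / (?y j)\<^sup>2)"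
      using qj by (simp add: power_mult_distrib power_divide power2_eq_square mult_ac)
    have "(?y j - q j)\<^sup>2 / (?y j)\<^sup>2 \<le> (?y j - q j)\<^sup>2 / ((q j)\<^sup>2 / 2)"
      using y2 qj y(1)[OF j] by (intro divide_left_mono) auto
    also have "\<dots> = 2 / q j * ((?y j - q j)\<^sup>2 / q j)" by (simp add: power2_eq_square)
    also have "\<dots> \<le> 2 / theta_min d p * (4 * A\<^sup>2 * real d / real n)"
      using t qj dev by (intro mult_mono divide_left_mono) auto
    also have "\<dots> = 8 * A\<^sup>2 * real d / (real n * theta_min d p)" by (simp add: mult_ac)
    finally show ?thesis unfolding eqb using qj by (intro mult_left_mono) auto
  qed
  have "(\<Sum>j\<in>{0..d}. q j * (b j)\<^sup>2) \<le> (\<Sum>j\<in>{0..d}. (u x j)\<^sup>2 / q j * (8 * A\<^sup>2 * real d / (real n * theta_min d p)))"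
    using qb by (intro sum_mono) auto
  also have "\<dots> = (\<Sum>j\<in>{0..d}. (u x j)\<^sup>2 / q j) * (8 * A\<^sup>2 * real d / (real n * theta_min d p))"
    by (rule sum_distrib_right[symmetric])
  also have "\<dots> \<le> (A\<^sup>2 * real d / real n) * (8 * A\<^sup>2 * real d / (real n * theta_min d p))"
    using t by (intro mult_right_mono u_bound[OF x]) auto
  also have "\<dots> = 8 * \<kappa> * (A\<^sup>2)\<^sup>2 / real n"
    by (simp add: \<kappa>_def power2_eq_square mult_ac)
  finally have sb: "(\<Sum>j\<in>{0..d}. q j * (b j)\<^sup>2) \<le> 8 * \<kappa> * (A\<^sup>2)\<^sup>2 / real n" .
  \<comment> \<open>Cauchy-Schwarz with weights \<open>sqrt (q j)\<close>, for which the factor with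
    \<open>u z\<close> is exactly the Euclidean norm of \<open>z\<close> over
    \<open>sqrt n\<close>.\<close>
  have "\<bar>\<Sum>j\<in>{0..d}. u z j * b j\<bar> \<le> (\<Sum>j\<in>{0..d}. \<bar>u z j / sqrt (q j)\<bar> * \<bar>sqrt (q j) * b j\<bar>)"
  proof (intro order_trans[OF sum_abs] sum_mono)
    fix j assume "j \<in> {0..d}"
    then have "0 < sqrt (q j)" using q_pos by simp
    then show "\<bar>u z j * b j\<bar> \<le> \<bar>u z j / sqrt (q j)\<bar> * \<bar>sqrt (q j) * b j\<bar>"
      by (simp add: abs_mult abs_divide)
  qed
  also have "\<dots> \<le> L2_set (\<lambda>j. u z j / sqrt (q j)) {0..d} * L2_set (\<lambda>j. sqrt (q j) * b j) {0..d}"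
    by (rule L2_set_mult_ineq)
  also have "L2_set (\<lambda>j. u z j / sqrt (q j)) {0..d} = sqrt (sq_norm d z / real n)"
  proof -
    have "(\<Sum>j\<in>{0..d}. (u z j / sqrt (q j))\<^sup>2) = (\<Sum>j\<in>{0..d}. (u z j)\<^sup>2 / q j)"
      using q_pos by (intro sum.cong) (auto simp: power_divide less_imp_le)
    then show ?thesis unfolding L2_set_def sum_u_sq[symmetric] by simp
  qed
  also have "L2_set (\<lambda>j. sqrt (q j) * b j) {0..d} = sqrt (\<Sum>j\<in>{0..d}. q j * (b j)\<^sup>2)"
    unfolding L2_set_def using q_pos by (intro arg_cong[where f=sqrt] sum.cong) (auto simp: power_mult_distrib less_imp_le)
  also have "sqrt (sq_norm d z / real n) * sqrt (\<Sum>j\<in>{0..d}. q j * (b j)\<^sup>2)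
      \<le> sqrt (sq_norm d z / real n) * sqrt (8 * \<kappa> * (A\<^sup>2)\<^sup>2 / real n)"
    by (intro mult_left_mono real_sqrt_le_mono sb) auto
  also have "\<dots> = sqrt (8 * \<kappa>) * A\<^sup>2 * sqrt (sq_norm d z) / real n"
    by (simp only: real_sqrt_mult real_sqrt_divide real_sqrt_abs) simp
  finally have "real n * \<bar>\<Sum>j\<in>{0..d}. u z j * b j\<bar> \<le> real n * (sqrt (8 * \<kappa>) * A\<^sup>2 * sqrt (sq_norm d z) / real n)"
    by (intro mult_left_mono) auto
  then have 1: "\<bar>real n * (\<Sum>j\<in>{0..d}. u z j * b j)\<bar> \<le> sqrt (8 * \<kappa>) * A\<^sup>2 * sqrt (sq_norm d z)"
    using n_pos by (simp add: abs_mult)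
  have "fisher_sq d p (V z) = sq_norm d z / real n"
    by (simp add: fisher_form_V sq_norm_def power2_eq_square)
  then have 2: "\<bar>\<Sum>j\<in>{1..d}. score (\<Phi> x) j * V z j\<bar> \<le> \<eta> * sqrt (sq_norm d z)"
    using score_bound[OF std_map_U_star[OF x], of "V z"] n_pos by (simp add: real_sqrt_divide)
  show ?thesis
    unfolding eq L_def using 1 2 abs_triangle_ineq[of "real n * (\<Sum>j\<in>{0..d}. u z j * b j)" "\<Sum>j\<in>{1..d}. score (\<Phi> x) j * V z j"]
    by (simp add: distrib_right)
qed

lemma likelihood_pos: "sq_norm d x \<le> A\<^sup>2 * real d \<Longrightarrow> 0 < likelihood x"
  unfolding likelihood_def by (intro mult_pos_pos prior_pos std_map_U_star) auto

lemma sqrt_d_le: "sqrt (real d) \<le> real d"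
  using d1 by (intro real_le_lsqrt) (auto simp: power2_eq_square)

text \<open>\<open>M0\<close> compares with the prior at the truth, while the normalizing constant
  involves its value near the MLE. Integrating the score along the segment between them bridges the
  two; the result is weakened from \<open>sqrt d\<close> to \<open>d\<close> to match the other
  exponents.\<close>

lemma prior_th_ge: "\<pi>0 p * exp (- (\<eta> * s * real d)) \<le> \<pi>0 th"
proof -
  define v where "v j = th j - p j" for j
  have pR: "p \<in> Rd d" using p by (simp add: Theta_def)
  have l1: "line d p v 1 = th"
    by (auto simp: line_def v_def th_def)
  have v: "fisher_sq d p v \<le> s\<^sup>2 * (real d / real n)"
  proof -
    have "fisher_sq d p v = (\<Sum>j\<in>{0..d}. (cell d th j - q j)\<^sup>2 / q j)"
      unfolding v_def fisher_form_cell_dir cell_diff by (simp add: power2_eq_square)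
    also have "\<dots> = (\<Sum>j\<in>{0..d}. (h j - q j)\<^sup>2 / q j)" by (intro sum.cong) (auto simp: cell_th)
    finally show ?thesis using chi_square by (simp add: h_def)
  qed
  have v': "sqrt (fisher_sq d p v) \<le> s * sqrt (real d / real n)"
  proof -
    have "sqrt (fisher_sq d p v) \<le> sqrt (s\<^sup>2 * (real d / real n))"
      by (rule real_sqrt_le_mono[OF v])
    also have "\<dots> = s * sqrt (real d / real n)" using s0 by (simp only: real_sqrt_mult real_sqrt_abs abs_of_nonneg)
    finally show ?thesis .
  qed
  have U: "line d p v t \<in> U_star n d p (2 * A)" if t: "0 \<le> t" "t \<le> 1" for t
  proof (rule U_starI)
    have "(\<Sum>j\<in>{0..d}. (cell d (line d p v t) j - q j)\<^sup>2 / q j) = (\<Sum>j\<in>{0..d}. t\<^sup>2 * ((cell_dir d v j)\<^sup>2 / q j))"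
      by (intro sum.cong) (auto simp: cell_line power_mult_distrib)
    also have "\<dots> = t\<^sup>2 * fisher_sq d p v"
      unfolding fisher_form_cell_dir sum_distrib_left by (intro sum.cong) (auto simp: power2_eq_square)
    also have "\<dots> \<le> 1 * (s\<^sup>2 * (real d / real n))"
      using v t q_pos by (intro mult_mono) (auto simp: power_le_one fisher_form_cell_dir intro!: sum_nonneg divide_nonneg_pos)
    also have "\<dots> \<le> 4 * A\<^sup>2 * (real d / real n)"
    proof -
      have "s\<^sup>2 \<le> 4 * A\<^sup>2" using power_mono[OF sA s0, of 2] zero_le_power2[of A] by linarith
      then show ?thesis unfolding mult_1 by (intro mult_right_mono) auto
    qed
    finally show "(\<Sum>j\<in>{0..d}. (cell d (line d p v t) j - q j)\<^sup>2 / q j) \<le> 4 * A\<^sup>2 * real d / real n" by simp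
  qed (rule line_Rd)
  have "\<pi>0 (line d p v 0) * exp (- (\<eta> * sqrt (real n) * (s * sqrt (real d / real n)))) \<le> \<pi>0 (line d p v 1)"
  proof (rule pos_log_derivative_lower_bound)
    fix t :: real assume t: "0 \<le> t" "t \<le> 1"
    show "0 < \<pi>0 (line d p v t)" by (rule prior_pos[OF U[OF t]])
    show "((\<lambda>t. \<pi>0 (line d p v t)) has_real_derivative \<pi>0 (line d p v t) * (\<Sum>j\<in>{1..d}. score (line d p v t) j * v j)) (at t)"
      by (rule has_derivative_line_pos[OF prior_C1 U[OF t] prior_pos[OF U[OF t]]])
    show "\<bar>\<Sum>j\<in>{1..d}. score (line d p v t) j * v j\<bar> \<le> \<eta> * sqrt (real n) * (s * sqrt (real d / real n))"
      using v' eta0 by (intro order_trans[OF score_bound[OF U[OF t]]] mult_left_mono) auto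
  qed
  moreover have "\<eta> * sqrt (real n) * (s * sqrt (real d / real n)) = \<eta> * s * sqrt (real d)"
    using n_pos by (simp add: real_sqrt_divide)
  moreover have "\<pi>0 p * exp (- (\<eta> * s * real d)) \<le> \<pi>0 p * exp (- (\<eta> * s * sqrt (real d)))"
    using eta0 s0 sqrt_d_le prior p by (intro mult_left_mono) (auto simp: prior_density_def mult_left_mono less_imp_le)
  ultimately show ?thesis by (simp add: line_0[OF pR] l1)
qed

text \<open>Along the ray from the MLE the logarithm falls by at most
  \<open>L * sqrt (2 * d)\<close>. Together with the loss of the prior between truth and MLE this is
  at most \<open>d\<close>, by \<open>L_small'\<close>.\<close>

lemma likelihood_lower:
  assumes xR: "x \<in> Rd d" and x: "sq_norm d x \<le> 2 * real d"
  shows "exp (- real n * nll n d N th) * \<pi>0 p * exp (- real d) \<le> likelihood x"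
proof -
  \<comment> \<open>The origin as an element of \<open>Rd d\<close>, hence \<open>undefined\<close>
    outside \<open>{1..d}\<close>; \<open>\<Phi>\<close> sends it to the MLE.\<close>
  define o' where "o' = (\<lambda>_\<in>{1..d}. 0 :: real)"
  have line: "line d o' x t = (\<lambda>k\<in>{1..d}. t * x k)" for t by (auto simp: line_def o'_def)
  have l0: "line d o' x 0 = o'" by (auto simp: line_def o'_def)
  have l1: "line d o' x 1 = x" unfolding line using xR by (auto simp: restrict_def extensional_def)
  have "2 \<le> A\<^sup>2" using R16 RA power_mono[of 16 A 2] by simp
  then have A2: "2 * real d \<le> A\<^sup>2 * real d" by (intro mult_right_mono) auto
  have sq: "sq_norm d (line d o' x t) \<le> A\<^sup>2 * real d" if t: "0 \<le> t" "t \<le> 1" for t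
  proof -
    have "sq_norm d (line d o' x t) = t\<^sup>2 * sq_norm d x"
      unfolding line sq_norm_def sum_distrib_left by (intro sum.cong) (auto simp: power_mult_distrib)
    also have "\<dots> \<le> 1 * (2 * real d)" using t x by (intro mult_mono) (auto simp: power_le_one)
    finally show ?thesis using A2 by simp
  qed
  have "likelihood (line d o' x 0) * exp (- (L * sqrt (2 * real d))) \<le> likelihood (line d o' x 1)"
  proof (rule pos_log_derivative_lower_bound)
    fix t :: real assume t: "0 \<le> t" "t \<le> 1"
    show "0 < likelihood (line d o' x t)" by (rule likelihood_pos[OF sq[OF t]])
    show "((\<lambda>t. likelihood (line d o' x t)) has_real_derivative likelihood (line d o' x t) * dlog (line d o' x t) x) (at t)"
      by (rule likelihood_derivative[OF sq[OF t]])
    show "\<bar>dlog (line d o' x t) x\<bar> \<le> L * sqrt (2 * real d)"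
      using L_nonneg x by (intro order_trans[OF dlog_bound[OF sq[OF t]]] mult_left_mono) auto
  qed
  then have 1: "likelihood o' * exp (- (L * sqrt (2 * real d))) \<le> likelihood x" by (simp add: l0 l1)
  have \<Phi>o: "\<Phi> o' = th"
    by (auto simp: std_map_def o'_def chol_map_def th_def)
  have lo: "likelihood o' = exp (- real n * nll n d N th) * \<pi>0 th"
    unfolding likelihood_def \<Phi>o by (simp add: sq_norm_def o'_def)
  have "sqrt (2 * real d) \<le> 2 * real d"
    using d1 by (intro real_le_lsqrt) (auto simp: power2_eq_square)
  then have "L * sqrt (2 * real d) \<le> L * (2 * real d)" using L_nonneg by (rule mult_left_mono)
  then have "\<eta> * s * real d + L * sqrt (2 * real d) \<le> (\<eta> * s + 2 * L) * real d" by (simp add: algebra_simps)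
  also have "\<dots> \<le> 1 * real d" using L_small' by (rule mult_right_mono) simp
  finally have "exp (- real d) \<le> exp (- (\<eta> * s * real d)) * exp (- (L * sqrt (2 * real d)))"
    by (simp add: exp_add[symmetric])
  then have "exp (- real n * nll n d N th) * \<pi>0 p * exp (- real d)
      \<le> exp (- real n * nll n d N th) * \<pi>0 p * (exp (- (\<eta> * s * real d)) * exp (- (L * sqrt (2 * real d))))"
    using prior p by (intro mult_left_mono) (auto simp: prior_density_def less_imp_le)
  also have "\<dots> = exp (- real n * nll n d N th) * (\<pi>0 p * exp (- (\<eta> * s * real d))) * exp (- (L * sqrt (2 * real d)))"
    by (simp add: mult_ac)
  also have "\<dots> \<le> exp (- real n * nll n d N th) * \<pi>0 th * exp (- (L * sqrt (2 * real d)))"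
    by (intro mult_right_mono mult_left_mono prior_th_ge) auto
  also have "\<dots> \<le> likelihood x" using 1 by (simp add: lo)
  finally show ?thesis .
qed

text \<open>The linear growth \<open>R * sqrt d * r / 8\<close> is split into halves. One half
  supplies \<open>R^2 * d / 16\<close> because \<open>r > R * sqrt d\<close>; the other dominates
  \<open>R / 16\<close> times the sum of absolute values by Cauchy-Schwarz, which gives an integrand
  that factorizes.\<close>

lemma likelihood_tail:
  assumes x: "R\<^sup>2 * real d < sq_norm d x" and \<theta>: "\<Phi> x \<in> Theta d"
  shows "likelihood x \<le> exp (- real n * nll n d N th) * \<pi>0 p * exp ((C - R\<^sup>2 / 16) * real d)
     * exp (sq_norm d x / 2 - R / 16 * (\<Sum>i\<in>{1..d}. \<bar>x i\<bar>))"
proof -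
  have R0: "0 < R" using R16 by simp
  define r where "r = sqrt (sq_norm d x)"
  have "R * sqrt (real d) \<le> r"
    using real_sqrt_le_mono[OF less_imp_le[OF x]] R0 by (simp add: r_def real_sqrt_mult)
  then have "R * sqrt (real d) * (R * sqrt (real d)) \<le> R * sqrt (real d) * r"
    using R0 by (intro mult_left_mono) auto
  then have 1: "R\<^sup>2 * real d \<le> R * (sqrt (real d) * r)" by (simp add: power2_eq_square mult_ac)
  have "(\<Sum>i\<in>{1..d}. \<bar>1\<bar> * \<bar>x i\<bar>) \<le> L2_set (\<lambda>i. 1) {1..d} * L2_set x {1..d}"
    by (rule L2_set_mult_ineq)
  also have "\<dots> = sqrt (real d) * r" by (simp add: L2_set_def r_def sq_norm_def)
  finally have 2: "R * (\<Sum>i\<in>{1..d}. \<bar>x i\<bar>) \<le> R * (sqrt (real d) * r)"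
    using R0 by (intro mult_left_mono) auto
  have "R * sqrt (real d) * r / 8 \<le> real n * (nll n d N (\<Phi> x) - nll n d N th)"
    unfolding r_def by (rule nll_global_linear[OF x R0 RA \<theta>])
  then have 3: "- real n * nll n d N (\<Phi> x) \<le> - real n * nll n d N th - R\<^sup>2 / 16 * real d - R / 16 * (\<Sum>i\<in>{1..d}. \<bar>x i\<bar>)"
    using 1 2 by (simp add: algebra_simps)
  have pp: "0 < \<pi>0 (\<Phi> x)" "0 < \<pi>0 p" using \<theta> p prior by (auto simp: prior_density_def)
  have "likelihood x \<le> exp (sq_norm d x / 2) * (exp (- real n * nll n d N th - R\<^sup>2 / 16 * real d - R / 16 * (\<Sum>i\<in>{1..d}. \<bar>x i\<bar>)) * (\<pi>0 p * exp (C * real d)))"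
    unfolding likelihood_def using 3 prior_bound[OF \<theta>] pp by (intro mult_left_mono mult_mono) auto
  also have "\<dots> = exp (- real n * nll n d N th) * \<pi>0 p * exp ((C - R\<^sup>2 / 16) * real d)
     * exp (sq_norm d x / 2 - R / 16 * (\<Sum>i\<in>{1..d}. \<bar>x i\<bar>))"
  proof -
    have e1: "exp a * (exp b * (\<pi>0 p * exp c)) = \<pi>0 p * exp (a + b + c)" for a b c :: real
      by (simp add: exp_add)
    have e2: "exp a * \<pi>0 p * exp b * exp c = \<pi>0 p * exp (a + b + c)" for a b c :: real
      by (simp add: exp_add)
    show ?thesis unfolding e1 e2 by (simp add: left_diff_distrib)
  qed
  finally show ?thesis .
qed

section \<open>Normalizing constant and density of the posterior relative to the Gaussian\<close>

definition unnorm :: "(nat \<Rightarrow> real) \<Rightarrow> real" where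
  "unnorm \<theta> = indicator (Theta d) \<theta> * (exp (- real n * nll n d N \<theta>) * \<pi>0 \<theta>)"

definition Z :: real where "Z = (\<integral>\<theta>. unnorm \<theta> \<partial>lebesgue_Rd d)"

lemma posterior_eq: "posterior n d \<pi>0 N = density (lebesgue_Rd d) (\<lambda>\<theta>. ennreal (unnorm \<theta> / Z))"
  by (simp add: posterior_def Let_def unnorm_def Z_def)

lemma coord_measurable: "i \<in> {1..d} \<Longrightarrow> (\<lambda>x. x i) \<in> borel_measurable (lebesgue_Rd d)"
  unfolding lebesgue_Rd_def using measurable_component_singleton[of i "{1..d}" "\<lambda>_. lborel :: real measure"] by simp

lemma cell_measurable: "j \<le> d \<Longrightarrow> (\<lambda>\<theta>. cell d \<theta> j) \<in> borel_measurable (lebesgue_Rd d)"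
  using coord_measurable[of j] by (cases "j = 0") (auto simp: cell_def intro!: borel_measurable_diff borel_measurable_sum coord_measurable)

lemma unnorm_measurable [measurable]: "unnorm \<in> borel_measurable (lebesgue_Rd d)"
proof -
  have [measurable]: "\<pi>0 \<in> borel_measurable (lebesgue_Rd d)" using prior by (simp add: prior_density_def)
  have [measurable]: "(\<lambda>\<theta>. nll n d N \<theta>) \<in> borel_measurable (lebesgue_Rd d)"
    unfolding nll_eq by (intro borel_measurable_uminus borel_measurable_sum borel_measurable_times borel_measurable_const
        borel_measurable_ln cell_measurable) auto
  have "{\<theta> \<in> space (lebesgue_Rd d). \<forall>j\<in>{0..d}. 0 < cell d \<theta> j} \<in> sets (lebesgue_Rd d)"
  proof (intro sets.sets_Collect_finite_All')
    show "{\<theta> \<in> space (lebesgue_Rd d). 0 < cell d \<theta> j} \<in> sets (lebesgue_Rd d)" if "j \<in> {0..d}" for j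
    proof -
      have [measurable]: "(\<lambda>\<theta>. cell d \<theta> j) \<in> borel_measurable (lebesgue_Rd d)" using that by (intro cell_measurable) auto
      show ?thesis by measurable
    qed
  qed auto
  also have "{\<theta> \<in> space (lebesgue_Rd d). \<forall>j\<in>{0..d}. 0 < cell d \<theta> j} = Theta d"
    by (simp only: set_eq_iff mem_Collect_eq Theta_iff_cells space_lebesgue_Rd) blast
  finally have [measurable]: "Theta d \<in> sets (lebesgue_Rd d)" .
  show ?thesis unfolding unnorm_def by measurable
qed

lemma unnorm_nonneg: "0 \<le> unnorm \<theta>"
  using prior by (cases "\<theta> \<in> Theta d") (auto simp: unnorm_def prior_density_def less_imp_le)

text \<open>All cells are at most 1, hence so is the likelihood. Domination by the prior makes the
  numerator integrable, so that \<open>Z\<close> is the true integral and not the default 0.\<close>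

lemma unnorm_le_prior: "\<theta> \<in> Rd d \<Longrightarrow> unnorm \<theta> \<le> \<pi>0 \<theta>"
proof (cases "\<theta> \<in> Theta d")
  case True
  have "ln (cell d \<theta> j) \<le> 0" if "j \<in> {0..d}" for j
  proof -
    have "cell d \<theta> j \<le> (\<Sum>j\<in>{0..d}. cell d \<theta> j)"
      using that cell_pos[OF True] by (intro member_le_sum) (auto intro: less_imp_le)
    then show ?thesis using cell_pos[OF True, of j] that by (simp add: sum_cell)
  qed
  then have "(\<Sum>j\<in>{0..d}. h j * ln (cell d \<theta> j)) \<le> 0"
    using h_pos by (intro sum_nonpos mult_nonneg_nonpos) (auto intro: less_imp_le)
  then have "- real n * nll n d N \<theta> \<le> 0" by (simp add: nll_eq mult_nonneg_nonpos)
  then have "exp (- real n * nll n d N \<theta>) * \<pi>0 \<theta> \<le> 1 * \<pi>0 \<theta>"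
    using prior True by (intro mult_right_mono) (auto simp: prior_density_def less_imp_le)
  then show ?thesis using True by (simp add: unnorm_def)
next
  case False
  assume "\<theta> \<in> Rd d"
  then show ?thesis using False prior by (simp add: unnorm_def prior_density_def)
qed

lemma unnorm_nn_integral: "(\<integral>\<^sup>+ \<theta>. ennreal (unnorm \<theta>) \<partial>lebesgue_Rd d) = ennreal Z"
proof -
  have "(\<integral>\<^sup>+ \<theta>. ennreal (unnorm \<theta>) \<partial>lebesgue_Rd d) \<le> (\<integral>\<^sup>+ \<theta>. ennreal (\<pi>0 \<theta>) \<partial>lebesgue_Rd d)"
    by (intro nn_integral_mono ennreal_leI unnorm_le_prior) simp
  also have "\<dots> = 1" using prior by (simp add: prior_density_def)
  finally have le: "(\<integral>\<^sup>+ \<theta>. ennreal (unnorm \<theta>) \<partial>lebesgue_Rd d) \<le> 1" .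
  have "integrable (lebesgue_Rd d) unnorm"
    using le_less_trans[OF le] unnorm_nonneg by (intro integrableI_nonneg) auto
  then show ?thesis unfolding Z_def using unnorm_nonneg by (intro nn_integral_eq_integral) auto
qed

text \<open>The global version of \<open>likelihood\<close>: it vanishes outside the parameter
  space, where \<open>likelihood\<close> carries no meaning for the posterior.\<close>

definition W :: "(nat \<Rightarrow> real) \<Rightarrow> real" where
  "W x = exp (sq_norm d x / 2) * unnorm (\<Phi> x)"

abbreviation "G \<equiv> stdN_prod {1..d}"
abbreviation "gc \<equiv> gauss_const d p n"

lemma gc_pos: "0 < gc" using gauss_const_pos[OF p n_pos] .

lemma W_nonneg: "0 \<le> W x" using unnorm_nonneg by (simp add: W_def)

lemma W_eq_likelihood: "\<Phi> x \<in> Theta d \<Longrightarrow> W x = likelihood x"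
  by (simp add: W_def likelihood_def unnorm_def)

lemma W_eq_0: "\<Phi> x \<notin> Theta d \<Longrightarrow> W x = 0"
  by (simp add: W_def unnorm_def)

lemma measurable_G: "f \<in> borel_measurable (lebesgue_Rd d) \<Longrightarrow> f \<in> borel_measurable G"
  using measurable_cong_sets[OF sets_stdN_prod_eq refl] by blast

lemma sq_norm_measurable: "sq_norm d \<in> borel_measurable (lebesgue_Rd d)"
  unfolding sq_norm_def by (intro borel_measurable_sum borel_measurable_power coord_measurable)

lemma W_measurable [measurable]: "W \<in> borel_measurable G"
proof -
  have "(\<lambda>x. unnorm (\<Phi> x)) \<in> borel_measurable (lebesgue_Rd d)"
    by (rule measurable_compose[OF std_map_measurable unnorm_measurable])
  then have "W \<in> borel_measurable (lebesgue_Rd d)"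
    unfolding W_def
    by (intro borel_measurable_times measurable_compose[OF _ borel_measurable_exp] borel_measurable_divide
        sq_norm_measurable borel_measurable_const)
  then show ?thesis by (rule measurable_G)
qed

lemma Z_eq: "ennreal Z = ennreal gc * (\<integral>\<^sup>+ x. ennreal (W x) \<partial>G)"
proof -
  have "ennreal Z = (\<integral>\<^sup>+ x. ennreal (gc * exp ((\<Sum>i\<in>{1..d}. (x i)\<^sup>2) / 2)) * ennreal (unnorm (\<Phi> x)) \<partial>G)"
    unfolding unnorm_nn_integral[symmetric] by (rule nn_integral_lebesgue_Rd_std[OF p n_pos]) measurable
  also have "\<dots> = (\<integral>\<^sup>+ x. ennreal gc * ennreal (W x) \<partial>G)"
    using gc_pos unnorm_nonneg by (intro nn_integral_cong) (simp add: W_def sq_norm_def ennreal_mult[symmetric] mult.assoc)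
  also have "\<dots> = ennreal gc * (\<integral>\<^sup>+ x. ennreal (W x) \<partial>G)" by (rule nn_integral_cmult) measurable
  finally show ?thesis .
qed

definition K0 :: real where "K0 = exp (- real n * nll n d N th) * \<pi>0 p"

lemma prior_p_pos: "0 < \<pi>0 p" using prior p by (simp add: prior_density_def)

lemma K0_pos: "0 < K0" using prior_p_pos by (simp add: K0_def)

lemma two_le_A_sq: "2 * real d \<le> A\<^sup>2 * real d"
proof -
  have "2 \<le> A\<^sup>2" using R16 RA power_mono[of 16 A 2] by simp
  then show ?thesis by (intro mult_right_mono) auto
qed

text \<open>The integrand is at least \<open>K0 * exp (- d)\<close> on a ball of Gaussian
  probability at least one half.\<close>

lemma Z_lower: "gc * (K0 * exp (- real d) / 2) \<le> Z"
proof -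
  let ?B = "{x \<in> extensional {1..d}. (\<Sum>i\<in>{1..d}. (x i)\<^sup>2) \<le> 2 * real (card {1..d})}"
  have sq: "sq_norm d \<in> borel_measurable G" by (rule measurable_G[OF sq_norm_measurable])
  have "?B = {x \<in> space G. sq_norm d x \<le> 2 * real d}" by (simp add: sq_norm_def)
  also have "\<dots> \<in> sets G" using sq by measurable
  finally have B: "?B \<in> sets G" .
  have "ennreal (K0 * exp (- real d)) * (1 / 2) \<le> ennreal (K0 * exp (- real d)) * emeasure G ?B"
    using d1 by (intro mult_left_mono stdN_prod_ball_half) auto
  also have "\<dots> = (\<integral>\<^sup>+ x. ennreal (K0 * exp (- real d)) * indicator ?B x \<partial>G)"
    using B by (rule nn_integral_cmult_indicator[symmetric])
  also have "\<dots> \<le> (\<integral>\<^sup>+ x. ennreal (W x) \<partial>G)"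
  proof (intro nn_integral_mono)
    fix x
    show "ennreal (K0 * exp (- real d)) * indicator ?B x \<le> ennreal (W x)"
    proof (cases "x \<in> ?B")
      case True
      then have x: "x \<in> Rd d" "sq_norm d x \<le> 2 * real d" by (auto simp: sq_norm_def)
      have "W x = likelihood x"
        using x two_le_A_sq by (intro W_eq_likelihood std_map_Theta) simp
      then show ?thesis using likelihood_lower[OF x] True by (simp add: K0_def ennreal_leI)
    qed simp
  qed
  finally have "ennreal gc * (ennreal (K0 * exp (- real d)) * (1 / 2)) \<le> ennreal Z"
    unfolding Z_eq by (intro mult_left_mono) auto
  moreover have "ennreal gc * (ennreal (K0 * exp (- real d)) * (1 / 2)) = ennreal (gc * (K0 * exp (- real d) / 2))"
  proof -
    have "(1 / 2 :: ennreal) = ennreal (1 / 2)" by (simp add: divide_ennreal_def)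
    then show ?thesis using gc_pos K0_pos by (simp only: ennreal_mult[symmetric] less_imp_le mult_nonneg_nonneg exp_ge_zero) (simp add: ennreal_mult[symmetric])
  qed
  ultimately have "ennreal (gc * (K0 * exp (- real d) / 2)) \<le> ennreal Z" by simp
  \<comment> \<open>Positivity of the left side is what allows the return from
    \<open>ennreal\<close>, where a negative \<open>Z\<close> would be truncated to 0.\<close>
  moreover have "0 < gc * (K0 * exp (- real d) / 2)" using gc_pos K0_pos by simp
  ultimately show ?thesis by (metis ennreal_le_iff2 not_le order_less_imp_le)
qed

lemma Z_pos: "0 < Z"
  using gc_pos K0_pos by (intro less_le_trans[OF _ Z_lower]) simp

definition \<rho> :: "(nat \<Rightarrow> real) \<Rightarrow> real" where "\<rho> x = gc / Z * W x"

text \<open>Bounds the posterior mass outside the ball of radius \<open>R * sqrt d\<close>: the 2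
  and the summand 1 are the price of dividing by the lower bound for \<open>Z\<close>.\<close>

definition \<tau> :: real where "\<tau> = 2 * exp (C + 1 - R\<^sup>2 / 16)"

lemma rho_nonneg: "0 \<le> \<rho> x"
  using gc_pos Z_pos W_nonneg by (simp add: \<rho>_def)

lemma rho_measurable [measurable]: "\<rho> \<in> borel_measurable G"
  unfolding \<rho>_def by measurable

lemma rho_nn_integral: "(\<integral>\<^sup>+ x. ennreal (\<rho> x) \<partial>G) = 1"
proof -
  have "(\<integral>\<^sup>+ x. ennreal (\<rho> x) \<partial>G) = (\<integral>\<^sup>+ x. ennreal (1 / Z) * (ennreal gc * ennreal (W x)) \<partial>G)"
    using gc_pos Z_pos W_nonneg by (intro nn_integral_cong) (simp add: \<rho>_def ennreal_mult[symmetric])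
  also have "\<dots> = ennreal (1 / Z) * (\<integral>\<^sup>+ x. ennreal gc * ennreal (W x) \<partial>G)"
    by (rule nn_integral_cmult) measurable
  also have "(\<integral>\<^sup>+ x. ennreal gc * ennreal (W x) \<partial>G) = ennreal Z"
    unfolding Z_eq by (rule nn_integral_cmult) measurable
  also have "ennreal (1 / Z) * ennreal Z = 1" using Z_pos by (subst ennreal_mult[symmetric]) auto
  finally show ?thesis .
qed

lemma rho_tail: "(\<integral>\<^sup>+ x. ennreal (\<rho> x) * indicator {x. R\<^sup>2 * real d < (\<Sum>i\<in>{1..d}. (x i)\<^sup>2)} x \<partial>G) \<le> ennreal \<tau>"
proof -
  define c where "c = gc / Z * (K0 * exp ((C - R\<^sup>2 / 16) * real d))"
  have c0: "0 \<le> c" using gc_pos Z_pos K0_pos by (simp add: c_def)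
  have "(\<integral>\<^sup>+ x. ennreal (\<rho> x) * indicator {x. R\<^sup>2 * real d < (\<Sum>i\<in>{1..d}. (x i)\<^sup>2)} x \<partial>G)
      \<le> (\<integral>\<^sup>+ x. ennreal c * ennreal (exp ((\<Sum>i\<in>{1..d}. (x i)\<^sup>2) / 2 - R / 16 * (\<Sum>i\<in>{1..d}. \<bar>x i\<bar>))) \<partial>G)"
  proof (intro nn_integral_mono)
    fix x :: "nat \<Rightarrow> real"
    show "ennreal (\<rho> x) * indicator {x. R\<^sup>2 * real d < (\<Sum>i\<in>{1..d}. (x i)\<^sup>2)} x
        \<le> ennreal c * ennreal (exp ((\<Sum>i\<in>{1..d}. (x i)\<^sup>2) / 2 - R / 16 * (\<Sum>i\<in>{1..d}. \<bar>x i\<bar>)))"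
    proof (cases "R\<^sup>2 * real d < sq_norm d x \<and> \<Phi> x \<in> Theta d")
      case True
      have "gc / Z * W x \<le> gc / Z * (K0 * exp ((C - R\<^sup>2 / 16) * real d)
          * exp (sq_norm d x / 2 - R / 16 * (\<Sum>i\<in>{1..d}. \<bar>x i\<bar>)))"
        using likelihood_tail[of x] True gc_pos Z_pos
        by (intro mult_left_mono) (auto simp: W_eq_likelihood K0_def)
      then have "\<rho> x \<le> c * exp ((\<Sum>i\<in>{1..d}. (x i)\<^sup>2) / 2 - R / 16 * (\<Sum>i\<in>{1..d}. \<bar>x i\<bar>))"
        by (simp add: \<rho>_def c_def sq_norm_def mult.assoc)
      then show ?thesis using True c0
        by (simp add: sq_norm_def ennreal_mult[symmetric] ennreal_leI)
    next
      case False
      then show ?thesis by (auto simp: sq_norm_def \<rho>_def W_eq_0 split: split_indicator)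
    qed
  qed
  also have "\<dots> = ennreal c * (\<integral>\<^sup>+ x. ennreal (exp ((\<Sum>i\<in>{1..d}. (x i)\<^sup>2) / 2 - R / 16 * (\<Sum>i\<in>{1..d}. \<bar>x i\<bar>))) \<partial>G)"
  proof (rule nn_integral_cmult)
    have "(\<lambda>x. exp ((\<Sum>i\<in>{1..d}. (x i)\<^sup>2) / 2 - R / 16 * (\<Sum>i\<in>{1..d}. \<bar>x i\<bar>))) \<in> borel_measurable (lebesgue_Rd d)"
      by (intro measurable_compose[OF _ borel_measurable_exp] borel_measurable_diff borel_measurable_divide
          borel_measurable_sum borel_measurable_power borel_measurable_times borel_measurable_const borel_measurable_abs coord_measurable)
    from measurable_G[OF this]
    show "(\<lambda>x. ennreal (exp ((\<Sum>i\<in>{1..d}. (x i)\<^sup>2) / 2 - R / 16 * (\<Sum>i\<in>{1..d}. \<bar>x i\<bar>)))) \<in> borel_measurable G"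
      by measurable
  qed
  also have "\<dots> \<le> ennreal c * 1"
    using R16 by (intro mult_left_mono nn_integral_stdN_prod_exp_abs) auto
  also have "\<dots> \<le> ennreal \<tau>"
  proof -
    \<comment> \<open>The bracket \<open>C + 1 - R^2 / 16\<close> is nonpositive by
      \<open>CR\<close>, so dropping its factor \<open>d \<ge> 1\<close> only increases it.\<close>
    have e: "(C - R\<^sup>2 / 16) * real d \<le> - real d + (C + 1 - R\<^sup>2 / 16)"
    proof -
      have "(C + 1 - R\<^sup>2 / 16) * real d \<le> (C + 1 - R\<^sup>2 / 16) * 1"
        using CR d1 by (intro mult_left_mono_neg) auto
      then show ?thesis by (simp add: algebra_simps)
    qed
    have "c \<le> gc / (gc * (K0 * exp (- real d) / 2)) * (K0 * exp (- real d + (C + 1 - R\<^sup>2 / 16)))"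
      unfolding c_def using Z_lower Z_pos gc_pos K0_pos e
      by (intro mult_mono divide_left_mono mult_pos_pos) auto
    also have "\<dots> = \<tau>"
      using gc_pos K0_pos unfolding exp_add \<tau>_def by (simp add: field_simps)
    finally show ?thesis by (simp add: ennreal_leI)
  qed
  finally show ?thesis .
qed

section \<open>Gradient bound and total variation\<close>

definition unit_dir :: "nat \<Rightarrow> nat \<Rightarrow> real" where "unit_dir i = (\<lambda>k. if k = i then 1 else 0)"

lemma fun_upd_eq_line: "x \<in> Rd d \<Longrightarrow> i \<in> {1..d} \<Longrightarrow> x(i := t) = line d x (unit_dir i) (t - x i)"
  by (auto simp: line_def unit_dir_def extensional_def fun_eq_iff)

lemma rho_derivative:
  assumes i: "i \<in> {1..d}" and xR: "x \<in> Rd d" and x: "sq_norm d x \<le> A\<^sup>2 * real d"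
  shows "((\<lambda>t. \<rho> (x(i := t))) has_real_derivative \<rho> x * dlog x (unit_dir i)) (at (x i))"
proof -
  let ?z = "unit_dir i"
  \<comment> \<open>An open set of \<open>t\<close> for which the moved point stays in the parameter
    space, so that \<open>W\<close> may be replaced by the differentiable \<open>likelihood\<close>
    near \<open>x i\<close>.\<close>
  define U where "U = {t. \<forall>j\<in>{0..d}. 0 < cell d (\<Phi> x) j + (t - x i) * u ?z j}"
  have "U = (\<Inter>j\<in>{0..d}. {t. 0 < cell d (\<Phi> x) j + (t - x i) * u ?z j})" by (auto simp: U_def)
  also have "open \<dots>" by (intro open_INT ballI open_Collect_less continuous_intros) auto
  finally have opU: "open U" .
  have xU: "x i \<in> U" using cell_near(3)[OF x] by (simp add: U_def)
  have l0: "line d x ?z 0 = x" by (rule line_0[OF xR])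
  have "((\<lambda>t. likelihood (line d x ?z t)) has_real_derivative likelihood x * dlog x ?z) (at 0)"
    using likelihood_derivative[of x ?z 0] x by (simp add: l0)
  then have "((\<lambda>t. likelihood (line d x ?z (t + - x i))) has_real_derivative likelihood x * dlog x ?z) (at (x i))"
    using DERIV_shift[of "\<lambda>t. likelihood (line d x ?z t)" _ "x i" "- x i"] by simp
  from DERIV_cmult[OF this, of "gc / Z"]
  have "((\<lambda>t. gc / Z * likelihood (line d x ?z (t - x i))) has_real_derivative \<rho> x * dlog x ?z) (at (x i))"
    using std_map_Theta[OF x] by (simp add: \<rho>_def W_eq_likelihood mult.assoc)
  then show ?thesis
  proof (rule has_field_derivative_transform_within_open[OF _ opU xU])
    fix t assume t: "t \<in> U"
    have "cell d (\<Phi> (line d x ?z (t - x i))) j = cell d (\<Phi> x) j + (t - x i) * u ?z j" if "j \<le> d" for j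
      using that by (simp add: std_map_line cell_line)
    then have "\<Phi> (line d x ?z (t - x i)) \<in> Theta d"
      using t unfolding Theta_iff_cells U_def by (intro conjI std_map_Rd) auto
    then show "gc / Z * likelihood (line d x ?z (t - x i)) = \<rho> (x(i := t))"
      by (simp add: \<rho>_def W_eq_likelihood fun_upd_eq_line[OF xR i])
  qed
qed

text \<open>Linearity in the direction, needed to pass from directional bounds to the Euclidean norm
  of the gradient.\<close>

lemma dlog_sum:
  "dlog x z = (\<Sum>i\<in>{1..d}. z i * dlog x (unit_dir i))"
proof -
  have Vz: "V z k = (\<Sum>i\<in>{1..d}. z i * V (unit_dir i) k)" if k: "k \<in> {1..d}" for k
  proof -
    have "chol_map p z k = chol_map p (\<lambda>k. \<Sum>i\<in>{1..d}. z i * unit_dir i k) k"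
      using k by (intro chol_map_cong) (auto simp: unit_dir_def if_distrib[of "\<lambda>a. _ * a"] cong: if_cong)
    also have "\<dots> = (\<Sum>i\<in>{1..d}. z i * chol_map p (unit_dir i) k)" by (rule chol_map_sum)
    finally show ?thesis by (simp add: V_def sum_divide_distrib)
  qed
  have uz: "u z j = (\<Sum>i\<in>{1..d}. z i * u (unit_dir i) j)" if j: "j \<le> d" for j
  proof (cases "j = 0")
    case True
    have "(\<Sum>k\<in>{1..d}. V z k) = (\<Sum>k\<in>{1..d}. \<Sum>i\<in>{1..d}. z i * V (unit_dir i) k)" by (intro sum.cong Vz) auto
    also have "\<dots> = (\<Sum>i\<in>{1..d}. \<Sum>k\<in>{1..d}. z i * V (unit_dir i) k)" by (rule sum.swap)
    finally show ?thesis using True by (simp add: cell_dir_def sum_negf sum_distrib_left)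
  next
    case False
    then show ?thesis using Vz[of j] j by (simp add: cell_dir_def)
  qed
  have 1: "(\<Sum>i\<in>{1..d}. x i * z i) = (\<Sum>i\<in>{1..d}. z i * (\<Sum>k\<in>{1..d}. x k * unit_dir i k))"
    by (intro sum.cong) (auto simp: unit_dir_def if_distrib[of "\<lambda>a. _ * a"] cong: if_cong)
  have 2: "(\<Sum>j\<in>{0..d}. h j * u z j / cell d (\<Phi> x) j) = (\<Sum>i\<in>{1..d}. z i * (\<Sum>j\<in>{0..d}. h j * u (unit_dir i) j / cell d (\<Phi> x) j))"
  proof -
    have "(\<Sum>j\<in>{0..d}. h j * u z j / cell d (\<Phi> x) j) = (\<Sum>j\<in>{0..d}. \<Sum>i\<in>{1..d}. z i * (h j * u (unit_dir i) j / cell d (\<Phi> x) j))"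
      by (intro sum.cong) (auto simp: uz sum_distrib_left sum_divide_distrib mult_ac)
    also have "\<dots> = (\<Sum>i\<in>{1..d}. \<Sum>j\<in>{0..d}. z i * (h j * u (unit_dir i) j / cell d (\<Phi> x) j))" by (rule sum.swap)
    finally show ?thesis by (simp only: sum_distrib_left)
  qed
  have 3: "(\<Sum>j\<in>{1..d}. score (\<Phi> x) j * V z j) = (\<Sum>i\<in>{1..d}. z i * (\<Sum>j\<in>{1..d}. score (\<Phi> x) j * V (unit_dir i) j))"
  proof -
    have "(\<Sum>j\<in>{1..d}. score (\<Phi> x) j * V z j) = (\<Sum>j\<in>{1..d}. \<Sum>i\<in>{1..d}. z i * (score (\<Phi> x) j * V (unit_dir i) j))"
      by (intro sum.cong) (auto simp: Vz sum_distrib_left mult_ac)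
    also have "\<dots> = (\<Sum>i\<in>{1..d}. \<Sum>j\<in>{1..d}. z i * (score (\<Phi> x) j * V (unit_dir i) j))" by (rule sum.swap)
    finally show ?thesis by (simp only: sum_distrib_left)
  qed
  show ?thesis
    unfolding dlog_def 1 2 3 distrib_left sum.distrib by (simp only: sum_distrib_left mult.left_commute)
qed

text \<open>Take the gradient itself as direction: its squared norm is then a directional
  derivative, at most \<open>L\<close> times its norm.\<close>

lemma rho_grad:
  assumes x: "sq_norm d x \<le> A\<^sup>2 * real d"
  shows "(\<Sum>i\<in>{1..d}. (dlog x (unit_dir i))\<^sup>2) \<le> L\<^sup>2"
proof -
  define D where "D i = dlog x (unit_dir i)" for i
  define g where "g = sqrt (sq_norm d D)"
  have g: "0 \<le> g" "g\<^sup>2 = sq_norm d D" by (auto simp: g_def)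
  have "g\<^sup>2 = dlog x D" unfolding g(2) dlog_sum[of x D] by (simp add: sq_norm_def D_def power2_eq_square)
  also have "\<dots> \<le> L * g" using dlog_bound[OF x, of D] by (simp add: g_def)
  finally have "g * g \<le> L * g" by (simp add: power2_eq_square)
  then have "g \<le> L" using g(1) L_nonneg by (cases "g = 0") auto
  then have "g\<^sup>2 \<le> L\<^sup>2" using g(1) by (intro power_mono)
  then show ?thesis by (simp add: g(2) sq_norm_def D_def)
qed

lemma rho_bound:
  assumes x: "sq_norm d x \<le> A\<^sup>2 * real d"
  shows "\<rho> x \<le> gc / Z * (exp (A\<^sup>2 * real d / 2) * (\<pi>0 p * exp (C * real d)))"
proof -
  have \<theta>: "\<Phi> x \<in> Theta d" by (rule std_map_Theta[OF x])
  have "unnorm (\<Phi> x) \<le> \<pi>0 p * exp (C * real d)"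
    by (rule order_trans[OF unnorm_le_prior prior_bound[OF \<theta>]]) (rule std_map_Rd)
  then show ?thesis
    unfolding \<rho>_def W_def using gc_pos Z_pos x unnorm_nonneg
    by (intro mult_left_mono mult_mono) auto
qed

lemma rho_near_1:
  assumes e: "0 < e" and small: "4 * R\<^sup>2 / A\<^sup>2 + \<tau> + 32 / A\<^sup>2 + L\<^sup>2 / 2 \<le> e\<^sup>2 / 8"
  shows "(\<integral>x. \<bar>\<rho> x - 1\<bar> \<partial>G) \<le> e"
proof (rule stdN_prod_density_near_1[where I="{1..d}" and d="real d" and \<rho>=\<rho> and A=A and R=R and L=L and \<tau>=\<tau>
      and b="gc / Z * (exp (A\<^sup>2 * real d / 2) * (\<pi>0 p * exp (C * real d)))" and D="\<lambda>i x. dlog x (unit_dir i)"])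
  show "0 < \<rho> x" if "x \<in> extensional {1..d}" "(\<Sum>i\<in>{1..d}. (x i)\<^sup>2) \<le> A\<^sup>2 * real d" for x
  proof -
    have x: "sq_norm d x \<le> A\<^sup>2 * real d" using that by (simp add: sq_norm_def)
    show ?thesis using likelihood_pos[OF x] gc_pos Z_pos by (simp add: \<rho>_def W_eq_likelihood[OF std_map_Theta[OF x]])
  qed
  show "\<rho> x \<le> gc / Z * (exp (A\<^sup>2 * real d / 2) * (\<pi>0 p * exp (C * real d)))"
    if "x \<in> extensional {1..d}" "(\<Sum>i\<in>{1..d}. (x i)\<^sup>2) \<le> A\<^sup>2 * real d" for x
    using that by (intro rho_bound) (simp add: sq_norm_def)
  show "((\<lambda>t. \<rho> (x(i := t))) has_real_derivative \<rho> x * dlog x (unit_dir i)) (at (x i))"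
    if "i \<in> {1..d}" "x \<in> extensional {1..d}" "(\<Sum>i\<in>{1..d}. (x i)\<^sup>2) \<le> A\<^sup>2 * real d" for i x
    using that(3) by (intro rho_derivative that(1,2)) (simp add: sq_norm_def)
  show "(\<Sum>i\<in>{1..d}. (dlog x (unit_dir i))\<^sup>2) \<le> L\<^sup>2"
    if "x \<in> extensional {1..d}" "(\<Sum>i\<in>{1..d}. (x i)\<^sup>2) \<le> A\<^sup>2 * real d" for x
    using that(2) by (intro rho_grad) (simp add: sq_norm_def)
qed (use d1 R16 RA A1 L_nonneg e small rho_nonneg rho_nn_integral rho_tail rho_measurable in \<open>auto simp: \<tau>_def\<close>)

text \<open>In standardized coordinates both measures of a set become Gaussian integrals over the
  same preimage, with weights \<open>\<rho>\<close> and 1, so they differ by at most the distance of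
  \<open>\<rho>\<close> from 1 in mean.\<close>

lemma TV_le:
  assumes e: "0 < e" and small: "4 * R\<^sup>2 / A\<^sup>2 + \<tau> + 32 / A\<^sup>2 + L\<^sup>2 / 2 \<le> e\<^sup>2 / 8"
  shows "TV (posterior n d \<pi>0 N) (gamma_star n d p N) \<le> e"
proof -
  interpret prob_space G by (rule prob_space_stdN_prod)
  have sets_post: "sets (posterior n d \<pi>0 N) = sets (lebesgue_Rd d)" by (simp add: posterior_eq)
  have \<rho>i: "integrable G \<rho>"
  proof -
    have "has_bochner_integral G \<rho> 1"
      using rho_nn_integral rho_nonneg by (intro has_bochner_integral_nn_integral rho_measurable) auto
    then show ?thesis by (simp add: has_bochner_integral_iff)
  qed
  have "\<bar>measure (posterior n d \<pi>0 N) B - measure (gamma_star n d p N) B\<bar> \<le> e" if B: "B \<in> sets (lebesgue_Rd d)" for B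
  proof -
    note [measurable] = B
    have \<Phi>m: "\<Phi> \<in> measurable G (lebesgue_Rd d)"
      using std_map_measurable measurable_cong_sets[OF sets_stdN_prod_eq refl] by blast
    have ind[measurable]: "(\<lambda>x. indicator B (\<Phi> x) :: real) \<in> borel_measurable G"
      by (rule measurable_compose[OF \<Phi>m]) measurable
    have m: "(\<lambda>x. \<rho> x * indicator B (\<Phi> x)) \<in> borel_measurable G"
      by (rule borel_measurable_times[OF rho_measurable ind])
    have i1: "integrable G (\<lambda>x. \<rho> x * indicator B (\<Phi> x))"
      by (rule Bochner_Integration.integrable_bound[OF \<rho>i m]) (auto split: split_indicator)
    have i2: "integrable G (\<lambda>x. indicator B (\<Phi> x) :: real)"
      by (intro integrable_const_bound[of _ 1] ind) (auto split: split_indicator)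
    have "emeasure (posterior n d \<pi>0 N) B = (\<integral>\<^sup>+ \<theta>. ennreal (unnorm \<theta> / Z) * indicator B \<theta> \<partial>lebesgue_Rd d)"
      unfolding posterior_eq by (rule emeasure_density) measurable
    also have "\<dots> = (\<integral>\<^sup>+ x. ennreal (gc * exp ((\<Sum>i\<in>{1..d}. (x i)\<^sup>2) / 2)) * (ennreal (unnorm (\<Phi> x) / Z) * indicator B (\<Phi> x)) \<partial>G)"
      by (rule nn_integral_lebesgue_Rd_std[OF p n_pos]) measurable
    also have "\<dots> = (\<integral>\<^sup>+ x. ennreal (\<rho> x * indicator B (\<Phi> x)) \<partial>G)"
      using gc_pos Z_pos unnorm_nonneg
      by (intro nn_integral_cong) (auto simp: \<rho>_def W_def sq_norm_def ennreal_mult[symmetric] split: split_indicator)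
    also have "\<dots> = ennreal (\<integral>x. \<rho> x * indicator B (\<Phi> x) \<partial>G)"
      using rho_nonneg by (intro nn_integral_eq_integral[OF i1]) auto
    finally have P: "measure (posterior n d \<pi>0 N) B = (\<integral>x. \<rho> x * indicator B (\<Phi> x) \<partial>G)"
      using rho_nonneg by (simp add: measure_def)
    have "emeasure (gamma_star n d p N) B = (\<integral>\<^sup>+ \<theta>. indicator B \<theta> \<partial>gamma_star n d p N)"
      by (rule nn_integral_indicator[symmetric]) (simp add: gamma_star_def mvn_def)
    also have "\<dots> = (\<integral>\<^sup>+ x. indicator B (\<Phi> x) \<partial>G)"
      unfolding gamma_star_def mle_eq by (rule nn_integral_mvn[OF p n_pos]) measurable
    also have "\<dots> = (\<integral>\<^sup>+ x. ennreal (indicator B (\<Phi> x)) \<partial>G)" by (simp add: ennreal_indicator)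
    also have "\<dots> = ennreal (\<integral>x. indicator B (\<Phi> x) \<partial>G)"
      by (rule nn_integral_eq_integral[OF i2]) auto
    finally have Q: "measure (gamma_star n d p N) B = (\<integral>x. indicator B (\<Phi> x) \<partial>G)"
      by (simp add: measure_def)
    have "\<bar>measure (posterior n d \<pi>0 N) B - measure (gamma_star n d p N) B\<bar>
        = \<bar>\<integral>x. \<rho> x * indicator B (\<Phi> x) - indicator B (\<Phi> x) \<partial>G\<bar>"
      unfolding P Q using i1 i2 by simp
    also have "\<dots> \<le> (\<integral>x. \<bar>\<rho> x * indicator B (\<Phi> x) - indicator B (\<Phi> x)\<bar> \<partial>G)"
      by (rule integral_abs_bound)
    also have "\<dots> \<le> (\<integral>x. \<bar>\<rho> x - 1\<bar> \<partial>G)"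
      by (intro integral_mono Bochner_Integration.integrable_diff integrable_abs i1 i2 \<rho>i integrable_const)
        (auto split: split_indicator)
    also have "\<dots> \<le> e" by (rule rho_near_1[OF e small])
    finally show ?thesis .
  qed
  then show ?thesis
    unfolding TV_def sets_post by (intro cSUP_least) auto
qed

end

section \<open>Asymptotics\<close>

text \<open>\<open>multinomial_counts\<close> constrains only the coordinates \<open>0..d\<close>,
  so the counts are restricted before being compared with the finitely many admissible count
  vectors.\<close>

lemma multinomial_counts_prob:
  assumes M: "prob_space M" and counts: "multinomial_counts M N n d p" and K: "K \<subseteq> compositions {0..d} n"
  shows "{\<omega> \<in> space M. restrict (N \<omega>) {0..d} \<in> K} \<in> sets M"
    and "measure M {\<omega> \<in> space M. restrict (N \<omega>) {0..d} \<in> K} = (\<Sum>k\<in>K. multinomial_pmf {0..d} n p k)"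
proof -
  interpret prob_space M by (rule M)
  have Nm[measurable]: "(\<lambda>\<omega>. N \<omega> j) \<in> measurable M (count_space UNIV)" if "j \<in> {0..d}" for j
    using counts that by (simp add: multinomial_counts_def)
  define E where "E k = {\<omega> \<in> space M. \<forall>j\<in>{0..d}. N \<omega> j = k j}" for k
  have Em: "E k \<in> sets M" for k
    unfolding E_def
  proof (intro sets.sets_Collect_finite_All')
    show "{\<omega> \<in> space M. N \<omega> j = k j} \<in> sets M" if "j \<in> {0..d}" for j
      using Nm[OF that] by measurable
  qed auto
  have fin: "finite K" using K finite_compositions[of "{0..d}" n] finite_subset by auto
  have eq: "{\<omega> \<in> space M. restrict (N \<omega>) {0..d} \<in> K} = (\<Union>k\<in>K. E k)"
  proof (intro equalityI subsetI)
    fix \<omega> assume "\<omega> \<in> {\<omega> \<in> space M. restrict (N \<omega>) {0..d} \<in> K}"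
    then show "\<omega> \<in> (\<Union>k\<in>K. E k)" by (auto simp: E_def intro!: bexI[of _ "restrict (N \<omega>) {0..d}"])
  next
    fix \<omega> assume "\<omega> \<in> (\<Union>k\<in>K. E k)"
    then obtain k where k: "k \<in> K" "\<omega> \<in> E k" by auto
    then have "restrict (N \<omega>) {0..d} = k"
      using K by (auto simp: E_def compositions_def extensional_def fun_eq_iff)
    then show "\<omega> \<in> {\<omega> \<in> space M. restrict (N \<omega>) {0..d} \<in> K}" using k by (simp add: E_def)
  qed
  show "{\<omega> \<in> space M. restrict (N \<omega>) {0..d} \<in> K} \<in> sets M"
    unfolding eq using fin Em by (intro sets.finite_UN) auto
  have "measure M (\<Union>k\<in>K. E k) = (\<Sum>k\<in>K. measure M (E k))"
  proof (rule finite_measure_finite_Union[OF fin])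
    show "disjoint_family_on E K"
    proof (unfold disjoint_family_on_def, intro ballI impI)
      fix k l assume kl: "k \<in> K" "l \<in> K" "k \<noteq> l"
      obtain j where j: "j \<in> {0..d}" "k j \<noteq> l j"
        using kl K extensionalityI[of k "{0..d}" l] by (auto simp: compositions_def)
      then show "E k \<inter> E l = {}" by (auto simp: E_def)
    qed
  qed (use Em in auto)
  also have "\<dots> = (\<Sum>k\<in>K. multinomial_pmf {0..d} n p k)"
    using K counts by (intro sum.cong) (auto simp: E_def multinomial_counts_def multinomial_pmf_def compositions_def)
  finally show "measure M {\<omega> \<in> space M. restrict (N \<omega>) {0..d} \<in> K} = (\<Sum>k\<in>K. multinomial_pmf {0..d} n p k)"
    unfolding eq .
qed

lemma nll_restrict: "nll n d (restrict N {0..d}) = nll n d N"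
  by (auto simp: nll_def fun_eq_iff)

lemma is_mle_restrict: "is_mle n d (restrict N {0..d}) = is_mle n d N"
  by (simp add: is_mle_def nll_restrict)

lemma TV_restrict:
  "TV (posterior n d \<pi>0 (restrict N {0..d})) (gamma_star n d p (restrict N {0..d})) = TV (posterior n d \<pi>0 N) (gamma_star n d p N)"
  by (simp add: posterior_def gamma_star_def mle_def is_mle_restrict nll_restrict)

text \<open>Collects the deterministic part with explicit constants. \<open>\<kappa>\<close> is only
  an upper bound for the dimension ratio, so that one small number can later serve for it and for
  \<open>\<eta>\<close>.\<close>

lemma posterior_TV_le:
  assumes n1: "1 \<le> n" and d1: "1 \<le> d" and p: "p \<in> Theta d" and prior: "prior_density d \<pi>0"
    and sumN: "(\<Sum>j\<in>{0..d}. N j) = n" and s0: "0 \<le> s"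
    and chi_square: "(\<Sum>j\<in>{0..d}. (real (N j) / real n - cell d p j)\<^sup>2 / cell d p j) \<le> s\<^sup>2 * real d / real n"
    and C0: "0 \<le> C" and prior_bound: "\<And>\<theta>. \<theta> \<in> Theta d \<Longrightarrow> \<pi>0 \<theta> \<le> \<pi>0 p * exp (C * real d)"
    and R: "16 \<le> R" "C + 1 \<le> R\<^sup>2 / 16" and A: "R \<le> A" "s \<le> A"
    and \<eta>: "0 \<le> \<eta>" "delta01 n d p \<pi>0 (2 * A) \<le> ereal (\<eta> * sqrt (real n))"
    and \<kappa>: "(real d)\<^sup>2 / (real n * theta_min d p) \<le> \<kappa>" "64 * A\<^sup>2 * \<kappa> \<le> 1"
    and L: "\<eta> * s + 2 * (sqrt (8 * \<kappa>) * A\<^sup>2 + \<eta>) \<le> 1"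
    and e: "0 < e" and small: "4 * R\<^sup>2 / A\<^sup>2 + 2 * exp (C + 1 - R\<^sup>2 / 16) + 32 / A\<^sup>2 + (sqrt (8 * \<kappa>) * A\<^sup>2 + \<eta>)\<^sup>2 / 2 \<le> e\<^sup>2 / 8"
  shows "(\<exists>!\<theta>. is_mle n d N \<theta>) \<and> TV (posterior n d \<pi>0 N) (gamma_star n d p N) \<le> e"
proof -
  let ?k = "(real d)\<^sup>2 / (real n * theta_min d p)"
  have sk: "sqrt (8 * ?k) * A\<^sup>2 + \<eta> \<le> sqrt (8 * \<kappa>) * A\<^sup>2 + \<eta>"
    using \<kappa>(1) by (intro add_right_mono mult_right_mono real_sqrt_le_mono mult_left_mono) auto
  interpret multinomial_fit d n p N s A
  proof
    show "64 * A\<^sup>2 * ((real d)\<^sup>2 / (real n * theta_min d p)) \<le> 1"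
      by (rule order_trans[OF mult_left_mono[OF \<kappa>(1)] \<kappa>(2)]) simp
  qed (use assms in auto)
  interpret multinomial_posterior d n p N s A \<pi>0 C \<eta> R
  proof
    show "\<eta> * s + 2 * (sqrt (8 * ((real d)\<^sup>2 / (real n * theta_min d p))) * A\<^sup>2 + \<eta>) \<le> 1"
      by (rule order_trans[OF add_left_mono[OF mult_left_mono[OF sk]] L]) simp
  qed (use assms in auto)
  have "L\<^sup>2 \<le> (sqrt (8 * \<kappa>) * A\<^sup>2 + \<eta>)\<^sup>2"
    using sk L_nonneg by (intro power_mono) (simp_all add: L_def \<kappa>_def)
  then have "TV (posterior n d \<pi>0 N) (gamma_star n d p N) \<le> e"
    using small by (intro TV_le[OF e]) (simp add: \<tau>_def)
  moreover have "\<exists>!\<theta>. is_mle n d N \<theta>" by (simp add: mle_unique)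
  ultimately show ?thesis by simp
qed

text \<open>A finite \<open>M0\<close> excludes its default value infinity, so the supremum in its
  definition is a genuine one.\<close>

lemma M0_prior_bound:
  assumes d1: "1 \<le> d" and p: "p \<in> Theta d" and prior: "prior_density d \<pi>0"
    and M: "\<bar>M0 d p \<pi>0\<bar> \<le> ereal C" and \<theta>: "\<theta> \<in> Theta d"
  shows "\<pi>0 \<theta> \<le> \<pi>0 p * exp (C * real d)"
proof -
  have bdd: "bdd_above (\<pi>0 ` Theta d)" using M by (auto simp: M0_def split: if_splits)
  define S where "S = (SUP \<theta>\<in>Theta d. \<pi>0 \<theta>)"
  have pp: "0 < \<pi>0 p" using p prior by (simp add: prior_density_def)
  have S: "\<pi>0 p \<le> S" "\<pi>0 \<theta> \<le> S" unfolding S_def using p \<theta> bdd by (auto intro: cSUP_upper)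
  have "\<bar>ln (S / \<pi>0 p) / real d\<bar> \<le> C"
    using M bdd by (simp add: M0_def S_def)
  then have "ln (S / \<pi>0 p) / real d \<le> C" by (rule abs_le_D1)
  then have "ln (S / \<pi>0 p) \<le> C * real d" using d1 by (simp add: pos_divide_le_eq)
  then have "exp (ln (S / \<pi>0 p)) \<le> exp (C * real d)" by simp
  then have "S / \<pi>0 p \<le> exp (C * real d)" using pp S by simp
  then show ?thesis using pp S(2) by (simp add: pos_divide_le_eq mult.commute)
qed

text \<open>Choice of the radii: first \<open>R\<close> to absorb the prior's growth in the tail, then \<open>A\<close>.\<close>

lemma ex_radii:
  assumes "0 < (e::real)"
  shows "\<exists>R A. 16 \<le> R \<and> C + 1 \<le> R\<^sup>2 / 16 \<and> R \<le> A \<and> s \<le> A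
    \<and> 4 * R\<^sup>2 / A\<^sup>2 + 2 * exp (C + 1 - R\<^sup>2 / 16) + 32 / A\<^sup>2 < e"
proof -
  have "((\<lambda>R. 2 * exp (C + 1 - R\<^sup>2 / 16)) \<longlongrightarrow> 0) at_top" by real_asymp
  then have "\<forall>\<^sub>F R in at_top. 2 * exp (C + 1 - R\<^sup>2 / 16) < e / 2"
    using assms by (intro order_tendstoD(2)) auto
  moreover have "filterlim (\<lambda>R::real. R\<^sup>2 / 16) at_top at_top" by real_asymp
  then have "\<forall>\<^sub>F R in at_top. C + 1 \<le> R\<^sup>2 / 16" unfolding filterlim_at_top by blast
  ultimately have "\<forall>\<^sub>F R in at_top. 2 * exp (C + 1 - R\<^sup>2 / 16) < e / 2 \<and> C + 1 \<le> R\<^sup>2 / 16 \<and> 16 \<le> R"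
    using eventually_ge_at_top[of 16] by eventually_elim auto
  then obtain R where R: "2 * exp (C + 1 - R\<^sup>2 / 16) < e / 2" "C + 1 \<le> R\<^sup>2 / 16" "16 \<le> R"
    using eventually_happens'[OF trivial_limit_at_top_linorder] by blast
  have "((\<lambda>A. 4 * R\<^sup>2 / A\<^sup>2 + 32 / A\<^sup>2) \<longlongrightarrow> 0) at_top" by real_asymp
  then have "\<forall>\<^sub>F A in at_top. 4 * R\<^sup>2 / A\<^sup>2 + 32 / A\<^sup>2 < e / 2"
    using assms by (intro order_tendstoD(2)) auto
  then have "\<forall>\<^sub>F A in at_top. 4 * R\<^sup>2 / A\<^sup>2 + 32 / A\<^sup>2 < e / 2 \<and> R \<le> A \<and> s \<le> A"
    using eventually_ge_at_top[of R] eventually_ge_at_top[of s] by eventually_elim auto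
  then obtain A where "4 * R\<^sup>2 / A\<^sup>2 + 32 / A\<^sup>2 < e / 2" "R \<le> A" "s \<le> A"
    using eventually_happens'[OF trivial_limit_at_top_linorder] by blast
  with R show ?thesis by (intro exI[of _ R] exI[of _ A]) auto
qed

theorem corollary5p8:
  fixes d :: "nat \<Rightarrow> nat"
    and \<theta>s :: "nat \<Rightarrow> nat \<Rightarrow> real"
    and \<pi>0 :: "nat \<Rightarrow> (nat \<Rightarrow> real) \<Rightarrow> real"
    and M :: "nat \<Rightarrow> 'a measure"
    and N :: "nat \<Rightarrow> 'a \<Rightarrow> nat \<Rightarrow> nat"
  assumes dim: "\<And>n. 1 \<le> n \<Longrightarrow> 1 \<le> d n"
    and truth: "\<And>n. 1 \<le> n \<Longrightarrow> \<theta>s n \<in> Theta (d n)"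
    and prior: "\<And>n. 1 \<le> n \<Longrightarrow> prior_density (d n) (\<pi>0 n)"
    and prob: "\<And>n. 1 \<le> n \<Longrightarrow> prob_space (M n)"
    and counts: "\<And>n. 1 \<le> n \<Longrightarrow> multinomial_counts (M n) (N n) n (d n) (cell (d n) (\<theta>s n))"
    and M0_bounded:
      "\<exists>C::real. eventually (\<lambda>n. \<bar>M0 (d n) (\<theta>s n) (\<pi>0 n)\<bar> \<le> ereal C) sequentially"
    and delta01_small:
      "\<And>s::real. 0 \<le> s \<Longrightarrow>
         (\<lambda>n. delta01 n (d n) (\<theta>s n) (\<pi>0 n) s / ereal (sqrt (real n))) \<longlonglongrightarrow> 0"
    and dim_small:
      "(\<lambda>n. (real (d n))\<^sup>2 / (real n * theta_min (d n) (\<theta>s n))) \<longlonglongrightarrow> 0"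
  shows "\<forall>\<epsilon>::real. 0 < \<epsilon> \<longrightarrow>
    (\<lambda>n. measure (M n)
       {\<omega> \<in> space (M n). (\<exists>!\<theta>. is_mle n (d n) (N n \<omega>) \<theta>) \<and>
          TV (posterior n (d n) (\<pi>0 n) (N n \<omega>)) (gamma_star n (d n) (\<theta>s n) (N n \<omega>)) \<le> \<epsilon>})
      \<longlonglongrightarrow> 1"
proof (intro allI impI)
  fix \<epsilon> :: real assume \<epsilon>: "0 < \<epsilon>"
  define good where "good n k \<longleftrightarrow> (\<exists>!\<theta>. is_mle n (d n) k \<theta>) \<and>
      TV (posterior n (d n) (\<pi>0 n) k) (gamma_star n (d n) (\<theta>s n) k) \<le> \<epsilon>" for n k
  have good_restrict: "good n (restrict k {0..d n}) \<longleftrightarrow> good n k" for n k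
    by (simp add: good_def is_mle_restrict TV_restrict)
  obtain C' where C': "eventually (\<lambda>n. \<bar>M0 (d n) (\<theta>s n) (\<pi>0 n)\<bar> \<le> ereal C') sequentially"
    using M0_bounded by blast
  \<comment> \<open>The deterministic estimate requires a nonnegative constant.\<close>
  define C where "C = max 0 C'"
  have C: "eventually (\<lambda>n. \<bar>M0 (d n) (\<theta>s n) (\<pi>0 n)\<bar> \<le> ereal C) sequentially"
    using C' by eventually_elim (auto simp: C_def intro: order_trans)
  have main: "\<forall>\<^sub>F n in sequentially. 1 - \<delta> \<le> measure (M n) {\<omega> \<in> space (M n). good n (N n \<omega>)}"
    if \<delta>: "0 < \<delta>" for \<delta> :: real
  proof -
    \<comment> \<open>Makes the chi-square event fail with probability at most
      \<open>\<delta>\<close>, uniformly in the dimension.\<close>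
    define s where "s = 1 / sqrt \<delta>"
    have s: "0 < s" "s\<^sup>2 = 1 / \<delta>" using \<delta> by (auto simp: s_def power_divide)
    obtain R A where R: "16 \<le> R" "C + 1 \<le> R\<^sup>2 / 16" and A: "R \<le> A" "s \<le> A"
      and RA: "4 * R\<^sup>2 / A\<^sup>2 + 2 * exp (C + 1 - R\<^sup>2 / 16) + 32 / A\<^sup>2 < \<epsilon>\<^sup>2 / 16"
      using ex_radii[of "\<epsilon>\<^sup>2 / 16" C s] \<epsilon> by auto
    \<comment> \<open>With the radii fixed, all remaining constraints on the common bound
      \<open>t\<close> for \<open>\<kappa>\<close> and \<open>\<eta>\<close> hold near 0, so one
      positive \<open>t\<close> meets them all.\<close>
    have "((\<lambda>t. t * s + 2 * (sqrt (8 * t) * A\<^sup>2 + t)) \<longlongrightarrow> 0 * s + 2 * (sqrt (8 * 0) * A\<^sup>2 + 0)) (at_right 0)"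
      by (intro tendsto_intros)
    then have e1: "\<forall>\<^sub>F t in at_right 0. t * s + 2 * (sqrt (8 * t) * A\<^sup>2 + t) < 1"
      by (intro order_tendstoD(2)) auto
    have "((\<lambda>t. (sqrt (8 * t) * A\<^sup>2 + t)\<^sup>2 / 2) \<longlongrightarrow> (sqrt (8 * 0) * A\<^sup>2 + 0)\<^sup>2 / 2) (at_right 0)"
      by (intro tendsto_intros) auto
    then have e2: "\<forall>\<^sub>F t in at_right 0. (sqrt (8 * t) * A\<^sup>2 + t)\<^sup>2 / 2 < \<epsilon>\<^sup>2 / 16"
      using \<epsilon> by (intro order_tendstoD(2)) auto
    have "((\<lambda>t. 64 * A\<^sup>2 * t) \<longlongrightarrow> 64 * A\<^sup>2 * 0) (at_right 0)"
      by (intro tendsto_intros)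
    then have e3: "\<forall>\<^sub>F t in at_right 0. 64 * A\<^sup>2 * t < 1"
      by (intro order_tendstoD(2)) auto
    have "\<forall>\<^sub>F t in at_right (0::real). 0 < t" by (simp add: eventually_at_right_less)
    with e1 e2 e3 have "\<forall>\<^sub>F t in at_right 0. 0 < t \<and> t * s + 2 * (sqrt (8 * t) * A\<^sup>2 + t) < 1
        \<and> (sqrt (8 * t) * A\<^sup>2 + t)\<^sup>2 / 2 < \<epsilon>\<^sup>2 / 16 \<and> 64 * A\<^sup>2 * t < 1"
      by eventually_elim auto
    then obtain t where t: "0 < t" "t * s + 2 * (sqrt (8 * t) * A\<^sup>2 + t) < 1"
        "(sqrt (8 * t) * A\<^sup>2 + t)\<^sup>2 / 2 < \<epsilon>\<^sup>2 / 16" "64 * A\<^sup>2 * t < 1"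
      using eventually_happens'[OF trivial_limit_at_right_real] by blast
    have "0 \<le> 2 * A" using R A by simp
    from order_tendstoD(2)[OF delta01_small[OF this], of "ereal t"]
    have d1: "\<forall>\<^sub>F n in sequentially. delta01 n (d n) (\<theta>s n) (\<pi>0 n) (2 * A) / ereal (sqrt (real n)) < ereal t"
      using t by (simp add: zero_ereal_def)
    have d2: "\<forall>\<^sub>F n in sequentially. (real (d n))\<^sup>2 / (real n * theta_min (d n) (\<theta>s n)) < t"
      using t by (intro order_tendstoD(2)[OF dim_small]) auto
    show ?thesis
      using d1 d2 C eventually_ge_at_top[of 1]
    proof eventually_elim
      case (elim n)
      note n = elim(4)
      let ?q = "cell (d n) (\<theta>s n)"
      define K where "K = {k \<in> compositions {0..d n} n. (\<Sum>j\<in>{0..d n}. (real (k j) / real n - ?q j)\<^sup>2 / ?q j) \<le> s\<^sup>2 * real (d n) / real n}"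
      define K' where "K' = {k \<in> compositions {0..d n} n. good n k}"
      have dn: "1 \<le> d n" by (rule dim[OF n])
      have "delta01 n (d n) (\<theta>s n) (\<pi>0 n) (2 * A) \<le> ereal t * ereal (sqrt (real n))"
        using elim(1) n by (intro less_imp_le) (simp add: ereal_divide_less_iff mult.commute)
      then have delta: "delta01 n (d n) (\<theta>s n) (\<pi>0 n) (2 * A) \<le> ereal (t * sqrt (real n))" by simp
      have "good n k" if k: "k \<in> K" for k
        unfolding good_def
      proof (rule posterior_TV_le[where s=s and C=C and R=R and A=A and \<eta>=t and \<kappa>=t])
        show "(\<Sum>j\<in>{0..d n}. k j) = n" using k by (simp add: K_def compositions_def)
        show "(\<Sum>j\<in>{0..d n}. (real (k j) / real n - ?q j)\<^sup>2 / ?q j) \<le> s\<^sup>2 * real (d n) / real n"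
          using k by (simp add: K_def)
        show "\<pi>0 n \<theta> \<le> \<pi>0 n (\<theta>s n) * exp (C * real (d n))" if "\<theta> \<in> Theta (d n)" for \<theta>
          by (rule M0_prior_bound[OF dn truth[OF n] prior[OF n] elim(3) that])
        show "4 * R\<^sup>2 / A\<^sup>2 + 2 * exp (C + 1 - R\<^sup>2 / 16) + 32 / A\<^sup>2 + (sqrt (8 * t) * A\<^sup>2 + t)\<^sup>2 / 2 \<le> \<epsilon>\<^sup>2 / 8"
          using RA t(3) by linarith
        show "delta01 n (d n) (\<theta>s n) (\<pi>0 n) (2 * A) \<le> ereal (t * sqrt (real n))" by (rule delta)
      qed (use n dn truth[OF n] prior[OF n] s R A t elim(2) \<epsilon> in \<open>auto simp: C_def\<close>)
      then have sub: "K \<subseteq> K'" by (auto simp: K_def K'_def)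
      have Kc: "K \<subseteq> compositions {0..d n} n" by (auto simp: K_def)
      have q1: "(\<Sum>j\<in>{0..d n}. ?q j) = 1" by (rule sum_cell)
      have "1 - (real (card {0..d n}) - 1) / (real n * (s\<^sup>2 * real (d n) / real n)) \<le> (\<Sum>k\<in>K. multinomial_pmf {0..d n} n ?q k)"
        unfolding K_def using n dn s \<delta> cell_pos[OF truth[OF n]] by (intro multinomial_chi_square_tail q1) auto
      moreover have "(real (card {0..d n}) - 1) / (real n * (s\<^sup>2 * real (d n) / real n)) = \<delta>"
        using n dn s(1) \<delta> by (simp add: s(2))
      moreover have "(\<Sum>k\<in>K. multinomial_pmf {0..d n} n ?q k) = measure (M n) {\<omega> \<in> space (M n). restrict (N n \<omega>) {0..d n} \<in> K}"
        by (rule multinomial_counts_prob(2)[OF prob[OF n] counts[OF n] Kc, symmetric])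
      moreover have "measure (M n) {\<omega> \<in> space (M n). restrict (N n \<omega>) {0..d n} \<in> K}
          \<le> measure (M n) {\<omega> \<in> space (M n). good n (N n \<omega>)}"
      proof -
        interpret prob_space "M n" by (rule prob[OF n])
        have Nm: "(\<lambda>\<omega>. N n \<omega> j) \<in> measurable (M n) (count_space UNIV)" if "j \<in> {0..d n}" for j
          using counts[OF n] that by (simp add: multinomial_counts_def)
        \<comment> \<open>The good event must be measurable before monotonicity applies. It depends
          on finitely many integer counts only, and every set of count vectors is measurable in the
          discrete product.\<close>
        have "(\<lambda>\<omega>. restrict (N n \<omega>) {0..d n}) \<in> measurable (M n) (PiM {0..d n} (\<lambda>_. count_space UNIV))"
          by (intro measurable_restrict Nm)
        moreover have "PiM {0..d n} (\<lambda>_. count_space (UNIV :: nat set)) = count_space (PiE {0..d n} (\<lambda>_. UNIV))"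
          by (rule count_space_PiM_finite) auto
        ultimately have "(\<lambda>\<omega>. restrict (N n \<omega>) {0..d n}) \<in> measurable (M n) (count_space (PiE {0..d n} (\<lambda>_. UNIV)))"
          by simp
        from measurable_sets[OF this, of "{k \<in> PiE {0..d n} (\<lambda>_. UNIV). good n k}"]
        have "(\<lambda>\<omega>. restrict (N n \<omega>) {0..d n}) -` {k \<in> PiE {0..d n} (\<lambda>_. UNIV). good n k} \<inter> space (M n) \<in> sets (M n)"
          by auto
        also have "(\<lambda>\<omega>. restrict (N n \<omega>) {0..d n}) -` {k \<in> PiE {0..d n} (\<lambda>_. UNIV). good n k} \<inter> space (M n)
            = {\<omega> \<in> space (M n). good n (N n \<omega>)}"
          by (auto simp: good_restrict)
        finally show ?thesis
          using sub by (intro finite_measure_mono) (auto simp: K'_def good_restrict)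
      qed
      ultimately show ?case by linarith
    qed
  qed
  have "(\<lambda>n. measure (M n) {\<omega> \<in> space (M n). good n (N n \<omega>)}) \<longlonglongrightarrow> 1"
  proof (rule order_tendstoI)
    fix a :: real assume "a < 1"
    \<comment> \<open>Half the gap, so that \<open>1 - \<delta>\<close> exceeds \<open>a\<close>
      strictly.\<close>
    then have "0 < (1 - a) / 2" by simp
    from main[OF this] show "\<forall>\<^sub>F n in sequentially. a < measure (M n) {\<omega> \<in> space (M n). good n (N n \<omega>)}"
      by eventually_elim (use \<open>a < 1\<close> in \<open>simp add: field_simps\<close>)
  next
    fix a :: real assume a: "1 < a"
    show "\<forall>\<^sub>F n in sequentially. measure (M n) {\<omega> \<in> space (M n). good n (N n \<omega>)} < a"
      using eventually_ge_at_top[of 1]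
    proof eventually_elim
      case (elim n)
      interpret prob_space "M n" by (rule prob[OF elim])
      show ?case using prob_le_1[of "{\<omega> \<in> space (M n). good n (N n \<omega>)}"] a by linarith
    qed
  qed
  then show "(\<lambda>n. measure (M n)
       {\<omega> \<in> space (M n). (\<exists>!\<theta>. is_mle n (d n) (N n \<omega>) \<theta>) \<and>
          TV (posterior n (d n) (\<pi>0 n) (N n \<omega>)) (gamma_star n (d n) (\<theta>s n) (N n \<omega>)) \<le> \<epsilon>})
      \<longlonglongrightarrow> 1"
    by (simp add: good_def)
qed

end
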